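(* Let $A\in\mathcal{A}_{4,2}^0$ be a $4$-dimensional regular ($2$-argument) anticommutative algebra over $\mathbb{C}$. Then the following assertions are valid. (i) $A$ has precisely five $3$-dimensional subalgebras. The set of these subalgebras is a generic configuration of five hyperplanes. In particular, $A$ has a pentahedral normal form, that is, it can be reduced by a transformation belonging to $\mathrm{GL}_4$ to an algebra such that the set of its five $3$-dimensional subalgebras is the Sylvester pentahedron $x_1=0$, $x_2=0$, $x_3=0$, $x_4=0$, $x_1+x_2+x_3+x_4=0$. (ii) $A$ has neither one-dimensional nor two-dimensional ideals. (iii) The set of two-dimensional subalgebras of $A$ (a subvariety of $\mathrm{Gr}(2,4)$) is a del Pezzo surface of degree $5$ (a blowing up of $\mathbb{P}^2$ at four generic points). (iv) $A$ has precisely $10$ fans, that is, flags $V_1\subset V_3$ of $1$-dimensional and $3$-dimensional subspaces such that every intermediate two-dimensional subspace $U$, $V_1\subset U\subset V_3$, is a two-dimensional subalgebra.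
   Context: Let $V=\mathbb{C}^4$. A $2$-argument anticommutative algebra on $V$ is the space $V$ with an alternating bilinear multiplication $[\cdot,\cdot]:V\times V\to V$, i.e. a point of $\Lambda^2V^*\otimes V$. It has zero trace if $\mathrm{Tr}\,[v,\cdot\,]=0$ for all $v\in V$; $\mathcal{A}=\mathcal{A}_{4,2}^0$ denotes the vector space of zero trace algebras, an irreducible $\mathrm{GL}_4$-module. A subalgebra is a linear subspace $U$ with $[U,U]\subset U$; an ideal is a linear subspace $I$ with $[I,V]\subset I$. A configuration of five hyperplanes in $V$ is generic if the intersection of any three of them is one-dimensional and the intersection of any four of them is zero. $D$-regularity: let $S_D\subset\mathcal{A}^*$ be the closure of the $\mathrm{GL}_4$-orbit of the highest weight vector of the dual module $\mathcal{A}^*$, let $P\mathcal{D}\subset P\mathcal{A}$ be the projectively dual variety of $PS_D\subset P\mathcal{A}^*$ (the closure of the set of hyperplanes tangent to $PS_D$), and let $\mathcal{D}\subset\mathcal{A}$ be the cone over $P\mathcal{D}$. An algebra $A\in\mathcal{A}$ is $D$-regular if $A\notin\mathcal{D}$. $E$-regularity: let $Z\subset\mathrm{Gr}(3,V)\times P\mathcal{A}$ be the subvariety of pairs $(S,A)$ such that $S$ is a subalgebra of $A$, let $\tilde\pi:Z\to P\mathcal{A}$ be the projection, let $\tilde{\mathcal{E}}\subset Z$ be the set of critical points of $\tilde\pi$ (points where its differential is not surjective), $P\mathcal{E}=\tilde\pi(\tilde{\mathcal{E}})$, and let $\mathcal{E}\subset\mathcal{A}$ be the cone over $P\mathcal{E}$.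 An algebra $A\in\mathcal{A}$ is $E$-regular if $A\notin\mathcal{E}$. An algebra is regular if it is both $D$-regular and $E$-regular. *)

theory Defs
  imports "HOL-Analysis.Analysis" "HOL-Library.Function_Algebras"
begin

section \<open>Algebraic geometry in complex vector spaces\<close>

text \<open>
  A complex vector space is given by a carrier set \<open>W\<close> in a type with addition, together with
  a scalar multiplication \<open>sc\<close>. Polynomial functions on \<open>W\<close> are generated by the
  linear functionals; only their values on \<open>W\<close> are ever used.
\<close>

definition linear_functional ::
    "(complex \<Rightarrow> 'w \<Rightarrow> 'w) \<Rightarrow> 'w::ab_group_add set \<Rightarrow> ('w \<Rightarrow> complex) \<Rightarrow> bool" where
  "linear_functional sc W l \<longleftrightarrow>
     (\<forall>x\<in>W. \<forall>y\<in>W. l (x + y) = l x + l y) \<and> (\<forall>c. \<forall>x\<in>W. l (sc c x) = c * l x)"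

inductive_set polynomial_functions ::
    "(complex \<Rightarrow> 'w \<Rightarrow> 'w) \<Rightarrow> 'w::ab_group_add set \<Rightarrow> ('w \<Rightarrow> complex) set"
  for sc W where
  const: "(\<lambda>_. c) \<in> polynomial_functions sc W"
| linear: "linear_functional sc W l \<Longrightarrow> l \<in> polynomial_functions sc W"
| add: "p \<in> polynomial_functions sc W \<Longrightarrow> q \<in> polynomial_functions sc W
        \<Longrightarrow> (\<lambda>x. p x + q x) \<in> polynomial_functions sc W"
| mult: "p \<in> polynomial_functions sc W \<Longrightarrow> q \<in> polynomial_functions sc W
        \<Longrightarrow> (\<lambda>x. p x * q x) \<in> polynomial_functions sc W"

definition vanishing_polynomials ::
    "(complex \<Rightarrow> 'w \<Rightarrow> 'w) \<Rightarrow> 'w::ab_group_add set \<Rightarrow> 'w set \<Rightarrow> ('w \<Rightarrow> complex) set" where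
  "vanishing_polynomials sc W S = {p \<in> polynomial_functions sc W. \<forall>y\<in>S. p y = 0}"

definition zariski_closure ::
    "(complex \<Rightarrow> 'w \<Rightarrow> 'w) \<Rightarrow> 'w::ab_group_add set \<Rightarrow> 'w set \<Rightarrow> 'w set" where
  "zariski_closure sc W S = {x \<in> W. \<forall>p\<in>vanishing_polynomials sc W S. p x = 0}"

definition tangent_space ::
    "(complex \<Rightarrow> 'w \<Rightarrow> 'w) \<Rightarrow> 'w::ab_group_add set \<Rightarrow> 'w set \<Rightarrow> 'w \<Rightarrow> 'w set" where
  "tangent_space sc W S x =
     {v \<in> W. \<forall>p\<in>vanishing_polynomials sc W S.
        ((\<lambda>t. p (x + sc t v)) has_field_derivative 0) (at 0)}"

text \<open>
  For an irreducible variety the smooth points are those where the dimension of the Zariski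
  tangent space is minimal. A cone \<open>S\<close> is smooth at \<open>x \<noteq> 0\<close> iff its
  projectivization is smooth at the point represented by \<open>x\<close>.
\<close>

definition smooth_cone_points ::
    "(complex \<Rightarrow> 'w \<Rightarrow> 'w) \<Rightarrow> 'w::ab_group_add set \<Rightarrow> 'w set \<Rightarrow> 'w set" where
  "smooth_cone_points sc W S =
     {x \<in> S - {0}. \<forall>y\<in>S - {0}.
        vector_space.dim sc (tangent_space sc W S x) \<le> vector_space.dim sc (tangent_space sc W S y)}"

text \<open>
  Elements of the dual space are extended by zero outside \<open>W\<close>, so that they are
  determined by their restriction to \<open>W\<close>.
\<close>

definition dual_space ::
    "(complex \<Rightarrow> 'w \<Rightarrow> 'w) \<Rightarrow> 'w::ab_group_add set \<Rightarrow> ('w \<Rightarrow> complex) set" where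
  "dual_space sc W = {\<phi>. linear_functional sc W \<phi> \<and> (\<forall>x. x \<notin> W \<longrightarrow> \<phi> x = 0)}"

definition dual_scale :: "complex \<Rightarrow> ('w \<Rightarrow> complex) \<Rightarrow> 'w \<Rightarrow> complex" where
  "dual_scale c \<phi> = (\<lambda>x. c * \<phi> x)"

text \<open>
  For a cone \<open>S\<close> in the dual space of \<open>W\<close>, the cone in \<open>W\<close> over the projectively
  dual variety of the projectivization of \<open>S\<close>. A point \<open>a \<noteq> 0\<close> of \<open>W\<close>
  represents the hyperplane of all \<open>\<psi>\<close> with \<open>\<psi> a = 0\<close>; it is tangent at the point
  represented by \<open>\<phi>\<close> if it contains the tangent space of the cone at \<open>\<phi>\<close>.
  Since the set under the closure is a cone, its closure in \<open>W\<close> is the cone over the closure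
  in projective space.
\<close>

definition projective_dual_cone ::
    "(complex \<Rightarrow> 'w \<Rightarrow> 'w) \<Rightarrow> 'w::ab_group_add set \<Rightarrow> ('w \<Rightarrow> complex) set \<Rightarrow> 'w set" where
  "projective_dual_cone sc W S =
     zariski_closure sc W
       {a \<in> W. \<exists>\<phi>\<in>smooth_cone_points dual_scale (dual_space sc W) S.
          \<forall>\<psi>\<in>tangent_space dual_scale (dual_space sc W) S \<phi>. \<psi> a = 0}"


section \<open>Grassmannians and multiprojective varieties\<close>

text \<open>
  The matrix \<open>B\<close> has the vectors of a basis of a subspace of dimension \<open>CARD('k)\<close> as its
  columns. Its Pluecker vector consists of the minors for all choices \<open>s\<close> of \<open>CARD('k)\<close>
  rows; repeated and reordered rows are allowed, so the vector is the full antisymmetric tensor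
  representing the exterior product of the columns.
\<close>

definition plucker :: "complex^'k::finite^'n::finite \<Rightarrow> complex^('k \<Rightarrow> 'n)" where
  "plucker B = (\<chi> s. det (\<chi> i. B $ s i))"

definition column_span :: "complex^'k::finite^'n::finite \<Rightarrow> (complex^'n) set" where
  "column_span B = range (\<lambda>x. B *v x)"

definition plucker_line :: "(complex^'n::finite) set \<Rightarrow> (complex^('k::finite \<Rightarrow> 'n)) set" where
  "plucker_line U = vec.span {plucker B | B :: complex^'k^'n. column_span B = U}"

text \<open>
  Points of a product of projective spaces, indexed by \<open>'i\<close>, are families of lines in
  \<open>complex^'n\<close>.
\<close>

type_synonym ('i, 'n) mpoint = "'i \<Rightarrow> (complex^'n) set"

definition multiprojective_space :: "('i, 'n::finite) mpoint set" where
  "multiprojective_space = {P. \<forall>i. vec.subspace (P i) \<and> vec.dim (P i) = 1}"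

definition represents :: "complex^'n::finite^'i::finite \<Rightarrow> ('i, 'n) mpoint \<Rightarrow> bool" where
  "represents x P \<longleftrightarrow> (\<forall>i. x $ i \<noteq> 0 \<and> x $ i \<in> P i)"

definition multihomogeneous :: "('i \<Rightarrow> nat) \<Rightarrow> (complex^'n::finite^'i::finite \<Rightarrow> complex) \<Rightarrow> bool" where
  "multihomogeneous d p \<longleftrightarrow>
     p \<in> polynomial_functions (\<lambda>c x. \<chi> i. c *s x $ i) UNIV \<and>
     (\<forall>t x. p (\<chi> i. t i *s x $ i) = (\<Prod>i\<in>UNIV. t i ^ d i) * p x)"

definition projective_variety :: "('i::finite, 'n::finite) mpoint set \<Rightarrow> bool" where
  "projective_variety X \<longleftrightarrow>
     (\<exists>E :: (complex^'n^'i \<Rightarrow> complex) set.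
        (\<forall>p\<in>E. \<exists>d. multihomogeneous d p) \<and>
        X = {P \<in> multiprojective_space. \<forall>p\<in>E. \<forall>x. represents x P \<longrightarrow> p x = 0})"

text \<open>
  A map is regular if near every point each of its components is given, in homogeneous
  coordinates, by multihomogeneous polynomials of a common multidegree which do not vanish
  simultaneously.
\<close>

definition regular_map ::
    "('i::finite, 'n::finite) mpoint set \<Rightarrow> ('j::finite, 'm::finite) mpoint set
      \<Rightarrow> (('i, 'n) mpoint \<Rightarrow> ('j, 'm) mpoint) \<Rightarrow> bool" where
  "regular_map X Y f \<longleftrightarrow> f ` X \<subseteq> Y \<and>
     (\<forall>P\<in>X. \<exists>F :: 'j \<Rightarrow> complex^'n^'i \<Rightarrow> complex^'m.
        (\<forall>j. \<exists>d. \<forall>k. multihomogeneous d (\<lambda>x. F j x $ k)) \<and>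
        (\<forall>x. represents x P \<longrightarrow> (\<forall>j. F j x \<noteq> 0)) \<and>
        (\<forall>Q\<in>X. \<forall>y. represents y Q \<and> (\<forall>j. F j y \<noteq> 0) \<longrightarrow> (\<forall>j. F j y \<in> f Q j)))"

definition isomorphic_varieties ::
    "('i::finite, 'n::finite) mpoint set \<Rightarrow> ('j::finite, 'm::finite) mpoint set \<Rightarrow> bool" where
  "isomorphic_varieties X Y \<longleftrightarrow>
     (\<exists>f g. regular_map X Y f \<and> regular_map Y X g \<and>
        (\<forall>P\<in>X. g (f P) = P) \<and> (\<forall>Q\<in>Y. f (g Q) = Q))"


section \<open>Del Pezzo surfaces of degree 5\<close>

text \<open>
  Lines in the projective plane are points of the dual plane, given by coefficient vectors.
  The blowing up of the plane at a point \<open>p\<close> is the incidence variety of pairs of a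
  point \<open>x\<close> and a line through \<open>x\<close> and \<open>p\<close>; the blowing up at distinct points is the
  fibre product of these over the plane. Component \<open>None\<close> is the point \<open>x\<close>, component
  \<open>Some i\<close> is the line through \<open>x\<close> and \<open>p i\<close>.
\<close>

definition incident :: "(complex^'n) set \<Rightarrow> (complex^'n) set \<Rightarrow> bool" where
  "incident l x \<longleftrightarrow> (\<forall>a\<in>l. \<forall>b\<in>x. (\<Sum>k\<in>UNIV. a $ k * b $ k) = 0)"

definition plane_blowup :: "('i, 3) mpoint \<Rightarrow> ('i option, 3) mpoint set" where
  "plane_blowup p =
     {Q \<in> multiprojective_space. \<forall>i. incident (Q (Some i)) (Q None) \<and> incident (Q (Some i)) (p i)}"

definition generic_plane_points :: "('i, 3) mpoint \<Rightarrow> bool" where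
  "generic_plane_points p \<longleftrightarrow>
     p \<in> multiprojective_space \<and> (\<forall>I. card I = 3 \<longrightarrow> vec.dim (\<Union>i\<in>I. p i) = 3)"

definition del_pezzo_degree_5 :: "('i::finite, 'n::finite) mpoint set \<Rightarrow> bool" where
  "del_pezzo_degree_5 X \<longleftrightarrow>
     projective_variety X \<and>
     (\<exists>p :: (4, 3) mpoint. generic_plane_points p \<and> isomorphic_varieties X (plane_blowup p))"


section \<open>Zero trace anticommutative algebras of dimension 4\<close>

type_synonym alg = "complex^4 \<Rightarrow> complex^4 \<Rightarrow> complex^4"

definition zero_trace_algebras :: "alg set" where
  "zero_trace_algebras =
     {m. (\<forall>v. Vector_Spaces.linear (*s) (*s) (m v)) \<and>
         (\<forall>v. Vector_Spaces.linear (*s) (*s) (\<lambda>u. m u v)) \<and>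
         (\<forall>v. m v v = 0) \<and>
         (\<forall>v. trace (matrix (m v)) = 0)}"

definition alg_scale :: "complex \<Rightarrow> alg \<Rightarrow> alg" where
  "alg_scale c m = (\<lambda>u v. c *s m u v)"

definition subalgebra :: "alg \<Rightarrow> (complex^4) set \<Rightarrow> bool" where
  "subalgebra m U \<longleftrightarrow> vec.subspace U \<and> (\<forall>u\<in>U. \<forall>v\<in>U. m u v \<in> U)"

definition alg_ideal :: "alg \<Rightarrow> (complex^4) set \<Rightarrow> bool" where
  "alg_ideal m I \<longleftrightarrow> vec.subspace I \<and> (\<forall>u\<in>I. \<forall>v. m u v \<in> I)"

definition alg_fans :: "alg \<Rightarrow> ((complex^4) set \<times> (complex^4) set) set" where
  "alg_fans m =
     {(V1, V3). vec.subspace V1 \<and> vec.dim V1 = 1 \<and> vec.subspace V3 \<and> vec.dim V3 = 3 \<and> V1 \<subseteq> V3 \<and>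
        (\<forall>U. vec.subspace U \<and> vec.dim U = 2 \<and> V1 \<subseteq> U \<and> U \<subseteq> V3 \<longrightarrow> subalgebra m U)}"

definition gl_act :: "complex^4^4 \<Rightarrow> alg \<Rightarrow> alg" where
  "gl_act g m = (\<lambda>u v. g *v m (matrix_inv g *v u) (matrix_inv g *v v))"

definition gl_act_dual :: "complex^4^4 \<Rightarrow> (alg \<Rightarrow> complex) \<Rightarrow> alg \<Rightarrow> complex" where
  "gl_act_dual g \<phi> = (\<lambda>m. \<phi> (gl_act (matrix_inv g) m))"


section \<open>Regularity\<close>

text \<open>
  A highest weight vector is a nonzero eigenvector of the Borel subgroup of upper triangular
  matrices. (The linear order on the index type \<open>4\<close> is 0 < 1 < 2 < 3, where 0 = 4; the choice
  of Borel subgroup does not affect the orbit.)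
\<close>

definition highest_weight_vector :: "(alg \<Rightarrow> complex) \<Rightarrow> bool" where
  "highest_weight_vector \<phi> \<longleftrightarrow>
     \<phi> \<in> dual_space alg_scale zero_trace_algebras \<and> \<phi> \<noteq> 0 \<and>
     (\<forall>b. invertible b \<and> (\<forall>i j. j < i \<longrightarrow> b $ i $ j = 0)
        \<longrightarrow> (\<exists>c. gl_act_dual b \<phi> = dual_scale c \<phi>))"

text \<open>
  The highest weight vector is unique up to a scalar factor, and its orbit is closed under
  nonzero scalar multiplication because of the scalar matrices.
\<close>

definition S_D :: "(alg \<Rightarrow> complex) set" where
  "S_D = zariski_closure dual_scale (dual_space alg_scale zero_trace_algebras)
           {gl_act_dual g \<phi> | g \<phi>. invertible g \<and> highest_weight_vector \<phi>}"

definition D_cone :: "alg set" where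
  "D_cone = projective_dual_cone alg_scale zero_trace_algebras S_D"

definition D_regular :: "alg \<Rightarrow> bool" where
  "D_regular m \<longleftrightarrow> m \<in> zero_trace_algebras \<and> m \<notin> D_cone"

text \<open>
  \<open>Z_cone\<close> is the multicone over the variety of pairs of a 3-dimensional
  subalgebra, embedded by its Pluecker vector, and a point of the projective space of algebras.
  \<open>Z_tangent\<close> is the tangent space of this multicone.
\<close>

definition Z_cone :: "((complex^(3 \<Rightarrow> 4)) \<times> alg) set" where
  "Z_cone = {(plucker B, m) | (B :: complex^3^4) m.
     m \<in> zero_trace_algebras \<and> m \<noteq> 0 \<and>
     vec.dim (column_span B) = 3 \<and> subalgebra m (column_span B)}"

definition Z_tangent ::
    "(complex^(3 \<Rightarrow> 4)) \<times> alg \<Rightarrow> ((complex^(3 \<Rightarrow> 4)) \<times> alg) set" where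
  "Z_tangent z = tangent_space (\<lambda>c (w, m). (c *s w, alg_scale c m))
                   (UNIV \<times> zero_trace_algebras) Z_cone z"

text \<open>
  The tangent space of projective space at the point represented by \<open>m\<close> is the quotient
  of the space of algebras by the line through \<open>m\<close>, and the tangent space of the multicone maps
  onto the tangent space of the variety itself. So the differential of the projection is
  surjective iff every algebra is congruent modulo \<open>m\<close> to the second component of a tangent
  vector of the multicone.
\<close>

definition Z_critical :: "((complex^(3 \<Rightarrow> 4)) \<times> alg) set" where
  "Z_critical = {(w, m) \<in> Z_cone.
     \<not> (\<forall>a\<in>zero_trace_algebras. \<exists>c w' a'. (w', a') \<in> Z_tangent (w, m) \<and> a = a' + alg_scale c m)}"

definition E_cone :: "alg set" where
  "E_cone = insert 0 (snd ` Z_critical)"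

definition E_regular :: "alg \<Rightarrow> bool" where
  "E_regular m \<longleftrightarrow> m \<in> zero_trace_algebras \<and> m \<notin> E_cone"

definition regular_algebra :: "alg \<Rightarrow> bool" where
  "regular_algebra m \<longleftrightarrow> D_regular m \<and> E_regular m"


section \<open>Configurations of hyperplanes\<close>

definition generic_five_hyperplanes :: "(complex^4) set set \<Rightarrow> bool" where
  "generic_five_hyperplanes H \<longleftrightarrow>
     card H = 5 \<and> (\<forall>S\<in>H. vec.subspace S \<and> vec.dim S = 3) \<and>
     (\<forall>T\<subseteq>H. card T = 3 \<longrightarrow> vec.dim (\<Inter>T) = 1) \<and>
     (\<forall>T\<subseteq>H. card T = 4 \<longrightarrow> \<Inter>T = {0})"

definition sylvester_pentahedron :: "(complex^4) set set" where
  "sylvester_pentahedron =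
     {{x. x $ 1 = 0}, {x. x $ 2 = 0}, {x. x $ 3 = 0}, {x. x $ 4 = 0},
      {x. x $ 1 + x $ 2 + x $ 3 + x $ 4 = 0}}"

definition subalgebras_of_dim :: "alg \<Rightarrow> nat \<Rightarrow> (complex^4) set set" where
  "subalgebras_of_dim m k = {U. subalgebra m U \<and> vec.dim U = k}"

text \<open>The set of 2-dimensional subalgebras inside the Pluecker embedding of the Grassmannian;
  the ambient product of projective spaces has a single factor.\<close>

definition surface_of_2dim_subalgebras :: "alg \<Rightarrow> (unit, 2 \<Rightarrow> 4) mpoint set" where
  "surface_of_2dim_subalgebras m = (\<lambda>U _. plucker_line U) ` subalgebras_of_dim m 2"

end

theory Submission
  imports Defs "HOL-Complex_Analysis.Cauchy_Integral_Formula"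
begin

text \<open>
  E-regularity says that the 3-dimensional subalgebras are simple zeros of a section of a vector
  bundle on the dual projective space, and this alone implies everything. Some 2-dimensional
  subspace is a subalgebra by an eigenvector argument, and looking for an invariant hyperplane
  along it leads to a quintic form in two variables, so there is a 3-dimensional subalgebra.
  Projecting from it, the others become the base points of a pencil of conics which meet
  transversally; hence there are exactly four of them, no three base points being collinear.

  The same pencil describes the 2-dimensional subalgebras: their variety is the graph of the pencil,
  that is, the blowing up of the plane at its four base points. Any two of the five hyperplanes,
  given by covectors \<open>f\<close> and \<open>h\<close>, determine a unique fan: there is a unique line spanned by a vector
  \<open>v\<close> killed by \<open>f\<close> and \<open>h\<close> such that both are eigenvectors of the transpose of \<open>m v\<close> for the
  same eigenvalue, and the 3-dimensional member of the fan is the corresponding eigenspace of \<open>m v\<close>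
  modulo \<open>v\<close>. All fans arise in this way. Small ideals would lead to multiple zeros.
\<close>

section \<open>Linear algebra\<close>

text \<open>The 3-form \<open>wedge m f f\<close> is divisible by \<open>f\<close>, so it
  corresponds to a vector in the kernel of \<open>f\<close>. The section thus lives in a bundle of
  rank 3, the cotangent bundle of the dual projective space twisted by 3, and its top Chern number
  32 - 72 + 72 - 27 = 5 is the origin of the five. Intersection theory is replaced by elimination.
  The obstacle is the first zero: confining the search to eigencovectors along an invariant plane
  leaves one binary form, of degree five again because a hyperplane in general position meets the
  plane in one line. Afterwards only quadratic equations and one cubic are solved. With the first
  hyperplane moved to \<open>x\<^sub>4 = 0\<close>, the derivative of the section there is an
  invertible matrix \<open>T\<close>, and replacing the first three coordinates \<open>n\<close> of
  another covector by \<open>n v* T\<close> turns the remaining equations into two conics. For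
  ideals and fans, one restricts to a linear family of covectors on which the section has at most
  one component; that component is a quadratic form, and \<open>nondegenerate\<close> bounds the
  kernel of its polar form.\<close>

definition cdot :: "complex^'n::finite \<Rightarrow> complex^'n \<Rightarrow> complex" (infixl "\<cdot>" 70) where
  "f \<cdot> v = (\<Sum>k\<in>UNIV. f $ k * v $ k)"

lemma cdot_add [simp]: "f \<cdot> (u + v) = f \<cdot> u + f \<cdot> v" "(f + h) \<cdot> v = f \<cdot> v + h \<cdot> v"
  by (simp_all add: cdot_def sum.distrib algebra_simps)

lemma cdot_diff [simp]: "f \<cdot> (u - v) = f \<cdot> u - f \<cdot> v" "(f - h) \<cdot> v = f \<cdot> v - h \<cdot> v"
  by (simp_all add: cdot_def sum_subtractf algebra_simps)

lemma cdot_scale [simp]: "f \<cdot> (c *s u) = c * (f \<cdot> u)" "(c *s f) \<cdot> v = c * (f \<cdot> v)"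
  by (simp_all add: cdot_def sum_distrib_left algebra_simps)

lemma cdot_zero [simp]: "f \<cdot> 0 = 0" "0 \<cdot> v = 0"
  by (simp_all add: cdot_def)

lemma cdot_minus [simp]: "f \<cdot> (- v) = - (f \<cdot> v)" "(- f) \<cdot> v = - (f \<cdot> v)"
  by (simp_all add: cdot_def sum_negf)

lemma cdot_axis [simp]: "f \<cdot> axis k c = f $ k * c" "axis k c \<cdot> f = c * f $ k"
proof -
  have 1: "f \<cdot> axis k c = f $ k * c" for f :: "complex^'a"
    by (simp add: cdot_def axis_def if_distrib cong: if_cong)
  then show "f \<cdot> axis k c = f $ k * c" .
  show "axis k c \<cdot> f = c * f $ k"
    using 1[of f] by (simp add: cdot_def mult.commute)
qed

lemma cdot_commute: "f \<cdot> v = v \<cdot> f"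
  by (simp add: cdot_def mult.commute)

lemma cdot_eq_0_iff: "(\<forall>v. f \<cdot> v = 0) \<longleftrightarrow> f = 0"
proof
  assume "\<forall>v. f \<cdot> v = 0"
  then have "f \<cdot> axis k 1 = 0" for k
    by blast
  then show "f = 0" by (simp add: vec_eq_iff)
qed simp

lemma cdot_matrix_vector: "f \<cdot> (M *v x) = (transpose M *v f) \<cdot> x"
proof -
  have "f \<cdot> (M *v x) = (\<Sum>i\<in>UNIV. \<Sum>j\<in>UNIV. f $ i * M $ i $ j * x $ j)"
    by (simp add: cdot_def matrix_vector_mult_def sum_distrib_left mult.assoc)
  also have "\<dots> = (\<Sum>j\<in>UNIV. \<Sum>i\<in>UNIV. f $ i * M $ i $ j * x $ j)"
    by (rule sum.swap)
  also have "\<dots> = (transpose M *v f) \<cdot> x"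
    by (simp add: cdot_def matrix_vector_mult_def transpose_def sum_distrib_right sum_distrib_left mult_ac)
  finally show ?thesis .
qed

lemma subspace_kernel: "vec.subspace {x. f \<cdot> x = 0}"
  by (auto simp: vec.subspace_def)

lemma nonzero_cdot: assumes "f \<noteq> 0" obtains z where "f \<cdot> z = 1"
proof -
  obtain v where "f \<cdot> v \<noteq> 0" using assms cdot_eq_0_iff by blast
  then have "f \<cdot> (inverse (f \<cdot> v) *s v) = 1" by simp
  then show ?thesis using that by blast
qed

lemma dim_kernel:
  fixes f :: "complex^'n::finite"
  assumes "f \<noteq> 0"
  shows "vec.dim {x. f \<cdot> x = 0} = CARD('n) - 1"
proof -
  obtain z where z: "f \<cdot> z = 1" using assms nonzero_cdot by blast
  let ?K = "{x. f \<cdot> x = 0}"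
  have zK: "z \<notin> vec.span ?K"
    using z subspace_kernel vec.span_eq_iff by (metis (mono_tags) mem_Collect_eq zero_neq_one)
  have "vec.span (insert z ?K) = UNIV"
  proof (intro set_eqI iffI UNIV_I)
    fix x
    have "x = (x - (f \<cdot> x) *s z) + (f \<cdot> x) *s z" by simp
    moreover have "x - (f \<cdot> x) *s z \<in> ?K" using z by simp
    ultimately show "x \<in> vec.span (insert z ?K)"
      by (metis insertCI vec.span_add vec.span_base vec.span_scale)
  qed
  then have "vec.dim (insert z ?K) = CARD('n)"
    by (metis vec.dim_span vec_dim_card)
  moreover have "vec.dim (insert z ?K) = vec.dim ?K + 1"
    using zK vec.dim_insert[of z ?K] by simp
  ultimately show ?thesis by simp
qed

text \<open>This serves to choose coordinates: \<open>matrix_inv g\<close> takes the given vectors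
  to unit vectors. The free columns are filled through any bijection onto the vectors added to the
  basis.\<close>

lemma complete_columns:
  fixes v :: "'n::finite \<Rightarrow> complex^'n"
  assumes "inj_on v J" "vec.independent (v ` J)"
  obtains g where "invertible g" "\<And>j. j \<in> J \<Longrightarrow> column j g = v j"
proof -
  define B where "B = vec.extend_basis (v ` J)"
  have B: "v ` J \<subseteq> B" "vec.independent B" "vec.span B = UNIV"
    using assms(2) vec.extend_basis_superset vec.independent_extend_basis vec.span_extend_basis
    unfolding B_def by blast+
  have fin: "finite B" using B(2) vec.finiteI_independent by blast
  have "card B = CARD('n)"
    using B(2,3) vec.dim_eq_card vec_dim_card by (metis vec.span_UNIV)
  then have "card (B - v ` J) = card (UNIV - J)"
    using B(1) fin assms(1) by (simp add: card_Diff_subset card_image finite_subset card_mono)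
  then obtain h where h: "bij_betw h (UNIV - J) (B - v ` J)"
    using fin finite_same_card_bij[of "UNIV - J" "B - v ` J"] by auto
  define k where "k j = (if j \<in> J then v j else h j)" for j
  define g where "g = (\<chi> r c. k c $ r)"
  have col: "column c g = k c" for c
    by (simp add: g_def column_def)
  have "k ` UNIV = B"
  proof -
    have "k ` UNIV = k ` J \<union> k ` (UNIV - J)" by auto
    also have "k ` J = v ` J" by (simp add: k_def)
    also have "k ` (UNIV - J) = h ` (UNIV - J)" by (auto simp add: k_def)
    also have "\<dots> = B - v ` J" using h by (simp add: bij_betw_def)
    finally show ?thesis using B(1) by auto
  qed
  then have "vec.span (columns g) = UNIV"
    using B(3) col unfolding columns_def by (simp add: full_SetCompr_eq)
  then have "invertible g"
    using matrix_right_invertible_span_columns invertible_right_inverse by blast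
  then show ?thesis
    using that[of g] by (simp add: col k_def)
qed

lemma matrix_vector_axis: "M *v axis j 1 = column j M" for M :: "complex^'n::finite^'m::finite"
  by (simp add: matrix_vector_mult_def column_def axis_def vec_eq_iff if_distrib cong: if_cong)

lemma pair_independent:
  fixes a b :: "complex^'n::finite"
  assumes "a \<noteq> 0" "\<nexists>c. b = c *s a"
  shows "vec.independent {a, b}" "a \<noteq> b"
proof -
  show "a \<noteq> b" using assms(2) by (metis vec.scale_one)
  have "b \<notin> vec.span {a}" using assms(2) by (auto simp: vec.span_singleton)
  moreover have "vec.independent {a}" using assms(1) by simp
  ultimately show "vec.independent {a, b}"
    using vec.independent_insert[of b "{a}"] by (simp add: insert_commute)
qed

lemma complete_column:
  fixes a :: "complex^'n::finite"
  assumes "a \<noteq> 0"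
  obtains g :: "complex^'n^'n" where "invertible g" "column i g = a"
proof -
  have "inj_on (\<lambda>_. a) {i}" "vec.independent ((\<lambda>_. a) ` {i})" using assms by simp_all
  then obtain g :: "complex^'n^'n" where g: "invertible g" "\<And>j. j \<in> {i} \<Longrightarrow> column j g = a"
    using complete_columns by blast
  show ?thesis by (rule that[OF g(1)]) (simp add: g(2))
qed

lemma complete_row:
  fixes f :: "complex^'n::finite"
  assumes "f \<noteq> 0"
  obtains g :: "complex^'n^'n" where "invertible g" "axis i 1 v* g = f"
proof -
  obtain h :: "complex^'n^'n" where h: "invertible h" "column i h = f" using complete_column[OF assms] by blast
  have "invertible (transpose h)" using h(1) by (simp add: invertible_det_nz)
  moreover have "axis i 1 v* transpose h = f" by (simp add: matrix_vector_axis h(2))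
  ultimately show ?thesis by (rule that)
qed

lemma complete_pair:
  fixes a b :: "complex^4"
  assumes "a \<noteq> 0" "\<nexists>c. b = c *s a"
  obtains g :: "complex^4^4" where "invertible g" "column 1 g = a" "column 2 g = b"
proof -
  define v where "v j = (if j = 1 then a else b)" for j :: 4
  have "v ` {1, 2} = {a, b}" by (auto simp: v_def)
  then have "inj_on v {1, 2}" "vec.independent (v ` {1, 2})"
    using pair_independent[OF assms] by (simp_all add: v_def)
  then obtain g where g: "invertible g" "\<And>j. j \<in> {1, 2} \<Longrightarrow> column j g = v j"
    using complete_columns by blast
  show ?thesis by (rule that[OF g(1)]) (use g(2)[of 1] g(2)[of 2] in \<open>simp_all add: v_def\<close>)
qed

lemma line_span:
  fixes V :: "(complex^'n::finite) set"
  assumes "vec.subspace V" "vec.dim V = 1"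
  obtains a where "a \<noteq> 0" "V = vec.span {a}"
proof (rule vec.basis_exists[of V])
  fix B assume B: "B \<subseteq> V" "vec.independent B" "V \<subseteq> vec.span B" "card B = vec.dim V"
  obtain a where a: "B = {a}" using B(4) assms(2) by (metis card_1_singletonE)
  have "a \<noteq> 0" using B(2) a by simp
  moreover have "V = vec.span {a}" using a vec.span_subspace[OF B(1) B(3) assms(1)] by simp
  ultimately show thesis using that by blast
qed

lemma hyperplane_eq_kernel:
  fixes S :: "(complex^'n::finite) set"
  assumes S: "vec.subspace S" "vec.dim S = CARD('n) - 1"
  obtains f where "f \<noteq> 0" "S = {x. f \<cdot> x = 0}"
proof -
  obtain B where B: "B \<subseteq> S" "vec.independent B" "vec.span B = S" "card B = vec.dim S"
  proof (rule vec.basis_exists[of S])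
    fix B assume "B \<subseteq> S" "vec.independent B" "S \<subseteq> vec.span B" "card B = vec.dim S"
    then show thesis using that[of B] vec.span_subspace[OF _ _ S(1)] by blast
  qed
  have fin: "finite B" using B(2) vec.finiteI_independent by blast
  have "S \<noteq> UNIV"
  proof
    assume "S = UNIV"
    then have "CARD('n) = CARD('n) - 1" using S(2) vec_dim_card by metis
    then show False using zero_less_card_finite[where 'a='n] by linarith
  qed
  then obtain z where z: "z \<notin> S" by blast
  then have zB: "z \<notin> B" "vec.independent (insert z B)"
    using B vec.independent_insert[of z B] by auto
  have "card (insert z B) = CARD('n)"
    using zB fin B(4) S(2) zero_less_card_finite[where 'a='n] by simp
  then obtain v where v: "bij_betw v (UNIV::'n set) (insert z B)"
    using fin finite_same_card_bij[of "UNIV::'n set" "insert z B"] by auto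
  then have "inj_on v UNIV" "v ` UNIV = insert z B"
    by (auto simp: bij_betw_def)
  then obtain g where g: "invertible g" "\<And>j. column j g = v j"
    using complete_columns[of v UNIV] zB by auto
  obtain j0 where j0: "v j0 = z" using \<open>v ` UNIV = insert z B\<close> by (metis imageE insertI1)
  obtain g' where g': "g' ** g = mat 1" using g(1) invertible_def by blast
  \<comment> \<open>The rows of the inverse matrix form the dual basis; the row belonging to
    \<open>z\<close> is 1 on \<open>z\<close> and 0 on \<open>B\<close>.\<close>
  define f where "f = row j0 g'"
  have fv: "f \<cdot> v j = (if j = j0 then 1 else 0)" for j
  proof -
    have "f \<cdot> v j = (g' ** g) $ j0 $ j"
      using g(2)[of j] by (auto simp: f_def row_def column_def cdot_def matrix_matrix_mult_def vec_eq_iff)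
    then show ?thesis by (simp add: g' mat_def)
  qed
  have "f \<noteq> 0" using fv[of j0] by auto
  moreover have "S = {x. f \<cdot> x = 0}"
  proof (rule vec.subspace_dim_equal[OF S(1) subspace_kernel])
    have "B \<subseteq> {x. f \<cdot> x = 0}"
    proof
      fix b assume "b \<in> B"
      then obtain j where "v j = b" using \<open>v ` UNIV = insert z B\<close> by (metis imageE insertI2)
      then have "j \<noteq> j0" using j0 zB(1) \<open>b \<in> B\<close> by auto
      then show "b \<in> {x. f \<cdot> x = 0}" using fv[of j] \<open>v j = b\<close> by simp
    qed
    then show "S \<subseteq> {x. f \<cdot> x = 0}"
      using vec.span_minimal[OF _ subspace_kernel] B(3) by blast
    show "vec.dim {x. f \<cdot> x = 0} \<le> vec.dim S"
      using dim_kernel[OF \<open>f \<noteq> 0\<close>] S(2) by simp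
  qed
  ultimately show ?thesis using that by blast
qed

lemma kernel_eq_imp_multiple:
  fixes f h :: "complex^'n::finite"
  assumes "\<And>x. f \<cdot> x = 0 \<Longrightarrow> h \<cdot> x = 0"
  obtains c where "h = c *s f"
proof (cases "f = 0")
  case True
  then have "\<forall>x. h \<cdot> x = 0" using assms by simp
  then have "h = 0" by (simp add: cdot_eq_0_iff)
  then show ?thesis using that[of 0] by simp
next
  case False
  then obtain z where z: "f \<cdot> z = 1" using nonzero_cdot by blast
  have "h \<cdot> x = ((h \<cdot> z) *s f) \<cdot> x" for x
  proof -
    have "f \<cdot> (x - (f \<cdot> x) *s z) = 0" using z by simp
    then have "h \<cdot> (x - (f \<cdot> x) *s z) = 0" using assms by blast
    then show ?thesis by (simp add: mult.commute)
  qed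
  note hx = this
  have "\<forall>x. (h - (h \<cdot> z) *s f) \<cdot> x = 0"
    unfolding cdot_diff by (intro allI) (subst hx, simp)
  then have "h - (h \<cdot> z) *s f = 0" by (simp only: cdot_eq_0_iff)
  then show ?thesis using that[of "h \<cdot> z"] by simp
qed

section \<open>Subalgebras of codimension one\<close>

definition alternating :: "alg \<Rightarrow> bool" where
  "alternating m \<longleftrightarrow> (\<forall>v. Vector_Spaces.linear (*s) (*s) (m v)) \<and>
     (\<forall>v. Vector_Spaces.linear (*s) (*s) (\<lambda>u. m u v)) \<and> (\<forall>v. m v v = 0)"

lemma alternating_zero_trace: "m \<in> zero_trace_algebras \<Longrightarrow> alternating m"
  by (simp add: alternating_def zero_trace_algebras_def)

lemma alternating_bilinear:
  assumes "alternating m"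
  shows "m (u + u') v = m u v + m u' v" "m u (v + v') = m u v + m u v'"
    "m (c *s u) v = c *s m u v" "m u (c *s v) = c *s m u v"
    "m (u - u') v = m u v - m u' v" "m u (v - v') = m u v - m u v'"
    "m 0 v = 0" "m u 0 = 0" "m u u = 0"
proof -
  have l: "Vector_Spaces.linear (*s) (*s) (m v)" "Vector_Spaces.linear (*s) (*s) (\<lambda>u. m u v)" for v
    using assms by (auto simp: alternating_def)
  show "m (u + u') v = m u v + m u' v" "m (c *s u) v = c *s m u v"
    "m (u - u') v = m u v - m u' v" "m 0 v = 0"
    using vec.linear_add[OF l(2)[of v]] vec.linear_scale[OF l(2)[of v]]
      vec.linear_diff[OF l(2)[of v]] vec.linear_0[OF l(2)[of v]] by auto
  show "m u (v + v') = m u v + m u v'" "m u (c *s v) = c *s m u v"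
    "m u (v - v') = m u v - m u v'" "m u 0 = 0"
    using vec.linear_add[OF l(1)[of u]] vec.linear_scale[OF l(1)[of u]]
      vec.linear_diff[OF l(1)[of u]] vec.linear_0[OF l(1)[of u]] by auto
  show "m u u = 0" using assms by (simp add: alternating_def)
qed

lemma alternating_swap: assumes "alternating m" shows "m v u = - m u v"
proof -
  have "0 = m (u + v) (u + v)" by (simp only: alternating_bilinear(9)[OF assms])
  also have "\<dots> = m u v + m v u"
    unfolding alternating_bilinear(1,2)[OF assms] by (simp add: alternating_bilinear(9)[OF assms])
  finally show ?thesis by (simp add: eq_neg_iff_add_eq_0 add.commute)
qed

text \<open>As a form in \<open>u\<close>, \<open>v\<close>, \<open>w\<close>, this is the exterior product of \<open>f\<close> with the
  alternating form \<open>h \<cdot> m\<close>.\<close>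
definition wedge :: "alg \<Rightarrow> complex^4 \<Rightarrow> complex^4 \<Rightarrow> complex^4 \<Rightarrow> complex^4 \<Rightarrow> complex^4 \<Rightarrow> complex" where
  "wedge m f h u v w = (f \<cdot> w) * (h \<cdot> m u v) + (f \<cdot> u) * (h \<cdot> m v w) + (f \<cdot> v) * (h \<cdot> m w u)"

text \<open>The hyperplanes which are subalgebras are the zeros of the section of a vector bundle on the
  dual projective space given by \<open>wedge m f f\<close>; nondegeneracy says that all zeros are simple.\<close>
definition sub_covector :: "alg \<Rightarrow> complex^4 \<Rightarrow> bool" where
  "sub_covector m f \<longleftrightarrow> (\<forall>u v w. wedge m f f u v w = 0)"

definition nondegenerate :: "alg \<Rightarrow> bool" where
  "nondegenerate m \<longleftrightarrow> (\<forall>f h. f \<noteq> 0 \<longrightarrow> sub_covector m f \<longrightarrow>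
     (\<forall>u v w. wedge m f h u v w + wedge m h f u v w = 0) \<longrightarrow> (\<exists>c. h = c *s f))"

text \<open>Evaluating the 3-form at two vectors of the kernel and at \<open>z\<close> with
  \<open>f \<cdot> z = 1\<close> leaves only \<open>f \<cdot> m u v\<close>. Conversely, if
  \<open>f \<cdot> w \<noteq> 0\<close>, then \<open>u\<close> and \<open>v\<close> can be pushed
  into the kernel along \<open>w\<close>, which changes the form only by the factor
  \<open>f \<cdot> w\<close>; if \<open>f\<close> kills all three arguments, the form vanishes
  anyway.\<close>

lemma sub_covector_iff:
  assumes m: "alternating m"
  shows "sub_covector m f \<longleftrightarrow> f = 0 \<or> subalgebra m {x. f \<cdot> x = 0}"
proof (cases "f = 0")
  case True
  then show ?thesis by (simp add: sub_covector_def wedge_def)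
next
  case False
  show ?thesis
  proof
    assume sub: "sub_covector m f"
    obtain z where z: "f \<cdot> z = 1" using False nonzero_cdot by blast
    have "f \<cdot> m u v = 0" if "f \<cdot> u = 0" "f \<cdot> v = 0" for u v
      using sub[unfolded sub_covector_def, rule_format, of u v z] that z by (simp add: wedge_def)
    then show "f = 0 \<or> subalgebra m {x. f \<cdot> x = 0}"
      by (simp add: subalgebra_def subspace_kernel)
  next
    assume "f = 0 \<or> subalgebra m {x. f \<cdot> x = 0}"
    then have sub: "\<And>u v. f \<cdot> u = 0 \<Longrightarrow> f \<cdot> v = 0 \<Longrightarrow> f \<cdot> m u v = 0"
      using False by (simp add: subalgebra_def)
    have key: "wedge m f f u v w = 0" if "f \<cdot> w \<noteq> 0" for u v w
    proof -
      let ?u = "(f \<cdot> w) *s u - (f \<cdot> u) *s w" and ?v = "(f \<cdot> w) *s v - (f \<cdot> v) *s w"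
      have "f \<cdot> m ?u ?v = 0" by (rule sub) simp_all
      moreover have "f \<cdot> m ?u ?v = (f \<cdot> w) * wedge m f f u v w"
        using alternating_swap[OF m, of u w] alternating_swap[OF m, of v w]
        by (simp add: alternating_bilinear[OF m] wedge_def algebra_simps)
      ultimately show ?thesis using that by simp
    qed
    have cyc: "wedge m f f u v w = wedge m f f v w u" for u v w
      by (simp add: wedge_def)
    show "sub_covector m f"
      unfolding sub_covector_def
    proof (intro allI)
      fix u v w
      show "wedge m f f u v w = 0"
      proof (cases "f \<cdot> w = 0 \<and> f \<cdot> u = 0 \<and> f \<cdot> v = 0")
        case True then show ?thesis by (simp add: wedge_def)
      next
        case False
        then consider "f \<cdot> w \<noteq> 0" | "f \<cdot> u \<noteq> 0" | "f \<cdot> v \<noteq> 0" by blast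
        then show ?thesis
          using key[of w u v] key[of u v w] key[of v w u] cyc[of u v w] cyc[of v w u]
          by cases auto
      qed
    qed
  qed
qed

section \<open>Pluecker vectors of hyperplanes as covectors\<close>

definition triple :: "4 \<Rightarrow> 4 \<Rightarrow> 4 \<Rightarrow> 3 \<Rightarrow> 4" where
  "triple i j k = (\<lambda>a. if a = 1 then i else if a = 2 then j else k)"

text \<open>These are the signed minors in the Laplace expansion along an added first column: paired
  with \<open>x\<close>, the covector of \<open>plucker B\<close> gives the determinant of
  \<open>x\<close> followed by the columns of \<open>B\<close>.\<close>

definition plucker_covector :: "complex^(3 \<Rightarrow> 4) \<Rightarrow> complex^4" where
  "plucker_covector w = vector [w $ triple 2 3 4, - w $ triple 1 3 4, w $ triple 1 2 4, - w $ triple 1 2 3]"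

lemma vector_4 [simp]:
  "(vector [a, b, c, d] :: ('a::zero)^4) $ 1 = a" "(vector [a, b, c, d] :: ('a::zero)^4) $ 2 = b"
  "(vector [a, b, c, d] :: ('a::zero)^4) $ 3 = c" "(vector [a, b, c, d] :: ('a::zero)^4) $ 4 = d"
  by (simp_all add: vector_def)

lemma cdot_4: "f \<cdot> v = f $ 1 * v $ 1 + f $ 2 * v $ 2 + f $ 3 * v $ 3 + f $ 4 * (v $ 4 :: complex)"
  for f v :: "complex^4"
  by (simp add: cdot_def sum_4)

lemma cdot_3: "f \<cdot> v = f $ 1 * v $ 1 + f $ 2 * v $ 2 + f $ 3 * (v $ 3 :: complex)"
  for f v :: "complex^3"
  by (simp add: cdot_def sum_3)

lemma plucker_triple:
  "plucker B $ triple i j k =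
     B $ i $ 1 * B $ j $ 2 * B $ k $ 3 + B $ i $ 2 * B $ j $ 3 * B $ k $ 1
     + B $ i $ 3 * B $ j $ 1 * B $ k $ 2 - B $ i $ 1 * B $ j $ 3 * B $ k $ 2
     - B $ i $ 2 * B $ j $ 1 * B $ k $ 3 - B $ i $ 3 * B $ j $ 2 * B $ k $ 1"
  by (simp add: plucker_def det_3 triple_def)

lemma plucker_covector_column_span:
  fixes B :: "complex^3^4"
  assumes "x \<in> column_span B"
  shows "plucker_covector (plucker B) \<cdot> x = 0"
proof -
  obtain y where "x = B *v y" using assms by (auto simp: column_span_def)
  show ?thesis
    unfolding \<open>x = B *v y\<close>
    by (simp add: cdot_4 plucker_covector_def plucker_triple matrix_vector_mult_def sum_3 algebra_simps)
qed

lemma exists_plucker_covector: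
  assumes "f \<noteq> 0"
  obtains B :: "complex^3^4" and c where "c \<noteq> 0" "column_span B = {x. f \<cdot> x = 0}"
    "plucker_covector (plucker B) = c *s f"
proof -
  have "\<exists>l. f $ l \<noteq> 0" using assms by (auto simp: vec_eq_iff)
  then consider "f $ 1 \<noteq> 0" | "f $ 2 \<noteq> 0" | "f $ 3 \<noteq> 0" | "f $ 4 \<noteq> 0"
    by (metis exhaust_4)
  then have "\<exists>(B :: complex^3^4) c. c \<noteq> 0 \<and> {x. f \<cdot> x = 0} \<subseteq> column_span B \<and> plucker_covector (plucker B) = c *s f"
  \<comment> \<open>If \<open>f $ l \<noteq> 0\<close>, the vectors
    \<open>f $ l *s axis j 1 - f $ j *s axis l 1\<close> with \<open>j \<noteq> l\<close> form a
    basis of the kernel. Their minors give \<open>f\<close> times the square of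
    \<open>f $ l\<close>, up to sign.\<close>
  proof cases
    case 1
    define B :: "complex^3^4" where "B = vector [vector [- f $ 2, - f $ 3, - f $ 4],
      vector [f $ 1, 0, 0], vector [0, f $ 1, 0], vector [0, 0, f $ 1]]"
    have "x = B *v (vector [x $ 2 / f $ 1, x $ 3 / f $ 1, x $ 4 / f $ 1])" if "f \<cdot> x = 0" for x
      using that 1 by (simp add: cdot_4 vec_eq_iff forall_4 B_def matrix_vector_mult_def sum_3 vector_def divide_simps) algebra
    moreover have "plucker_covector (plucker B) = (f $ 1 * f $ 1) *s f"
      by (simp add: plucker_covector_def plucker_triple vec_eq_iff forall_4 B_def vector_def)
    ultimately show ?thesis using 1 unfolding column_span_def by (intro exI[of _ B] exI[of _ "f $ 1 * f $ 1"]) auto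
  next
    case 2
    define B :: "complex^3^4" where "B = vector [vector [f $ 2, 0, 0],
      vector [- f $ 1, - f $ 3, - f $ 4], vector [0, f $ 2, 0], vector [0, 0, f $ 2]]"
    have "x = B *v (vector [x $ 1 / f $ 2, x $ 3 / f $ 2, x $ 4 / f $ 2])" if "f \<cdot> x = 0" for x
      using that 2 by (simp add: cdot_4 vec_eq_iff forall_4 B_def matrix_vector_mult_def sum_3 vector_def divide_simps) algebra
    moreover have "plucker_covector (plucker B) = - (f $ 2 * f $ 2) *s f"
      by (simp add: plucker_covector_def plucker_triple vec_eq_iff forall_4 B_def vector_def)
    ultimately show ?thesis using 2 unfolding column_span_def by (intro exI[of _ B] exI[of _ "- (f $ 2 * f $ 2)"]) auto
  next
    case 3
    define B :: "complex^3^4" where "B = vector [vector [f $ 3, 0, 0],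
      vector [0, f $ 3, 0], vector [- f $ 1, - f $ 2, - f $ 4], vector [0, 0, f $ 3]]"
    have "x = B *v (vector [x $ 1 / f $ 3, x $ 2 / f $ 3, x $ 4 / f $ 3])" if "f \<cdot> x = 0" for x
      using that 3 by (simp add: cdot_4 vec_eq_iff forall_4 B_def matrix_vector_mult_def sum_3 vector_def divide_simps) algebra
    moreover have "plucker_covector (plucker B) = (f $ 3 * f $ 3) *s f"
      by (simp add: plucker_covector_def plucker_triple vec_eq_iff forall_4 B_def vector_def)
    ultimately show ?thesis using 3 unfolding column_span_def by (intro exI[of _ B] exI[of _ "f $ 3 * f $ 3"]) auto
  next
    case 4
    define B :: "complex^3^4" where "B = vector [vector [f $ 4, 0, 0],
      vector [0, f $ 4, 0], vector [0, 0, f $ 4], vector [- f $ 1, - f $ 2, - f $ 3]]"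
    have "x = B *v (vector [x $ 1 / f $ 4, x $ 2 / f $ 4, x $ 3 / f $ 4])" if "f \<cdot> x = 0" for x
      using that 4 by (simp add: cdot_4 vec_eq_iff forall_4 B_def matrix_vector_mult_def sum_3 vector_def divide_simps) algebra
    moreover have "plucker_covector (plucker B) = - (f $ 4 * f $ 4) *s f"
      by (simp add: plucker_covector_def plucker_triple vec_eq_iff forall_4 B_def vector_def)
    ultimately show ?thesis using 4 unfolding column_span_def by (intro exI[of _ B] exI[of _ "- (f $ 4 * f $ 4)"]) auto
  qed
  then obtain B :: "complex^3^4" and c where B: "c \<noteq> 0" "{x. f \<cdot> x = 0} \<subseteq> column_span B"
    "plucker_covector (plucker B) = c *s f" by blast
  have "column_span B \<subseteq> {x. f \<cdot> x = 0}"
    using plucker_covector_column_span[of _ B] B(1,3) by auto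
  then show ?thesis using that B by blast
qed

section \<open>The differential of the section and E-regularity\<close>

lemma plucker_covector_linear:
  "plucker_covector (w + w') = plucker_covector w + plucker_covector w'"
  "plucker_covector (c *s w) = c *s plucker_covector w"
  by (simp_all add: plucker_covector_def vec_eq_iff forall_4)

abbreviation "pair_scale \<equiv> (\<lambda>c (w, m). (c *s w, alg_scale c m)) ::
  complex \<Rightarrow> (complex^(3 \<Rightarrow> 4)) \<times> alg \<Rightarrow> (complex^(3 \<Rightarrow> 4)) \<times> alg"

lemma wedge_polynomial:
  "(\<lambda>x. wedge (snd x) (plucker_covector (fst x)) (plucker_covector (fst x)) u v w)
     \<in> polynomial_functions pair_scale (UNIV \<times> zero_trace_algebras)"
proof -
  have 1: "(\<lambda>x. plucker_covector (fst x) \<cdot> a) \<in> polynomial_functions pair_scale (UNIV \<times> zero_trace_algebras)" for a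
    by (rule polynomial_functions.linear)
      (auto simp: linear_functional_def plucker_covector_linear)
  have k: "(\<lambda>x. plucker_covector (fst x) $ k) \<in> polynomial_functions pair_scale (UNIV \<times> zero_trace_algebras)" for k
    by (rule polynomial_functions.linear)
      (auto simp: linear_functional_def plucker_covector_linear)
  have m: "(\<lambda>x. snd x a b $ k) \<in> polynomial_functions pair_scale (UNIV \<times> zero_trace_algebras)" for a b k
    by (rule polynomial_functions.linear) (auto simp: linear_functional_def alg_scale_def)
  have 2: "(\<lambda>x. plucker_covector (fst x) \<cdot> snd x a b) \<in> polynomial_functions pair_scale (UNIV \<times> zero_trace_algebras)" for a b
    unfolding cdot_4 by (intro polynomial_functions.add polynomial_functions.mult k m)
  show ?thesis
    unfolding wedge_def by (intro polynomial_functions.add polynomial_functions.mult 1 2)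
qed

text \<open>The form \<open>wedge\<close>, quadratic in the Pluecker vector and linear in the
  algebra, is a polynomial vanishing on \<open>Z_cone\<close>. A tangent vector therefore
  annihilates its derivative, and the product rule yields the three terms.\<close>

lemma Z_tangent_wedge:
  assumes "(w', a) \<in> Z_tangent (w, m)"
  defines "f \<equiv> plucker_covector w" and "h \<equiv> plucker_covector w'"
  shows "wedge m f h u v z + wedge m h f u v z + wedge a f f u v z = 0"
proof -
  let ?p = "\<lambda>x. wedge (snd x) (plucker_covector (fst x)) (plucker_covector (fst x)) u v z"
  have "?p y = 0" if y: "y \<in> Z_cone" for y
  proof -
    obtain B :: "complex^3^4" and m' where B: "y = (plucker B, m')" "m' \<in> zero_trace_algebras"
      "vec.dim (column_span B) = 3" "subalgebra m' (column_span B)"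
      using y by (auto simp: Z_cone_def)
    let ?g = "plucker_covector (plucker B)"
    have "sub_covector m' ?g"
    proof (cases "?g = 0")
      case True then show ?thesis by (simp add: sub_covector_def wedge_def)
    next
      case False
      have "column_span B = {x. ?g \<cdot> x = 0}"
        using B(4) plucker_covector_column_span dim_kernel[OF False] B(3)
        by (intro vec.subspace_dim_equal subspace_kernel) (auto simp: subalgebra_def)
      then show ?thesis
        using B sub_covector_iff[OF alternating_zero_trace[OF B(2)]] by simp
    qed
    then show ?thesis by (simp add: B(1) sub_covector_def)
  qed
  then have "?p \<in> vanishing_polynomials pair_scale (UNIV \<times> zero_trace_algebras) Z_cone"
    using wedge_polynomial by (simp add: vanishing_polynomials_def)
  note van = this
  have "\<forall>p\<in>vanishing_polynomials pair_scale (UNIV \<times> zero_trace_algebras) Z_cone.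
      ((\<lambda>t. p ((w, m) + pair_scale t (w', a))) has_field_derivative 0) (at 0)"
    using assms(1) unfolding Z_tangent_def tangent_space_def mem_Collect_eq by (rule conjunct2)
  from bspec[OF this van]
  have "((\<lambda>t. ?p ((w, m) + pair_scale t (w', a))) has_field_derivative 0) (at 0)" .
  moreover have "((\<lambda>t. ?p ((w, m) + pair_scale t (w', a))) has_field_derivative
      (wedge m f h u v z + wedge m h f u v z + wedge a f f u v z)) (at 0)"
  proof -
    define q where "q x y t = f \<cdot> m x y + t * (h \<cdot> m x y) + t * (f \<cdot> a x y + t * (h \<cdot> a x y))" for x y t
    have q: "(q x y has_field_derivative (h \<cdot> m x y + f \<cdot> a x y)) (at 0)" for x y
      unfolding q_def by (rule derivative_eq_intros refl | simp)+
    have l: "((\<lambda>t. f \<cdot> x + t * (h \<cdot> x)) has_field_derivative h \<cdot> x) (at 0)" for x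
      by (rule derivative_eq_intros refl | simp)+
    have e: "?p ((w, m) + pair_scale t (w', a)) =
        (f \<cdot> z + t * (h \<cdot> z)) * q u v t + (f \<cdot> u + t * (h \<cdot> u)) * q v z t
        + (f \<cdot> v + t * (h \<cdot> v)) * q z u t" for t
      by (simp add: wedge_def q_def plucker_covector_linear alg_scale_def f_def h_def)
    have d: "h \<cdot> z * q u v 0 + (h \<cdot> m u v + f \<cdot> a u v) * (f \<cdot> z + 0 * (h \<cdot> z))
        + (h \<cdot> u * q v z 0 + (h \<cdot> m v z + f \<cdot> a v z) * (f \<cdot> u + 0 * (h \<cdot> u)))
        + (h \<cdot> v * q z u 0 + (h \<cdot> m z u + f \<cdot> a z u) * (f \<cdot> v + 0 * (h \<cdot> v)))
        = wedge m f h u v z + wedge m h f u v z + wedge a f f u v z"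
      by (simp add: wedge_def q_def ring_distribs)
    note D = DERIV_cong[OF DERIV_add[OF DERIV_add[OF DERIV_mult[OF l[of z] q[of u v]]
            DERIV_mult[OF l[of u] q[of v z]]] DERIV_mult[OF l[of v] q[of z u]]] d]
    have "(\<lambda>t. ?p ((w, m) + pair_scale t (w', a))) = (\<lambda>t. (f \<cdot> z + t * (h \<cdot> z)) * q u v t
        + (f \<cdot> u + t * (h \<cdot> u)) * q v z t + (f \<cdot> v + t * (h \<cdot> v)) * q z u t)"
      by (rule ext) (rule e)
    then show ?thesis
      by (rule ssubst) (rule D)
  qed
  ultimately show ?thesis by (rule DERIV_unique[symmetric])
qed

text \<open>The contraction of the volume form with \<open>y\<close> and \<open>z\<close>, as an algebra
  with values in the line through \<open>z\<close>.\<close>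
definition test_algebra :: "complex^4 \<Rightarrow> complex^4 \<Rightarrow> alg" where
  "test_algebra y z = (\<lambda>u v.
     ((y $ 1 * z $ 2 - y $ 2 * z $ 1) * (u $ 3 * v $ 4 - u $ 4 * v $ 3)
      - (y $ 1 * z $ 3 - y $ 3 * z $ 1) * (u $ 2 * v $ 4 - u $ 4 * v $ 2)
      + (y $ 1 * z $ 4 - y $ 4 * z $ 1) * (u $ 2 * v $ 3 - u $ 3 * v $ 2)
      + (y $ 2 * z $ 3 - y $ 3 * z $ 2) * (u $ 1 * v $ 4 - u $ 4 * v $ 1)
      - (y $ 2 * z $ 4 - y $ 4 * z $ 2) * (u $ 1 * v $ 3 - u $ 3 * v $ 1)
      + (y $ 3 * z $ 4 - y $ 4 * z $ 3) * (u $ 1 * v $ 2 - u $ 2 * v $ 1)) *s z)"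

text \<open>The trace of \<open>test_algebra y z v\<close> is the volume form at \<open>y\<close>,
  \<open>z\<close>, \<open>v\<close>, \<open>z\<close>, where \<open>z\<close> is repeated.\<close>

lemma test_algebra_zero_trace: "test_algebra y z \<in> zero_trace_algebras"
proof -
  have "Vector_Spaces.linear (*s) (*s) (test_algebra y z v)" for v
    by (auto simp: Vector_Spaces.linear_iff test_algebra_def vec.vector_space_axioms vec_eq_iff algebra_simps)
  moreover have "Vector_Spaces.linear (*s) (*s) (\<lambda>u. test_algebra y z u v)" for v
    by (auto simp: Vector_Spaces.linear_iff test_algebra_def vec.vector_space_axioms vec_eq_iff algebra_simps)
  moreover have "test_algebra y z v v = 0" for v
    by (simp add: test_algebra_def)
  moreover have "trace (matrix (test_algebra y z v)) = 0" for v
    by (simp add: trace_def matrix_def sum_4 test_algebra_def axis_def algebra_simps)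
  ultimately show ?thesis by (simp add: zero_trace_algebras_def)
qed

text \<open>The vector \<open>y\<close> for which \<open>F u v w\<close> is the determinant of \<open>y\<close>, \<open>u\<close>, \<open>v\<close>, \<open>w\<close>.\<close>
definition dual_vector :: "(complex^4 \<Rightarrow> complex^4 \<Rightarrow> complex^4 \<Rightarrow> complex) \<Rightarrow> complex^4" where
  "dual_vector F = vector [F (axis 2 1) (axis 3 1) (axis 4 1), - F (axis 1 1) (axis 3 1) (axis 4 1),
     F (axis 1 1) (axis 2 1) (axis 4 1), - F (axis 1 1) (axis 2 1) (axis 3 1)]"

lemma dual_vector_linear:
  "dual_vector (\<lambda>u v w. F u v w + G u v w) = dual_vector F + dual_vector G"
  "dual_vector (\<lambda>u v w. c * F u v w) = c *s dual_vector F"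
  by (simp_all add: dual_vector_def vec_eq_iff forall_4)

text \<open>Because \<open>f \<cdot> z = 1\<close> and \<open>f \<cdot> y = 0\<close>, the product
  of \<open>f\<close> with the volume form contracted by \<open>y\<close> and \<open>z\<close> is
  the volume form contracted by \<open>y\<close>. So zero trace algebras realise every possible
  value of the section at \<open>f\<close>.\<close>

lemma dual_vector_test_algebra:
  assumes "f \<cdot> y = 0" "f \<cdot> z = 1"
  shows "dual_vector (wedge (test_algebra y z) f f) = y"
proof -
  show ?thesis
    using assms
    apply (simp add: vec_eq_iff forall_4 dual_vector_def wedge_def test_algebra_def axis_def cdot_4)
    apply (intro conjI)
       apply algebra+
    done
qed

text \<open>A dimension count. \<open>\<Phi>\<close> is the differential of the section at
  \<open>f\<close>. By E-regularity each test algebra is, modulo \<open>A\<close>, the second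
  component of a tangent vector of the multicone, and the tangent equation expresses the
  corresponding value \<open>y\<close> through \<open>\<Phi>\<close>. Hence the image of
  \<open>\<Phi>\<close> contains the three-dimensional kernel of \<open>f\<close>. A second kernel
  vector \<open>h\<close> besides \<open>f\<close> would leave only two generators for that
  image.\<close>

theorem E_regular_nondegenerate:
  assumes reg: "E_regular A"
  shows "nondegenerate A"
  unfolding nondegenerate_def
proof (intro allI impI, rule ccontr)
  fix f h
  assume f: "f \<noteq> 0" and sub: "sub_covector A f"
    and lin: "\<forall>u v w. wedge A f h u v w + wedge A h f u v w = 0" and h: "\<nexists>c. h = c *s f"
  have A: "A \<in> zero_trace_algebras" "A \<notin> E_cone"
    using reg by (auto simp: E_regular_def)
  define \<Phi> where "\<Phi> h = dual_vector (\<lambda>u v w. wedge A f h u v w + wedge A h f u v w)" for h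
  have lin\<Phi>: "Vector_Spaces.linear (*s) (*s) \<Phi>"
  proof -
    have "\<Phi> (x + y) = \<Phi> x + \<Phi> y" for x y
      by (simp add: \<Phi>_def dual_vector_linear(1)[symmetric] wedge_def algebra_simps)
    moreover have "\<Phi> (c *s x) = c *s \<Phi> x" for c x
      by (simp add: \<Phi>_def dual_vector_linear(2)[symmetric] wedge_def algebra_simps)
    ultimately show ?thesis by (auto simp: Vector_Spaces.linear_iff vec.vector_space_axioms)
  qed
  have ker: "\<Phi> f = 0" "\<Phi> h = 0"
    using sub lin by (auto simp: \<Phi>_def sub_covector_def dual_vector_def vec_eq_iff forall_4)
  have range: "\<exists>x. \<Phi> x = y" if y: "f \<cdot> y = 0" for y
  proof -
    obtain z where z: "f \<cdot> z = 1" using f nonzero_cdot by blast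
    obtain B :: "complex^3^4" and c where B: "c \<noteq> 0" "column_span B = {x. f \<cdot> x = 0}"
      "plucker_covector (plucker B) = c *s f"
      by (rule exists_plucker_covector[OF f])
    have "A \<noteq> 0" using A(2) by (auto simp: E_cone_def)
    moreover have "subalgebra A (column_span B)"
      using sub f B(2) sub_covector_iff[OF alternating_zero_trace[OF A(1)]] by simp
    ultimately have "(plucker B, A) \<in> Z_cone"
      using A(1) dim_kernel[OF f] B(2) by (auto simp: Z_cone_def)
    moreover have "(plucker B, A) \<notin> Z_critical"
      using A(2) by (force simp: E_cone_def)
    ultimately obtain k w' a' where t: "(w', a') \<in> Z_tangent (plucker B, A)"
      and a': "test_algebra y z = a' + alg_scale k A"
      using test_algebra_zero_trace[of y z] unfolding Z_critical_def by blast
    define x where "x = plucker_covector w'"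
    \<comment> \<open>Passing to the quotient by the line through \<open>A\<close> is harmless:
      \<open>f\<close> is a zero of the section of \<open>A\<close>, so \<open>A\<close> contributes
      nothing.\<close>
    have "wedge (test_algebra y z) f f u v w = wedge a' f f u v w + k * wedge A f f u v w" for u v w
      by (simp add: a' wedge_def alg_scale_def algebra_simps)
    then have eq: "wedge (test_algebra y z) f f u v w = wedge a' f f u v w" for u v w
      using sub by (simp add: sub_covector_def)
    have "(- (1 / c)) * (wedge A f x u v w + wedge A x f u v w) = wedge (test_algebra y z) f f u v w" for u v w
    proof -
      have "c * (wedge A f x u v w + wedge A x f u v w) + c * c * wedge a' f f u v w = 0"
        using Z_tangent_wedge[OF t, of u v w] unfolding B(3) x_def[symmetric]
        by (simp add: wedge_def algebra_simps)
      then have "c * ((wedge A f x u v w + wedge A x f u v w) + c * wedge a' f f u v w) = 0"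
        by (simp add: algebra_simps)
      then show ?thesis using B(1) by (simp add: eq add_eq_0_iff2 divide_simps)
    qed
    then have "dual_vector (\<lambda>u v w. (- (1 / c)) * (wedge A f x u v w + wedge A x f u v w)) = y"
      using dual_vector_test_algebra[OF y z] by simp
    then have "(- (1 / c)) *s \<Phi> x = y"
      unfolding \<Phi>_def dual_vector_linear .
    then show ?thesis using vec.linear_scale[OF lin\<Phi>] by metis
  qed
  obtain g :: "complex^4^4" where g: "invertible g" "column 1 g = f" "column 2 g = h"
    using complete_pair[OF f h] by blast
  let ?T = "{\<Phi> (column 3 g), \<Phi> (column 4 g)}"
  have "{y. f \<cdot> y = 0} \<subseteq> vec.span ?T"
  proof
    fix y assume "y \<in> {y. f \<cdot> y = 0}"
    then obtain x where x: "\<Phi> x = y" using range by blast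
    obtain t where "x = g *v t"
      using g(1) by (metis invertible_def matrix_vector_mul_assoc matrix_vector_mul_lid)
    then have "x = t $ 1 *s f + t $ 2 *s h + t $ 3 *s column 3 g + t $ 4 *s column 4 g"
      by (simp add: matrix_mult_sum sum_4 g(2,3))
    then have "y = t $ 3 *s \<Phi> (column 3 g) + t $ 4 *s \<Phi> (column 4 g)"
      using x ker by (simp add: vec.linear_add[OF lin\<Phi>] vec.linear_scale[OF lin\<Phi>])
    then show "y \<in> vec.span ?T"
      by (simp add: vec.span_add vec.span_base vec.span_scale)
  qed
  then have "vec.dim {y. f \<cdot> y = 0} \<le> card ?T"
    by (rule vec.dim_le_card) simp
  also have "\<dots> \<le> 2" by (simp add: card_insert_if)
  finally show False using dim_kernel[OF f] by simp
qed

section \<open>Existence of a three-dimensional subalgebra\<close>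

lemma matrix_inv_mult:
  fixes g :: "complex^'n::finite^'n"
  assumes "invertible g"
  shows "g ** matrix_inv g = mat 1" "matrix_inv g ** g = mat 1"
  using someI_ex[OF assms[unfolded invertible_def]] by (simp_all add: matrix_inv_def)

lemma matrix_inv_vector:
  fixes g :: "complex^'n::finite^'n"
  assumes "invertible g"
  shows "g *v (matrix_inv g *v x) = x" "matrix_inv g *v (g *v x) = x"
  by (simp_all add: matrix_vector_mul_assoc matrix_inv_mult[OF assms])

lemma invertible_matrix_inv:
  fixes g :: "complex^'n::finite^'n"
  assumes "invertible g"
  shows "invertible (matrix_inv g)" "matrix_inv (matrix_inv g) = g"
proof -
  show i: "invertible (matrix_inv g)"
    using matrix_inv_mult[OF assms] by (auto simp: invertible_def)
  have "matrix_inv (matrix_inv g) = (g ** matrix_inv g) ** matrix_inv (matrix_inv g)"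
    by (simp add: matrix_inv_mult[OF assms])
  also have "\<dots> = g"
    by (simp add: matrix_mul_assoc[symmetric] matrix_inv_mult[OF i])
  finally show "matrix_inv (matrix_inv g) = g" .
qed

lemma vector_matrix_linear:
  fixes g :: "complex^'n::finite^'m::finite"
  shows "(x + y) v* g = x v* g + y v* g" "(c *s x) v* g = c *s (x v* g)" "(x - y) v* g = x v* g - y v* g"
  by (simp_all only: transpose_matrix_vector[symmetric] matrix_vector_right_distrib
      matrix_vector_mult_diff_distrib vec.scale)

lemma cdot_vector_matrix: "f \<cdot> (M *v x) = (f v* M) \<cdot> x"
  using cdot_matrix_vector[of f M x] by simp

lemma alternating_gl_act:
  assumes "alternating m" shows "alternating (gl_act g m)"
  using alternating_bilinear[OF assms]
  by (auto simp: alternating_def gl_act_def Vector_Spaces.linear_iff vec.vector_space_axioms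
      matrix_vector_right_distrib vec.scale)

lemma wedge_gl_act:
  assumes "invertible g"
  shows "wedge (gl_act g m) f h u v w = wedge m (f v* g) (h v* g)
    (matrix_inv g *v u) (matrix_inv g *v v) (matrix_inv g *v w)"
  by (simp add: wedge_def gl_act_def cdot_vector_matrix[symmetric] matrix_inv_vector[OF assms])

lemma sub_covector_gl_act:
  assumes "invertible g"
  shows "sub_covector (gl_act g m) f \<longleftrightarrow> sub_covector m (f v* g)"
proof
  assume s: "sub_covector m (f v* g)"
  then show "sub_covector (gl_act g m) f" by (simp add: sub_covector_def wedge_gl_act[OF assms])
next
  assume "sub_covector (gl_act g m) f"
  then have "wedge (gl_act g m) f f (g *v u) (g *v v) (g *v w) = 0" for u v w
    by (simp add: sub_covector_def)
  then show "sub_covector m (f v* g)"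
    by (simp add: sub_covector_def wedge_gl_act[OF assms] matrix_inv_vector[OF assms])
qed

lemma vector_matrix_inj:
  fixes g :: "complex^'n::finite^'n"
  assumes g: "invertible g" and xy: "x v* g = y v* g"
  shows "x = y"
proof -
  have "(x - y) \<cdot> (g *v w) = 0" for w
    by (simp add: cdot_vector_matrix vector_matrix_linear xy)
  then have "\<forall>w. (x - y) \<cdot> w = 0"
    by (metis matrix_inv_vector(1)[OF g])
  then show ?thesis unfolding cdot_eq_0_iff by simp
qed

lemma nondegenerate_gl_act:
  assumes g: "invertible g" and m: "nondegenerate m"
  shows "nondegenerate (gl_act g m)"
  unfolding nondegenerate_def
proof (intro allI impI)
  fix f h
  assume f: "f \<noteq> 0" and s: "sub_covector (gl_act g m) f"
    and l: "\<forall>u v w. wedge (gl_act g m) f h u v w + wedge (gl_act g m) h f u v w = 0"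
  have "f v* g \<noteq> 0"
    using vector_matrix_inj[OF g, of f 0] f by auto
  moreover have "sub_covector m (f v* g)"
    using s sub_covector_gl_act[OF g] by blast
  moreover have "wedge m (f v* g) (h v* g) u v w
      + wedge m (h v* g) (f v* g) u v w = 0" for u v w
    using l[rule_format, of "g *v u" "g *v v" "g *v w"]
    by (simp add: wedge_gl_act[OF g] matrix_inv_vector[OF g])
  ultimately obtain c where "h v* g = c *s (f v* g)"
    using m unfolding nondegenerate_def by blast
  then have "h v* g = (c *s f) v* g" by (simp add: vector_matrix_linear)
  then show "\<exists>c. h = c *s f" using vector_matrix_inj[OF g] by blast
qed

lemma gl_act_image:
  fixes g :: "complex^4^4"
  assumes g: "invertible g"
  shows "subalgebra (gl_act g m) ((*v) g ` U) \<longleftrightarrow> subalgebra m U"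
proof -
  have "inj ((*v) g)" using matrix_inv_vector(2)[OF g] by (metis injI)
  then have mem: "g *v x \<in> (*v) g ` U \<longleftrightarrow> x \<in> U" for x by (auto dest: injD)
  have sub: "vec.subspace ((*v) g ` U) \<longleftrightarrow> vec.subspace U"
  proof
    assume a: "vec.subspace ((*v) g ` U)"
    have "g *v 0 \<in> (*v) g ` U" using a by (simp add: vec.subspace_def)
    moreover have "g *v (x + y) \<in> (*v) g ` U" if "x \<in> U" "y \<in> U" for x y
      using a that by (simp add: vec.subspace_def matrix_vector_right_distrib)
    moreover have "g *v (c *s x) \<in> (*v) g ` U" if "x \<in> U" for x c
      using a that by (simp add: vec.subspace_def vec.scale)
    ultimately show "vec.subspace U" unfolding mem vec.subspace_def by blast
  next
    assume "vec.subspace U" then show "vec.subspace ((*v) g ` U)"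
      by (rule vec.subspace_image)
  qed
  show ?thesis
    unfolding subalgebra_def sub using mem
    by (simp add: gl_act_def matrix_inv_vector[OF g])
qed

lemma axis_expansion_4: "x = x $ 1 *s axis 1 1 + x $ 2 *s axis 2 1 + x $ 3 *s axis 3 1 + x $ 4 *s axis 4 1"
  for x :: "complex^4"
  by (simp add: vec_eq_iff forall_4 axis_def)

text \<open>Cyclic invariance carries linearity from the first argument to the others, and together
  with \<open>swap\<close> it generates all permutations, so entries with a repeated vector vanish.
  What remains on basis vectors are four numbers.\<close>

lemma alternating_trilinear_zero:
  fixes F :: "complex^4 \<Rightarrow> complex^4 \<Rightarrow> complex^4 \<Rightarrow> complex"
  assumes add: "\<And>u u' v w. F (u + u') v w = F u v w + F u' v w"
    and scale: "\<And>c u v w. F (c *s u) v w = c * F u v w"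
    and cyc: "\<And>u v w. F u v w = F v w u"
    and swap: "\<And>u v w. F v u w = - F u v w"
    and zero: "F (axis 1 1) (axis 2 1) (axis 3 1) = 0" "F (axis 1 1) (axis 2 1) (axis 4 1) = 0"
      "F (axis 1 1) (axis 3 1) (axis 4 1) = 0" "F (axis 2 1) (axis 3 1) (axis 4 1) = 0"
  shows "F u v w = 0"
proof -
  have exp: "F u v w = u $ 1 * F (axis 1 1) v w + u $ 2 * F (axis 2 1) v w
      + u $ 3 * F (axis 3 1) v w + u $ 4 * F (axis 4 1) v w" for u v w
    by (subst axis_expansion_4[of u]) (simp only: add scale)
  have rep: "F u u w = 0" for u w using swap[of u u w] by simp
  have perm: "F a b c = 0 \<Longrightarrow> F b c a = 0 \<and> F c a b = 0 \<and> F b a c = 0 \<and> F a c b = 0 \<and> F c b a = 0" for a b c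
    using cyc[of a b c] cyc[of b c a] swap[of b a c] swap[of c b a] swap[of a c b] by simp
  have rep': "F u w u = 0" "F w u u = 0" for u w
    using rep[of u w] cyc[of u u w] cyc[of u w u] by simp_all
  have "\<forall>i j k. F (axis i 1) (axis j 1) (axis k 1) = 0"
    unfolding forall_4 using zero[THEN perm] zero by (simp add: rep rep')
  then have e: "F (axis i 1) (axis j 1) (axis k 1) = 0" for i j k by blast
  have e2: "F (axis j 1) w (axis i 1) = 0" for i j w
    by (simp only: cyc[of "axis j 1" w "axis i 1"] exp[of w "axis i 1" "axis j 1"] e mult_zero_right add_0_right)
  have e3: "F (axis i 1) v w = 0" for i v w
    by (simp only: cyc[of "axis i 1" v w] exp[of v w "axis i 1"] e2 mult_zero_right add_0_right)
  show ?thesis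
    by (simp only: exp[of u v w] e3 mult_zero_right add_0_right)
qed

lemma wedge_cyc: "wedge m f h u v w = wedge m f h v w u"
  by (simp add: wedge_def)

lemma wedge_swap:
  assumes "alternating m" shows "wedge m f h v u w = - wedge m f h u v w"
  using alternating_swap[OF assms, of u v] alternating_swap[OF assms, of v w] alternating_swap[OF assms, of u w]
  by (simp add: wedge_def)

lemma wedge_linear:
  assumes "alternating m"
  shows "wedge m f h (u + u') v w = wedge m f h u v w + wedge m f h u' v w"
    "wedge m f h (c *s u) v w = c * wedge m f h u v w"
  by (simp_all add: wedge_def alternating_bilinear[OF assms] algebra_simps)

lemma wedge_covector_linear:
  "wedge m (f + f') h u v w = wedge m f h u v w + wedge m f' h u v w"
  "wedge m (c *s f) h u v w = c * wedge m f h u v w"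
  "wedge m f (h + h') u v w = wedge m f h u v w + wedge m f h' u v w"
  "wedge m f (c *s h) u v w = c * wedge m f h u v w"
  by (simp_all add: wedge_def algebra_simps)

lemma polar_wedge_zero:
  assumes m: "alternating m"
    and zero: "\<And>i j k. (i, j, k) \<in> {(1, 2, 3), (1, 2, 4), (1, 3, 4), (2, 3, 4)} \<Longrightarrow>
      wedge m f h (axis i 1) (axis j 1) (axis k 1) + wedge m h f (axis i 1) (axis j 1) (axis k 1) = 0"
  shows "wedge m f h u v w + wedge m h f u v w = 0"
proof (rule alternating_trilinear_zero[where F = "\<lambda>u v w. wedge m f h u v w + wedge m h f u v w"])
  show "wedge m f h u v w + wedge m h f u v w = wedge m f h v w u + wedge m h f v w u" for u v w
    by (simp only: wedge_cyc[of m f h u v w] wedge_cyc[of m h f u v w])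
  show "wedge m f h v u w + wedge m h f v u w = - (wedge m f h u v w + wedge m h f u v w)" for u v w
    by (simp add: wedge_swap[OF m, of _ _ v u w])
qed (use zero in \<open>auto simp: wedge_linear[OF m] algebra_simps\<close>)

lemma sub_covector_axis:
  assumes "alternating m"
  shows "sub_covector m f \<longleftrightarrow> wedge m f f (axis 1 1) (axis 2 1) (axis 3 1) = 0 \<and>
    wedge m f f (axis 1 1) (axis 2 1) (axis 4 1) = 0 \<and> wedge m f f (axis 1 1) (axis 3 1) (axis 4 1) = 0 \<and>
    wedge m f f (axis 2 1) (axis 3 1) (axis 4 1) = 0"
  using polar_wedge_zero[OF assms, of f f] unfolding sub_covector_def by auto

text \<open>A section of the line bundle of degree \<open>d\<close> on the projective line, given by \<open>F\<close> and \<open>G\<close> in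
  the two affine charts, has a zero.\<close>
lemma entire_root:
  fixes F G :: "complex \<Rightarrow> complex"
  assumes hol: "F holomorphic_on UNIV" and cont: "continuous (at 0) G" and d: "d \<ge> 1"
    and hom: "\<And>s. s \<noteq> 0 \<Longrightarrow> F s = s ^ d * G (1 / s)"
  shows "(\<exists>s. F s = 0) \<or> G 0 = 0"
proof (rule disjCI)
  assume nz: "G 0 \<noteq> 0"
  have "\<forall>\<^sub>F x in at_infinity. B \<le> norm (F x)" for B :: real
  proof -
    have "(G \<longlongrightarrow> G 0) (at 0)" using cont by (simp add: continuous_within)
    then have lim: "((\<lambda>s. G (1 / s)) \<longlongrightarrow> G 0) at_infinity"
      by (simp add: lim_at_infinity_0 o_def inverse_eq_divide)
    \<comment> \<open>Half of the limit remains a lower bound for \<open>G (1 / s)\<close> near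
      infinity. As \<open>d \<ge> 1\<close>, \<open>F\<close> then tends to infinity, which
      Liouville's theorem forbids for an entire function without zeros.\<close>
    define c where "c = norm (G 0) / 2"
    have c: "c > 0" using nz by (simp add: c_def)
    have "\<forall>\<^sub>F s in at_infinity. norm (G (1 / s)) > c"
      using tendsto_norm[OF lim] c by (intro order_tendstoD(1)[where a = c]) (auto simp: c_def)
    moreover have "\<forall>\<^sub>F s in at_infinity. norm (s::complex) \<ge> max 1 (B / c)"
      using eventually_at_infinity by blast
    ultimately show ?thesis
    proof eventually_elim
      case (elim s)
      then have s: "s \<noteq> 0" "1 \<le> norm s" "B / c \<le> norm s" by auto
      have "B \<le> norm s * c" using s(3) c by (simp add: divide_le_eq)
      also have "\<dots> \<le> norm s ^ d * norm (G (1 / s))"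
        using s(2) elim(1) c d by (intro mult_mono) (auto intro: self_le_power)
      also have "\<dots> = norm (F s)" using hom[OF s(1)] by (simp add: norm_mult norm_power)
      finally show ?case .
    qed
  qed
  then show "\<exists>s. F s = 0" using Liouville_weak_inverse[OF hol] by metis
qed

section \<open>Roots of binary forms and eigenvectors\<close>

lemma binary_quadratic_root:
  fixes a b c :: complex
  obtains s t where "(s, t) \<noteq> (0, 0)" "a * s\<^sup>2 + b * s * t + c * t\<^sup>2 = 0"
proof (cases "a = 0")
  case True
  \<comment> \<open>A vanishing leading coefficient means a root at infinity.\<close>
  then show ?thesis using that[of 1 0] by simp
next
  case False
  let ?d = "csqrt (b\<^sup>2 - 4 * a * c)"
  have d: "?d\<^sup>2 = b\<^sup>2 - 4 * a * c" by simp
  have "a * ((- b + ?d))\<^sup>2 + b * (- b + ?d) * (2 * a) + c * (2 * a)\<^sup>2 = 0"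
    using d by algebra
  then show ?thesis using that[of "- b + ?d" "2 * a"] False by simp
qed

text \<open>The determinant of the general member is a binary cubic form; \<open>s\<close> and
  \<open>u\<close> are the coordinates of the two affine charts of the projective line.\<close>

lemma singular_pencil_member:
  fixes P Q :: "complex^3^3"
  obtains a b k where "(a, b) \<noteq> (0, 0)" "k \<noteq> 0" "a *s (P *v k) + b *s (Q *v k) = 0"
proof -
  define M where "M a b = (\<chi> i j. a * P $ i $ j + b * Q $ i $ j)" for a b
  have Mk: "M a b *v k = a *s (P *v k) + b *s (Q *v k)" for a b k
    by (simp add: M_def matrix_vector_mult_def vec_eq_iff sum.distrib sum_distrib_left algebra_simps)
  have "(\<exists>s. det (M s 1) = 0) \<or> det (M 1 0) = 0"
  proof (rule entire_root[where d = 3 and G = "\<lambda>u. det (M 1 u)"])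
    show "(\<lambda>s. det (M s 1)) holomorphic_on UNIV"
      unfolding det_3 M_def vec_lambda_beta by (intro holomorphic_intros)
    have "(\<lambda>u. det (M 1 u)) holomorphic_on UNIV"
      unfolding det_3 M_def vec_lambda_beta by (intro holomorphic_intros)
    then show "continuous (at 0) (\<lambda>u. det (M 1 u))"
      using holomorphic_on_imp_continuous_on continuous_on_eq_continuous_at[OF open_UNIV] by blast
    show "det (M s 1) = s ^ 3 * det (M 1 (1 / s))" if "s \<noteq> 0" for s
      using that unfolding det_3 M_def by (simp add: field_simps power3_eq_cube)
  qed simp
  then obtain a b where ab: "(a, b) \<noteq> (0, 0)" "det (M a b) = 0"
    by (metis prod.inject zero_neq_one)
  then have "\<not> invertible (M a b)" by (simp add: invertible_det_nz)
  then obtain k where "k \<noteq> 0" "M a b *v k = 0"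
    using matrix_left_invertible_ker invertible_left_inverse by blast
  then show ?thesis using that ab(1) Mk by metis
qed

lemma two_in_kernel:
  fixes r :: "complex^3"
  obtains a b where "r \<cdot> a = 0" "r \<cdot> b = 0" "\<And>x y. x *s a + y *s b = 0 \<Longrightarrow> x = 0 \<and> y = 0"
proof -
  consider "r $ 1 \<noteq> 0" | "r $ 2 \<noteq> 0" | "r $ 3 \<noteq> 0" | "r = 0"
    by (auto simp: vec_eq_iff forall_3)
  then show ?thesis
  proof cases
    case 1
    show ?thesis
      by (rule that[of "vector [- r $ 2, r $ 1, 0]" "vector [- r $ 3, 0, r $ 1]"])
        (use 1 in \<open>auto simp: cdot_3 vec_eq_iff forall_3\<close>)
  next
    case 2
    show ?thesis
      by (rule that[of "vector [r $ 2, - r $ 1, 0]" "vector [0, - r $ 3, r $ 2]"])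
        (use 2 in \<open>auto simp: cdot_3 vec_eq_iff forall_3\<close>)
  next
    case 3
    show ?thesis
      by (rule that[of "vector [r $ 3, 0, - r $ 1]" "vector [0, r $ 3, - r $ 2]"])
        (use 3 in \<open>auto simp: cdot_3 vec_eq_iff forall_3\<close>)
  next
    case 4
    show ?thesis
      by (rule that[of "vector [1, 0, 0]" "vector [0, 1, 0]"])
        (use 4 in \<open>auto simp: cdot_3 vec_eq_iff forall_3\<close>)
  qed
qed

definition ccross :: "complex^3 \<Rightarrow> complex^3 \<Rightarrow> complex^3" where
  "ccross x y = vector [x $ 2 * y $ 3 - x $ 3 * y $ 2, x $ 3 * y $ 1 - x $ 1 * y $ 3,
     x $ 1 * y $ 2 - x $ 2 * y $ 1]"

lemma ccross_nth [simp]: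
  "ccross x y $ 1 = x $ 2 * y $ 3 - x $ 3 * y $ 2" "ccross x y $ 2 = x $ 3 * y $ 1 - x $ 1 * y $ 3"
  "ccross x y $ 3 = x $ 1 * y $ 2 - x $ 2 * y $ 1"
  by (simp_all add: ccross_def)

lemma ccross_eq_0:
  assumes "x \<noteq> 0" "ccross x y = 0"
  obtains c where "y = c *s x"
proof -
  have e: "x $ 2 * y $ 3 = x $ 3 * y $ 2" "x $ 3 * y $ 1 = x $ 1 * y $ 3" "x $ 1 * y $ 2 = x $ 2 * y $ 1"
    using assms(2) by (simp_all add: vec_eq_iff forall_3)
  consider "x $ 1 \<noteq> 0" | "x $ 2 \<noteq> 0" | "x $ 3 \<noteq> 0"
    using assms(1) by (auto simp: vec_eq_iff forall_3)
  then show ?thesis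
  proof cases
    case 1 then show ?thesis
      using e by (intro that[of "y $ 1 / x $ 1"]) (simp add: vec_eq_iff forall_3 field_simps)
  next
    case 2 then show ?thesis
      using e by (intro that[of "y $ 2 / x $ 2"]) (simp add: vec_eq_iff forall_3 field_simps)
  next
    case 3 then show ?thesis
      using e by (intro that[of "y $ 3 / x $ 3"]) (simp add: vec_eq_iff forall_3 field_simps)
  qed
qed

text \<open>An eigenvalue is a singular member of the pencil spanned by \<open>mat 1\<close> and
  \<open>M\<close>. The coefficient of \<open>M\<close> is nonzero because \<open>mat 1\<close>
  itself is nonsingular.\<close>

lemma eigenvector_3:
  fixes M :: "complex^3^3"
  obtains l k where "k \<noteq> 0" "M *v k = l *s k"
proof -
  obtain a b k where ab: "(a, b) \<noteq> (0, 0)" and k: "k \<noteq> 0" "a *s (mat 1 *v k) + b *s (M *v k) = 0"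
    using singular_pencil_member by blast
  have "b \<noteq> 0"
  proof
    assume "b = 0"
    then have "a *s k = 0" "a \<noteq> 0" using ab k(2) by simp_all
    then show False using k(1) by (simp add: vec_eq_iff)
  qed
  moreover have "b *s (M *v k) = (- a) *s k" using k(2) by (simp add: vec_eq_iff add_eq_0_iff)
  ultimately have "M *v k = (- a / b) *s k" by (simp add: vec_eq_iff field_simps)
  then show ?thesis using that k(1) by blast
qed

text \<open>Since \<open>m e e = 0\<close>, multiplication by the first unit vector \<open>e\<close>
  acts on the three-dimensional quotient by \<open>e\<close>, with matrix \<open>M\<close>. An
  eigenvector there, lifted to \<open>w\<close>, spans with \<open>e\<close> a plane closed under
  multiplication.\<close>

lemma exists_plane_subalgebra:
  assumes m: "alternating m"
  obtains g a b where "invertible g" "gl_act g m (axis 1 1) (axis 2 1) = a *s axis 1 1 + b *s axis 2 1"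
proof -
  let ?e = "axis 1 1 :: complex^4"
  define M :: "complex^3^3" where
    "M = vector [vector [m ?e (axis 2 1) $ 2, m ?e (axis 3 1) $ 2, m ?e (axis 4 1) $ 2],
      vector [m ?e (axis 2 1) $ 3, m ?e (axis 3 1) $ 3, m ?e (axis 4 1) $ 3],
      vector [m ?e (axis 2 1) $ 4, m ?e (axis 3 1) $ 4, m ?e (axis 4 1) $ 4]]"
  obtain l k where k: "k \<noteq> 0" "M *v k = l *s k" using eigenvector_3 by blast
  define w :: "complex^4" where "w = vector [0, k $ 1, k $ 2, k $ 3]"
  have "w = k $ 1 *s axis 2 1 + k $ 2 *s axis 3 1 + k $ 3 *s axis 4 1"
    by (simp add: w_def vec_eq_iff forall_4 axis_def)
  then have "m ?e w = k $ 1 *s m ?e (axis 2 1) + k $ 2 *s m ?e (axis 3 1) + k $ 3 *s m ?e (axis 4 1)"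
    by (simp only: alternating_bilinear[OF m])
  then have mw: "m ?e w = m ?e w $ 1 *s ?e + l *s w"
    using k(2) by (simp add: M_def w_def vec_eq_iff forall_4 forall_3 axis_def
        matrix_vector_mult_def sum_3 algebra_simps)
  have "\<nexists>c. w = c *s ?e"
    using k(1) by (auto simp: w_def vec_eq_iff forall_4 forall_3 axis_def)
  moreover have "?e \<noteq> 0" by (simp add: axis_eq_0_iff)
  ultimately obtain g :: "complex^4^4" where g: "invertible g" "column 1 g = ?e" "column 2 g = w"
    using complete_pair by blast
  have ge: "g *v axis 1 1 = ?e" "g *v axis 2 1 = w" by (simp_all add: matrix_vector_axis g(2,3))
  have "gl_act (matrix_inv g) m (axis 1 1) (axis 2 1) = matrix_inv g *v m ?e w"
    by (simp add: gl_act_def invertible_matrix_inv[OF g(1)] ge)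
  also have "\<dots> = m ?e w $ 1 *s (matrix_inv g *v ?e) + l *s (matrix_inv g *v w)"
    by (subst mw) (simp add: matrix_vector_right_distrib vec.scale)
  also have "matrix_inv g *v ?e = axis 1 1" using matrix_inv_vector(2)[OF g(1), of "axis 1 1"] ge by simp
  also have "matrix_inv g *v w = axis 2 1" using matrix_inv_vector(2)[OF g(1), of "axis 2 1"] ge by simp
  finally show ?thesis using that invertible_matrix_inv(1)[OF g(1)] by blast
qed

text \<open>If \<open>f\<close> kills a vector \<open>v\<close> and is an eigenvector of the transpose of \<open>m v\<close>, then
  \<open>wedge m f f\<close> vanishes as soon as one of its values not involving \<open>v\<close> does.\<close>
lemma eigencovector_sub_covector:
  assumes m: "alternating m"
    and f0: "s * f $ 1 + t * f $ 2 = 0"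
    and eig: "\<And>x. f \<cdot> m (s *s axis 1 1 + t *s axis 2 1) x = l * (f \<cdot> x)"
    and z: "(t \<noteq> 0 \<and> wedge m f f (axis 1 1) (axis 3 1) (axis 4 1) = 0) \<or>
      (s \<noteq> 0 \<and> wedge m f f (axis 2 1) (axis 3 1) (axis 4 1) = 0)"
  shows "sub_covector m f"
proof -
  let ?W = "wedge m f f"
  have "f \<cdot> (s *s axis 1 1 + t *s axis 2 1) = 0" using f0 by (simp add: mult.commute)
  then have "?W (s *s axis 1 1 + t *s axis 2 1) x y = 0" for x y
    using eig[of x] eig[of y]
    unfolding wedge_def alternating_swap[OF m, of y "s *s axis 1 1 + t *s axis 2 1"] by simp
  then have v: "s * ?W (axis 1 1) x y + t * ?W (axis 2 1) x y = 0" for x y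
    by (simp only: wedge_linear[OF m])
  have rep: "?W x x y = 0" "?W x y x = 0" for x y
    using wedge_swap[OF m, of f f x x y] wedge_cyc[of m f f x y x] wedge_cyc[of m f f y x x]
      wedge_swap[OF m, of f f x x y] by (simp_all add: wedge_cyc[of m f f x y x])
  have sw: "?W (axis 2 1) (axis 1 1) y = - ?W (axis 1 1) (axis 2 1) y" for y
    by (rule wedge_swap[OF m])
  have 1: "t * ?W (axis 1 1) (axis 2 1) y = 0" for y
    using v[of "axis 1 1" y] rep sw by simp
  have 2: "s * ?W (axis 1 1) (axis 2 1) y = 0" for y
    using v[of "axis 2 1" y] rep by simp
  have "s \<noteq> 0 \<or> t \<noteq> 0" using z by blast
  then have 3: "?W (axis 1 1) (axis 2 1) y = 0" for y using 1[of y] 2[of y] by auto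
  have "?W (axis 1 1) (axis 3 1) (axis 4 1) = 0 \<and> ?W (axis 2 1) (axis 3 1) (axis 4 1) = 0"
    using z v[of "axis 3 1" "axis 4 1"] by auto
  then show ?thesis using 3 sub_covector_axis[OF m] by simp
qed

text \<open>For each vector \<open>v\<close> of an invariant plane, the transpose of \<open>m v\<close> has an eigenvector killing
  \<open>v\<close> whose coordinates are forms in \<open>v\<close>. The remaining condition on it is a form of degree 5 on
  the plane, which has a zero.\<close>
lemma exists_sub_covector_of_plane:
  assumes m: "alternating m"
    and plane: "m (axis 1 1) (axis 2 1) = a *s axis 1 1 + b *s axis 2 1"
  obtains f where "f \<noteq> 0" "sub_covector m f"
proof -
  define v :: "complex \<Rightarrow> complex \<Rightarrow> complex^4" where "v s t = s *s axis 1 1 + t *s axis 2 1" for s t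
  define c where "c i j s t = s * m (axis 1 1) (axis j 1) $ i + t * m (axis 2 1) (axis j 1) $ i" for i j s t
  \<comment> \<open>The eigenvalue of \<open>m (v s t)\<close> on the invariant plane modulo
    \<open>v s t\<close>. A covector killing \<open>v s t\<close> but not the whole plane can only
    be an eigenvector of the transpose for this value.\<close>
  define l where "l s t = s * b - t * a" for s t
  define r where "r j s t = - t * c 1 j s t + s * c 2 j s t" for j s t
  define F :: "complex \<Rightarrow> complex \<Rightarrow> complex^3 \<Rightarrow> complex^4" where
    "F s t x = vector [- t * x $ 1, s * x $ 1, x $ 2, x $ 3]" for s t x
  \<comment> \<open>The choice of \<open>l\<close> settles the eigenvector condition on the plane.
    The conditions at \<open>axis 3 1\<close> and \<open>axis 4 1\<close> remain, and they are
    linear in \<open>x\<close>.\<close>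
  define row3 :: "complex \<Rightarrow> complex \<Rightarrow> complex^3" where
    "row3 s t = vector [r 3 s t, c 3 3 s t - l s t, c 4 3 s t]" for s t
  define row4 :: "complex \<Rightarrow> complex \<Rightarrow> complex^3" where
    "row4 s t = vector [r 4 s t, c 3 4 s t, c 4 4 s t - l s t]" for s t
  have vj: "m (v s t) (axis j 1) $ i = c i j s t" for s t i j
    by (simp add: v_def c_def alternating_bilinear[OF m])
  have eig: "F s t x \<cdot> m (v s t) y = l s t * (F s t x \<cdot> y)"
    if x: "row3 s t \<cdot> x = 0" "row4 s t \<cdot> x = 0" for s t x y
  proof -
    let ?f = "F s t x"
    have e21: "m (axis 2 1) (axis 1 1) = - (a *s axis 1 1 + b *s axis 2 1)"
      using alternating_swap[OF m] plane by metis
    then have 1: "?f \<cdot> m (v s t) (axis 1 1) = l s t * ?f $ 1" "?f \<cdot> m (v s t) (axis 2 1) = l s t * ?f $ 2"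
      unfolding v_def alternating_bilinear[OF m] plane e21 by (simp_all add: F_def l_def algebra_simps)
    have 2: "?f \<cdot> m (v s t) (axis 3 1) = l s t * ?f $ 3" "?f \<cdot> m (v s t) (axis 4 1) = l s t * ?f $ 4"
      using x unfolding cdot_4 cdot_3 vj
      by (simp_all add: F_def row3_def row4_def r_def algebra_simps vector_3)
    have "m (v s t) y = y $ 1 *s m (v s t) (axis 1 1) + y $ 2 *s m (v s t) (axis 2 1)
        + y $ 3 *s m (v s t) (axis 3 1) + y $ 4 *s m (v s t) (axis 4 1)"
      by (subst axis_expansion_4[of y]) (simp only: alternating_bilinear[OF m])
    then have "?f \<cdot> m (v s t) y = y $ 1 * (l s t * ?f $ 1) + y $ 2 * (l s t * ?f $ 2)
        + y $ 3 * (l s t * ?f $ 3) + y $ 4 * (l s t * ?f $ 4)"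
      by (simp only: cdot_add cdot_scale 1 2)
    then show ?thesis by (simp add: cdot_4 algebra_simps)
  qed
  have Flin: "F s t (p *s x + q *s y) = p *s F s t x + q *s F s t y" for s t p q x y
    by (simp add: F_def vec_eq_iff forall_4 algebra_simps)
  have F0: "x = 0" if "F s t x = 0" "(s, t) \<noteq> (0, 0)" for s t x
    using that by (auto simp: F_def vec_eq_iff forall_4 forall_3)
  have sub: "sub_covector m (F s t x)"
    if x: "row3 s t \<cdot> x = 0" "row4 s t \<cdot> x = 0"
      and z: "(t \<noteq> 0 \<and> wedge m (F s t x) (F s t x) (axis 1 1) (axis 3 1) (axis 4 1) = 0) \<or>
        (s \<noteq> 0 \<and> wedge m (F s t x) (F s t x) (axis 2 1) (axis 3 1) (axis 4 1) = 0)" for s t x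
    by (rule eigencovector_sub_covector[OF m _ eig[OF x, unfolded v_def] z]) (simp add: F_def)
  \<comment> \<open>The entries of this solution are forms of degree 2, 3, 3, so all coordinates of
    \<open>F s t (x s t)\<close> have degree 3.\<close>
  define x where "x s t = ccross (row3 s t) (row4 s t)" for s t
  have rx: "row3 s t \<cdot> x s t = 0" "row4 s t \<cdot> x s t = 0" for s t
    by (simp_all add: x_def cdot_3 algebra_simps)
  \<comment> \<open>If the two rows are dependent, the solutions contain a two-dimensional space.
    The last condition is a quadratic form there, so it has a nontrivial zero. The vector
    \<open>w\<close> completes \<open>v s t\<close> to a basis of the plane.\<close>
  have degenerate: "\<exists>f. f \<noteq> 0 \<and> sub_covector m f" if st: "(s, t) \<noteq> (0, 0)" and x0: "x s t = 0" for s t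
  proof -
    obtain \<rho> where \<rho>: "\<And>y. \<rho> \<cdot> y = 0 \<Longrightarrow> row3 s t \<cdot> y = 0 \<and> row4 s t \<cdot> y = 0"
    proof (cases "row3 s t = 0")
      case True then show ?thesis using that[of "row4 s t"] by simp
    next
      case False
      then obtain c where "row4 s t = c *s row3 s t" using ccross_eq_0 x0 unfolding x_def by metis
      then show ?thesis using that[of "row3 s t"] by simp
    qed
    obtain p q where pq: "\<rho> \<cdot> p = 0" "\<rho> \<cdot> q = 0" "\<And>x y. x *s p + y *s q = 0 \<Longrightarrow> x = 0 \<and> y = 0"
      using two_in_kernel by blast
    define w :: "complex^4" where "w = (if t \<noteq> 0 then axis 1 1 else axis 2 1)"
    let ?W = "\<lambda>f h. wedge m f h w (axis 3 1) (axis 4 1)"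
    obtain \<alpha> \<beta> where \<alpha>\<beta>: "(\<alpha>, \<beta>) \<noteq> (0, 0)" "?W (F s t p) (F s t p) * \<alpha>\<^sup>2
       + (?W (F s t p) (F s t q) + ?W (F s t q) (F s t p)) * \<alpha> * \<beta> + ?W (F s t q) (F s t q) * \<beta>\<^sup>2 = 0"
      using binary_quadratic_root by blast
    define y where "y = \<alpha> *s p + \<beta> *s q"
    have "\<rho> \<cdot> y = 0" using pq(1,2) by (simp add: y_def)
    then have ry: "row3 s t \<cdot> y = 0" "row4 s t \<cdot> y = 0" using \<rho> by auto
    have "y \<noteq> 0" using pq(3) \<alpha>\<beta>(1) unfolding y_def by blast
    then have "F s t y \<noteq> 0" using F0 st by blast
    moreover have "?W (F s t y) (F s t y) = 0"
      using \<alpha>\<beta>(2) unfolding y_def Flin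
      by (simp add: wedge_covector_linear power2_eq_square algebra_simps)
    then have "sub_covector m (F s t y)"
      using sub[OF ry] st by (auto simp: w_def split: if_splits)
    ultimately show ?thesis by blast
  qed
  \<comment> \<open>The form \<open>wedge\<close> has degree 6 here. Its values \<open>W1\<close>,
    \<open>W2\<close> at \<open>axis 1 1\<close> and \<open>axis 2 1\<close> satisfy
    \<open>s * W1 + t * W2 = 0\<close>, so they are \<open>t\<close> and \<open>- s\<close> times
    one quintic form. \<open>\<Phi>\<close> and \<open>\<Psi>\<close> are that quintic in the charts
    \<open>t = 1\<close> and \<open>s = 1\<close>.\<close>
  define \<Phi> where "\<Phi> s = wedge m (F s 1 (x s 1)) (F s 1 (x s 1)) (axis 1 1) (axis 3 1) (axis 4 1)" for s
  define \<Psi> where "\<Psi> u = - wedge m (F 1 u (x 1 u)) (F 1 u (x 1 u)) (axis 2 1) (axis 3 1) (axis 4 1)" for u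
  have "(\<exists>s. \<Phi> s = 0) \<or> \<Psi> 0 = 0"
  proof (rule entire_root[where d = 5])
    show "\<Phi> holomorphic_on UNIV"
      unfolding \<Phi>_def wedge_def cdot_4 F_def x_def row3_def row4_def r_def c_def l_def ccross_def vector_4 vector_3
      by (intro holomorphic_intros)
    have "\<Psi> holomorphic_on UNIV"
      unfolding \<Psi>_def wedge_def cdot_4 F_def x_def row3_def row4_def r_def c_def l_def ccross_def vector_4 vector_3
      by (intro holomorphic_intros)
    then show "continuous (at 0) \<Psi>"
      using holomorphic_on_imp_continuous_on continuous_on_eq_continuous_at[OF open_UNIV] by blast
    show "\<Phi> s = s ^ 5 * \<Psi> (1 / s)" if s: "s \<noteq> 0" for s
    proof -
      let ?u = "1 / s"
      have hom: "c i j s 1 = s * c i j 1 ?u" "l s 1 = s * l 1 ?u" for i j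
        using s by (simp_all add: c_def l_def field_simps)
      have "r j s 1 = s\<^sup>2 * r j 1 ?u" for j
        using s unfolding r_def hom by (simp add: field_simps power2_eq_square)
      then have "F s 1 (x s 1) = s ^ 3 *s F 1 ?u (x 1 ?u)"
        using s unfolding F_def x_def row3_def row4_def hom
        by (simp add: vec_eq_iff forall_4 vector_3 field_simps power2_eq_square power3_eq_cube)
      then have 1: "\<Phi> s = s ^ 6 * wedge m (F 1 ?u (x 1 ?u)) (F 1 ?u (x 1 ?u)) (axis 1 1) (axis 3 1) (axis 4 1)"
        unfolding \<Phi>_def by (simp add: wedge_covector_linear power_add[symmetric])
      let ?f = "F 1 ?u (x 1 ?u)"
      have "?f \<cdot> v 1 ?u = 0" by (simp add: F_def v_def)
      then have "wedge m ?f ?f (v 1 ?u) y z = 0" for y z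
        using eig[OF rx, of 1 ?u y] eig[OF rx, of 1 ?u z]
        unfolding wedge_def alternating_swap[OF m, of z "v 1 ?u"] by simp
      then have "wedge m ?f ?f (axis 1 1) (axis 3 1) (axis 4 1) + ?u * wedge m ?f ?f (axis 2 1) (axis 3 1) (axis 4 1) = 0"
        unfolding v_def wedge_linear[OF m] by simp
      then have W: "wedge m ?f ?f (axis 1 1) (axis 3 1) (axis 4 1) = - (?u * wedge m ?f ?f (axis 2 1) (axis 3 1) (axis 4 1))"
        by (simp only: eq_neg_iff_add_eq_0)
      show ?thesis using s unfolding 1 W \<Psi>_def by (simp add: eval_nat_numeral)
    qed
  qed simp
  then consider s where "\<Phi> s = 0" | "\<Psi> 0 = 0" by blast
  then have "\<exists>f. f \<noteq> 0 \<and> sub_covector m f"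
  proof cases
    case 1
    show ?thesis
    proof (cases "x s 1 = 0")
      case True then show ?thesis using degenerate[of s 1] by simp
    next
      case False
      then have "F s 1 (x s 1) \<noteq> 0" using F0 by fastforce
      moreover have "sub_covector m (F s 1 (x s 1))" using sub[OF rx, of 1 s] 1 by (simp add: \<Phi>_def)
      ultimately show ?thesis by blast
    qed
  next
    case 2
    show ?thesis
    proof (cases "x 1 0 = 0")
      case True then show ?thesis using degenerate[of 1 0] by simp
    next
      case False
      then have "F 1 0 (x 1 0) \<noteq> 0" using F0 by fastforce
      moreover have "sub_covector m (F 1 0 (x 1 0))" using sub[OF rx, of 0 1] 2 by (simp add: \<Psi>_def)
      ultimately show ?thesis by blast
    qed
  qed
  then show ?thesis using that by blast
qed

theorem exists_sub_covector:
  assumes m: "alternating m"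
  obtains f where "f \<noteq> 0" "sub_covector m f"
proof -
  obtain g a b where g: "invertible g" "gl_act g m (axis 1 1) (axis 2 1) = a *s axis 1 1 + b *s axis 2 1"
    using exists_plane_subalgebra[OF m] by blast
  obtain f where f: "f \<noteq> 0" "sub_covector (gl_act g m) f"
    using exists_sub_covector_of_plane[OF alternating_gl_act[OF m] g(2)] by blast
  have "f v* g \<noteq> 0"
    using vector_matrix_inj[OF g(1), of f 0] f(1) by auto
  then show ?thesis using that f(2) sub_covector_gl_act[OF g(1)] by blast
qed

section \<open>Pencils of conics\<close>

lemma indep3_span:
  fixes a b c :: "complex^3"
  assumes ind: "\<And>x y z. x *s a + y *s b + z *s c = 0 \<Longrightarrow> x = 0 \<and> y = 0 \<and> z = 0"
  obtains x y z where "v = x *s a + y *s b + z *s c"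
proof -
  define M :: "complex^3^3" where "M = (\<chi> i j. (vector [a, b, c] :: complex^3^3) $ j $ i)"
  have M: "M *v x = x $ 1 *s a + x $ 2 *s b + x $ 3 *s c" for x
    by (simp add: M_def matrix_vector_mult_def sum_3 vec_eq_iff algebra_simps)
  have "invertible M"
    unfolding invertible_left_inverse matrix_left_invertible_ker
  proof (intro allI impI)
    fix x assume "M *v x = 0"
    then have "x $ 1 = 0 \<and> x $ 2 = 0 \<and> x $ 3 = 0" unfolding M by (rule ind)
    then show "x = 0" by (simp add: vec_eq_iff forall_3)
  qed
  then obtain w where "v = M *v w"
    using matrix_inv_vector(1) by metis
  then show ?thesis using that M by blast
qed

lemma two_complement:
  fixes k :: "complex^3"
  assumes "k \<noteq> 0"
  obtains u w where "\<And>x y z. x *s k + y *s u + z *s w = 0 \<Longrightarrow> x = 0 \<and> y = 0 \<and> z = 0"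
proof -
  consider "k $ 1 \<noteq> 0" | "k $ 2 \<noteq> 0" | "k $ 3 \<noteq> 0"
    using assms by (auto simp: vec_eq_iff forall_3)
  then show ?thesis
  proof cases
    case 1 then show ?thesis
      by (intro that[of "axis 2 1" "axis 3 1"]) (auto simp: vec_eq_iff forall_3 axis_def)
  next
    case 2 then show ?thesis
      by (intro that[of "axis 1 1" "axis 3 1"]) (auto simp: vec_eq_iff forall_3 axis_def)
  next
    case 3 then show ?thesis
      by (intro that[of "axis 1 1" "axis 2 1"]) (auto simp: vec_eq_iff forall_3 axis_def)
  qed
qed

text \<open>At a common point \<open>n\<close> the polar lines of \<open>n\<close> are the tangents.
  That they share only \<open>n\<close> means that both conics are smooth there and cross with
  distinct tangents.\<close>

definition transversal :: "complex^3^3 \<Rightarrow> complex^3^3 \<Rightarrow> bool" where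
  "transversal P Q \<longleftrightarrow> transpose P = P \<and> transpose Q = Q \<and>
     (\<forall>n y. n \<noteq> 0 \<longrightarrow> n \<cdot> (P *v n) = 0 \<longrightarrow> n \<cdot> (Q *v n) = 0 \<longrightarrow> n \<cdot> (P *v y) = 0 \<longrightarrow>
        n \<cdot> (Q *v y) = 0 \<longrightarrow> (\<exists>c. y = c *s n))"

text \<open>The pencil contains a pair of lines meeting in \<open>k\<close>; each line contains two of the
  four common points, which are interchanged by the reflection at the polar line of \<open>k\<close>.\<close>
lemma pencil_base_points:
  assumes "transversal P Q"
  obtains k y z where
    "\<And>a b c. a *s k + b *s y + c *s z = 0 \<Longrightarrow> a = 0 \<and> b = 0 \<and> c = 0"
    "\<And>x. x \<cdot> (P *v x) = 0 \<and> x \<cdot> (Q *v x) = 0 \<longleftrightarrow>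
       (\<exists>c. x = c *s (y + k) \<or> x = c *s (y - k) \<or> x = c *s (z + k) \<or> x = c *s (z - k))"
proof -
  define B where "B M x y = x \<cdot> (M *v y)" for M :: "complex^3^3" and x y
  have sym: "B M x y = B M y x" if "transpose M = M" for M x y
    unfolding B_def by (metis cdot_commute cdot_matrix_vector that)
  have Blin: "B M (x + x') y = B M x y + B M x' y" "B M x (y + y') = B M x y + B M x y'"
    "B M (c *s x) y = c * B M x y" "B M x (c *s y) = c * B M x y"
    "B M (x - x') y = B M x y - B M x' y" "B M x (y - y') = B M x y - B M x y'" for M x x' y y' c
    by (simp_all add: B_def matrix_vector_right_distrib matrix_vector_mult_diff_distrib vec.scale)
  have PQ: "transpose P = P" "transpose Q = Q" using assms by (auto simp: transversal_def)
  have tr: "\<exists>c. y = c *s n" if "n \<noteq> 0" "B P n n = 0" "B Q n n = 0" "B P n y = 0" "B Q n y = 0" for n y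
    using assms that unfolding transversal_def B_def by blast
  obtain s t k where st: "(s, t) \<noteq> (0, 0)" and k: "k \<noteq> 0" "s *s (P *v k) + t *s (Q *v k) = 0"
    using singular_pencil_member by blast
  \<comment> \<open>\<open>K\<close> is the singular member with vertex \<open>k\<close>, and
    \<open>H\<close> is a second member chosen so that both span the pencil.\<close>
  define K where "K x y = s * B P x y + t * B Q x y" for x y
  define H where "H = B (if t \<noteq> 0 then P else Q)"
  have Ksym: "K x y = K y x" for x y unfolding K_def using sym PQ by metis
  have Hsym: "H x y = H y x" for x y unfolding H_def using sym PQ by metis
  have Klin: "K (x + x') y = K x y + K x' y" "K x (y + y') = K x y + K x y'"
    "K (c *s x) y = c * K x y" "K x (c *s y) = c * K x y"
    "K (x - x') y = K x y - K x' y" "K x (y - y') = K x y - K x y'" for x x' y y' c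
    by (simp_all add: K_def Blin algebra_simps)
  have Hlin: "H (x + x') y = H x y + H x' y" "H x (y + y') = H x y + H x y'"
    "H (c *s x) y = c * H x y" "H x (c *s y) = c * H x y"
    "H (x - x') y = H x y - H x' y" "H x (y - y') = H x y - H x y'" for x x' y y' c
    by (simp_all add: H_def Blin)
  have KH: "K x y = 0 \<and> H x y = 0 \<longleftrightarrow> B P x y = 0 \<and> B Q x y = 0" for x y
    using st by (auto simp: K_def H_def)
  have tr': "\<exists>c. y = c *s n" if "n \<noteq> 0" "K n n = 0" "H n n = 0" "K n y = 0" "H n y = 0" for n y
    using tr KH that by blast
  have Kk: "K k y = 0" for y
  proof -
    have "K y k = y \<cdot> (s *s (P *v k) + t *s (Q *v k))" by (simp add: K_def B_def)
    then show ?thesis using k(2) Ksym by simp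
  qed
  \<comment> \<open>If a vertex \<open>n\<close> of \<open>K\<close> lay on \<open>H\<close>, the
    two tangency conditions at \<open>n\<close> would reduce to the single one
    \<open>H n y = 0\<close>, which has solutions outside the line of \<open>n\<close>.\<close>
  have singular: "H n n \<noteq> 0" if n: "n \<noteq> 0" and Kn: "\<And>y. K n y = 0" for n
  proof
    assume h: "H n n = 0"
    obtain u w where uw: "\<And>x y z. x *s n + y *s u + z *s w = 0 \<Longrightarrow> x = 0 \<and> y = 0 \<and> z = 0"
      using two_complement[OF n] by blast
    have "\<exists>a b. (a, b) \<noteq> (0, 0) \<and> a * H n u + b * H n w = 0"
    proof (cases "H n u = 0")
      case True then show ?thesis by (intro exI[of _ 1] exI[of _ 0]) simp
    next
      case False then show ?thesis by (intro exI[of _ "H n w"] exI[of _ "- H n u"]) simp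
    qed
    then obtain a b where ab: "(a, b) \<noteq> (0, 0)" "a * H n u + b * H n w = 0" by blast
    have "H n (a *s u + b *s w) = 0" using ab(2) by (simp add: Hlin)
    then obtain c where "a *s u + b *s w = c *s n" using tr'[OF n] h Kn by blast
    then have "(- c) *s n + a *s u + b *s w = 0" by (simp add: vec_eq_iff algebra_simps)
    then show False using uw ab(1) by blast
  qed
  note Hk = singular[OF k(1) Kk]
  obtain u0 w0 where uw0: "\<And>x y z. x *s k + y *s u0 + z *s w0 = 0 \<Longrightarrow> x = 0 \<and> y = 0 \<and> z = 0"
    using two_complement[OF k(1)] by blast
  \<comment> \<open>Subtracting the \<open>H\<close>-projection onto \<open>k\<close> makes
    \<open>u\<close> and \<open>w\<close> a basis of the polar line \<open>Y\<close> of
    \<open>k\<close> with respect to \<open>H\<close>.\<close>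
  define u where "u = u0 - (H k u0 / H k k) *s k"
  define w where "w = w0 - (H k w0 / H k k) *s k"
  have Hku: "H k u = 0" "H k w = 0" using Hk by (simp_all add: u_def w_def Hlin)
  have uw: "x = 0 \<and> y = 0 \<and> z = 0" if "x *s k + y *s u + z *s w = 0" for x y z
  proof -
    have "(x - y * (H k u0 / H k k) - z * (H k w0 / H k k)) *s k + y *s u0 + z *s w0 = 0"
      using that by (simp add: u_def w_def vec_eq_iff algebra_simps)
    then show ?thesis using uw0 by fastforce
  qed
  define Y where "Y x \<longleftrightarrow> H k x = 0" for x
  have Yk: "\<not> Y k" using Hk by (simp add: Y_def)
  have span: "\<exists>a b. x = a *s u + b *s w" if "Y x" for x
  proof -
    obtain c a b where x: "x = c *s k + a *s u + b *s w" using indep3_span[OF uw] by blast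
    then have "c * H k k = 0" using that Hku by (simp add: Y_def Hlin)
    then show ?thesis using x Hk by auto
  qed
  \<comment> \<open>On \<open>Y\<close> the form \<open>K\<close> is nondegenerate. Otherwise
    \<open>K\<close> would be a double line with a second vertex \<open>y\<close>; every point of
    the line joining \<open>k\<close> and \<open>y\<close> would then be a vertex, and
    \<open>H\<close> vanishes at one of them.\<close>
  have nondeg: "\<exists>z. Y z \<and> K y z \<noteq> 0" and Hyy: "H y y \<noteq> 0" if y: "Y y" "y \<noteq> 0" "K y y = 0" for y
  proof -
    show H: "H y y \<noteq> 0"
    proof
      assume "H y y = 0"
      then obtain c where "k = c *s y" using tr'[of y k] y Kk[of y] Ksym Hsym by (auto simp: Y_def)
      then show False using Hk y(1) by (auto simp: Y_def Hlin)
    qed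
    show "\<exists>z. Y z \<and> K y z \<noteq> 0"
    proof (rule ccontr)
      assume "\<not> ?thesis"
      then have Ky: "K y u = 0" "K y w = 0" using Hku by (auto simp: Y_def)
      have K0: "K y x = 0" for x
      proof -
        obtain c a b where "x = c *s k + a *s u + b *s w" using indep3_span[OF uw] by blast
        then show ?thesis using Ky Kk[of y] Ksym[of y k] by (simp add: Klin)
      qed
      define c where "c = csqrt (- H y y / H k k)"
      have c2: "c * c * H k k = - H y y"
        using Hk by (simp add: c_def power2_eq_square[symmetric])
      define n where "n = c *s k + y"
      have Kn: "K n x = 0" for x using K0 Kk by (simp add: n_def Klin)
      have "H n n = 0" using c2 y(1) Hsym[of y k] by (simp add: n_def Hlin Y_def algebra_simps)
      have "n \<noteq> 0"
      proof
        assume "n = 0"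
        then have "H k n = 0" by (simp add: H_def B_def)
        then have "c = 0" using Hk y(1) by (simp add: n_def Hlin Y_def)
        then show False using c2 H by simp
      qed
      show False using singular[OF \<open>n \<noteq> 0\<close> Kn] \<open>H n n = 0\<close> by simp
    qed
  qed
  obtain a b where ab: "(a, b) \<noteq> (0, 0)" "K u u * a\<^sup>2 + (2 * K u w) * a * b + K w w * b\<^sup>2 = 0"
    using binary_quadratic_root by blast
  define y1 where "y1 = a *s u + b *s w"
  have y1: "Y y1" "K y1 y1 = 0" "y1 \<noteq> 0"
  proof -
    show "Y y1" using Hku by (simp add: Y_def y1_def Hlin)
    show "K y1 y1 = 0"
      using ab(2) Ksym[of w u] by (simp add: y1_def Klin power2_eq_square algebra_simps)
    show "y1 \<noteq> 0" using uw[of 0 a b] ab(1) by (auto simp: y1_def)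
  qed
  obtain z0 where z0: "Y z0" "K y1 z0 \<noteq> 0" using nondeg y1 by blast
  \<comment> \<open>Correcting by the isotropic vector \<open>y1\<close> makes the second vector
    isotropic too. The lines of the singular conic join \<open>k\<close> to \<open>y1\<close> and to
    \<open>z1\<close>.\<close>
  define z1 where "z1 = z0 - (K z0 z0 / (2 * K y1 z0)) *s y1"
  have z1: "Y z1" "K z1 z1 = 0" "K y1 z1 \<noteq> 0"
    using y1 z0 Ksym[of z0 y1] by (simp_all add: Y_def z1_def Hlin Klin field_simps)
  have "z1 \<noteq> 0" using z1(3) by (auto simp: K_def B_def)
  \<comment> \<open>The scaling gives \<open>H x x = - H k k\<close>, so that \<open>H\<close>
    vanishes at \<open>x + k\<close> and \<open>x - k\<close>.\<close>
  define normal where "normal x = csqrt (- H k k / H x x) *s x" for x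
  have normal: "Y (normal x)" "K (normal x) (normal x) = 0" "H (normal x) (normal x) = - H k k"
    "\<exists>c. c \<noteq> 0 \<and> normal x = c *s x" if x: "Y x" "x \<noteq> 0" "K x x = 0" for x
  proof -
    let ?c = "csqrt (- H k k / H x x)"
    have c: "?c * ?c * H x x = - H k k"
      using Hyy[OF x] by (simp add: power2_eq_square[symmetric])
    show "Y (normal x)" "K (normal x) (normal x) = 0"
      using x by (simp_all add: normal_def Y_def Hlin Klin)
    show "H (normal x) (normal x) = - H k k"
      using c by (simp add: normal_def Hlin mult.assoc)
    have "?c \<noteq> 0" using c Hk by auto
    then show "\<exists>c. c \<noteq> 0 \<and> normal x = c *s x" unfolding normal_def by blast
  qed
  define y where "y = normal y1"
  define z where "z = normal z1"
  note ny = normal[OF y1(1,3,2), folded y_def]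
  note nz = normal[OF z1(1) \<open>z1 \<noteq> 0\<close> z1(2), folded z_def]
  have Kyz: "K y z \<noteq> 0" using ny(4) nz(4) z1(3) by (auto simp: Klin)
  have Hks: "H k y = 0" "H k z = 0" "H y k = 0" "H z k = 0" "K y k = 0" "K z k = 0"
    using ny(1) nz(1) Hsym[of y k] Hsym[of z k] Ksym[of y k] Ksym[of z k] Kk by (simp_all add: Y_def)
  have ind: "a = 0 \<and> b = 0 \<and> c = 0" if e: "a *s k + b *s y + c *s z = 0" for a b c
  proof -
    have "H k (a *s k + b *s y + c *s z) = 0" "K y (a *s k + b *s y + c *s z) = 0"
      "K z (a *s k + b *s y + c *s z) = 0"
      unfolding e by (simp_all add: H_def K_def B_def)
    then show ?thesis using Hk Hks ny nz Kyz Ksym[of z y] by (simp add: Hlin Klin)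
  qed
  \<comment> \<open>In these coordinates \<open>K\<close> is a product: its zeros have
    \<open>b = 0\<close> or \<open>c = 0\<close>, and on each of the two lines \<open>H\<close> is a
    difference of squares.\<close>
  have form: "K x x = 2 * b * c * K y z"
    "H x x = (a * a - b * b - c * c) * H k k + 2 * b * c * H y z"
    if "x = a *s k + b *s y + c *s z" for x a b c
    using Hks ny nz Kk Ksym[of z y] Hsym[of z y] unfolding that
    by (simp_all add: Hlin Klin algebra_simps)
  have "x \<cdot> (P *v x) = 0 \<and> x \<cdot> (Q *v x) = 0 \<longleftrightarrow>
       (\<exists>c. x = c *s (y + k) \<or> x = c *s (y - k) \<or> x = c *s (z + k) \<or> x = c *s (z - k))" for x
  proof -
    have "x \<cdot> (P *v x) = 0 \<and> x \<cdot> (Q *v x) = 0 \<longleftrightarrow> K x x = 0 \<and> H x x = 0"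
      using KH by (simp add: B_def)
    also have "\<dots> \<longleftrightarrow> (\<exists>c. x = c *s (y + k) \<or> x = c *s (y - k) \<or> x = c *s (z + k) \<or> x = c *s (z - k))"
    proof
      assume KHx: "K x x = 0 \<and> H x x = 0"
      obtain a b c where x: "x = a *s k + b *s y + c *s z" using indep3_span[OF ind] by blast
      have bc: "b = 0 \<or> c = 0" using KHx form(1)[OF x] Kyz by auto
      then have "(a * a - b * b - c * c) = 0" using KHx form(2)[OF x] Hk by auto
      then have "(a - b - c) * (a + b + c) = 0" using bc by (auto simp: algebra_simps)
      then have "a - b - c = 0 \<or> a + b + c = 0" by (simp only: mult_eq_0_iff)
      then have "a = b + c \<or> a = - (b + c)"
      proof
        assume "a - b - c = 0" then show ?thesis by (simp add: diff_eq_eq add.commute)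
      next
        assume "a + b + c = 0" then show ?thesis by (simp only: eq_neg_iff_add_eq_0 add.assoc simp_thms)
      qed
      then have "x = b *s (y + k) \<or> x = b *s (y - k) \<or> x = c *s (z + k) \<or> x = c *s (z - k)"
      proof -
        have "(a = b \<and> c = 0) \<or> (a = - b \<and> c = 0) \<or> (a = c \<and> b = 0) \<or> (a = - c \<and> b = 0)"
          using bc \<open>a = b + c \<or> a = - (b + c)\<close> by auto
        then show ?thesis
        proof (elim disjE)
          assume "a = b \<and> c = 0" then have "x = b *s (y + k)" by (simp add: x vec_eq_iff algebra_simps)
          then show ?thesis by blast
        next
          assume "a = - b \<and> c = 0" then have "x = b *s (y - k)" by (simp add: x vec_eq_iff algebra_simps)
          then show ?thesis by blast
        next
          assume "a = c \<and> b = 0" then have "x = c *s (z + k)" by (simp add: x vec_eq_iff algebra_simps)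
          then show ?thesis by blast
        next
          assume "a = - c \<and> b = 0" then have "x = c *s (z - k)" by (simp add: x vec_eq_iff algebra_simps)
          then show ?thesis by blast
        qed
      qed
      then show "\<exists>c. x = c *s (y + k) \<or> x = c *s (y - k) \<or> x = c *s (z + k) \<or> x = c *s (z - k)" by blast
    next
      assume "\<exists>c. x = c *s (y + k) \<or> x = c *s (y - k) \<or> x = c *s (z + k) \<or> x = c *s (z - k)"
      then show "K x x = 0 \<and> H x x = 0"
        using Hks ny(2,3) nz(2,3) Kk by (auto simp: Hlin Klin)
    qed
    finally show ?thesis .
  qed
  then show ?thesis using that[of k y z] ind by blast
qed

lemma pencil_points:
  assumes "transversal P Q"
  obtains p :: "4 \<Rightarrow> complex^3" where
    "\<And>x. x \<cdot> (P *v x) = 0 \<and> x \<cdot> (Q *v x) = 0 \<longleftrightarrow> (\<exists>i c. x = c *s p i)"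
    "\<And>i j l a b c. i \<noteq> j \<Longrightarrow> j \<noteq> l \<Longrightarrow> i \<noteq> l \<Longrightarrow> a *s p i + b *s p j + c *s p l = 0 \<Longrightarrow> a = 0 \<and> b = 0 \<and> c = 0"
proof -
  obtain k y z where ind: "\<And>a b c. a *s k + b *s y + c *s z = 0 \<Longrightarrow> a = 0 \<and> b = 0 \<and> c = 0"
    and base: "\<And>x. x \<cdot> (P *v x) = 0 \<and> x \<cdot> (Q *v x) = 0 \<longleftrightarrow>
       (\<exists>c. x = c *s (y + k) \<or> x = c *s (y - k) \<or> x = c *s (z + k) \<or> x = c *s (z - k))"
    using pencil_base_points[OF assms] by blast
  \<comment> \<open>The coordinates of the base points with respect to \<open>k\<close>,
    \<open>y\<close>, \<open>z\<close>. Indices 1 and 2 belong to one line of the singular conic,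
    the others to the second line.\<close>
  define \<alpha> \<beta> \<gamma> :: "4 \<Rightarrow> complex" where
    "\<alpha> i = (if i = 1 \<or> i = 3 then 1 else - 1)" and "\<beta> i = (if i = 1 \<or> i = 2 then 1 else 0)"
    and "\<gamma> i = (if i = 1 \<or> i = 2 then 0 else 1)" for i
  define p where "p i = \<alpha> i *s k + \<beta> i *s y + \<gamma> i *s z" for i
  have ex4: "(\<exists>i::4. X i) \<longleftrightarrow> X 1 \<or> X 2 \<or> X 3 \<or> X 4" for X
    by (metis exhaust_4)
  have pv: "p 1 = y + k" "p 2 = y - k" "p 3 = z + k" "p 4 = z - k"
    by (simp_all add: p_def \<alpha>_def \<beta>_def \<gamma>_def vec_eq_iff)
  have 1: "x \<cdot> (P *v x) = 0 \<and> x \<cdot> (Q *v x) = 0 \<longleftrightarrow> (\<exists>i c. x = c *s p i)" for x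
    unfolding base ex4 pv by blast
  have 2: "a = 0 \<and> b = 0 \<and> c = 0"
    if ne: "i \<noteq> j" "j \<noteq> l" "i \<noteq> l" and rel: "a *s p i + b *s p j + c *s p l = 0" for i j l a b c
  proof -
    have "(a * \<alpha> i + b * \<alpha> j + c * \<alpha> l) *s k + (a * \<beta> i + b * \<beta> j + c * \<beta> l) *s y
        + (a * \<gamma> i + b * \<gamma> j + c * \<gamma> l) *s z = a *s p i + b *s p j + c *s p l"
      by (simp add: p_def vec_eq_iff algebra_simps)
    then have "a * \<alpha> i + b * \<alpha> j + c * \<alpha> l = 0 \<and> a * \<beta> i + b * \<beta> j + c * \<beta> l = 0
        \<and> a * \<gamma> i + b * \<gamma> j + c * \<gamma> l = 0"
      using ind rel by metis
    moreover have "\<forall>i j l::4. i \<noteq> j \<longrightarrow> j \<noteq> l \<longrightarrow> i \<noteq> l \<longrightarrow>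
        a * \<alpha> i + b * \<alpha> j + c * \<alpha> l = 0 \<and> a * \<beta> i + b * \<beta> j + c * \<beta> l = 0
        \<and> a * \<gamma> i + b * \<gamma> j + c * \<gamma> l = 0 \<longrightarrow> a = 0 \<and> b = 0 \<and> c = 0"
      unfolding forall_4 by (auto simp: \<alpha>_def \<beta>_def \<gamma>_def add_eq_0_iff2)
    ultimately show ?thesis using ne by blast
  qed
  show ?thesis by (rule that[OF 1 2])
qed

section \<open>Projection from a three-dimensional subalgebra\<close>

definition join :: "complex^3 \<Rightarrow> complex \<Rightarrow> complex^4" where
  "join n c = vector [n $ 1, n $ 2, n $ 3, c]"

definition head :: "complex^4 \<Rightarrow> complex^3" where
  "head f = vector [f $ 1, f $ 2, f $ 3]"

lemma join_nth [simp]: "join n c $ 1 = n $ 1" "join n c $ 2 = n $ 2" "join n c $ 3 = n $ 3" "join n c $ 4 = c"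
  by (simp_all add: join_def)

lemma head_nth [simp]: "head f $ 1 = f $ 1" "head f $ 2 = f $ 2" "head f $ 3 = f $ 3"
  by (simp_all add: head_def)

lemma join_head: "join (head f) (f $ 4) = f"
  by (simp add: vec_eq_iff forall_4)

lemma head_join [simp]: "head (join n c) = n"
  by (simp add: vec_eq_iff forall_3)

text \<open>The two halves of the Pluecker vector of the plane spanned by \<open>u\<close> and \<open>v\<close>.\<close>
definition moment :: "complex^4 \<Rightarrow> complex^4 \<Rightarrow> complex^3" where
  "moment u v = ccross (head u) (head v)"

definition direction :: "complex^4 \<Rightarrow> complex^4 \<Rightarrow> complex^3" where
  "direction u v = (v $ 4) *s head u - (u $ 4) *s head v"

text \<open>The alternating algebras for which \<open>x\<^sub>4 = 0\<close> is a subalgebra.\<close>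
definition block_algebra :: "complex^3^3 \<Rightarrow> complex^3^3 \<Rightarrow> complex^3 \<Rightarrow> alg" where
  "block_algebra N R \<rho> u v = join (N *v moment u v + R *v direction u v) (\<rho> \<cdot> direction u v)"

text \<open>The matrix of the map \<open>ccross \<rho>\<close>. Adding it to \<open>N\<close>
  absorbs the last coordinate of the products.\<close>

definition skew :: "complex^3 \<Rightarrow> complex^3^3" where
  "skew \<rho> = vector [vector [0, - \<rho> $ 3, \<rho> $ 2], vector [\<rho> $ 3, 0, - \<rho> $ 1], vector [- \<rho> $ 2, \<rho> $ 1, 0]]"

lemma vector_matrix_3: "n v* M = vector [n $ 1 * M $ 1 $ 1 + n $ 2 * M $ 2 $ 1 + n $ 3 * M $ 3 $ 1,
    n $ 1 * M $ 1 $ 2 + n $ 2 * M $ 2 $ 2 + n $ 3 * M $ 3 $ 2,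
    n $ 1 * M $ 1 $ 3 + n $ 2 * M $ 2 $ 3 + n $ 3 * (M $ 3 $ 3 :: complex)]" for M :: "complex^3^3"
  by (simp add: vec_eq_iff forall_3 vector_matrix_mult_def sum_3 mult.commute)

text \<open>A product depends only on the Pluecker vector of its factors. Products inside the
  hyperplane, the moment part, have no fourth coordinate and give \<open>N\<close>; products with
  the fourth unit vector, the direction part, give \<open>R\<close> and
  \<open>\<rho>\<close>.\<close>

lemma block_algebra_exists:
  assumes m: "alternating m" and sub: "sub_covector m (axis 4 1)"
  obtains N R \<rho> where "m = block_algebra N R \<rho>"
proof -
  define e :: "4 \<Rightarrow> complex^4" where "e i = axis i 1" for i
  define N :: "complex^3^3" where "N = (\<chi> i j. head (if j = 1 then m (e 2) (e 3) else if j = 2 then m (e 3) (e 1) else m (e 1) (e 2)) $ i)"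
  define R :: "complex^3^3" where "R = (\<chi> i j. head (if j = 1 then m (e 1) (e 4) else if j = 2 then m (e 2) (e 4) else m (e 3) (e 4)) $ i)"
  define \<rho> :: "complex^3" where "\<rho> = vector [m (e 1) (e 4) $ 4, m (e 2) (e 4) $ 4, m (e 3) (e 4) $ 4]"
  have z: "m (e i) (e j) $ 4 = 0" if "i \<noteq> 4" "j \<noteq> 4" for i j
    using sub[unfolded sub_covector_def, rule_format, of "e i" "e j" "e 4"] that
    by (simp add: wedge_def e_def) (simp add: axis_def)
  have exp: "u = u $ 1 *s e 1 + u $ 2 *s e 2 + u $ 3 *s e 3 + u $ 4 *s e 4" for u
    unfolding e_def by (rule axis_expansion_4)
  have sw: "m (e 2) (e 1) = - m (e 1) (e 2)" "m (e 3) (e 1) = - m (e 1) (e 3)" "m (e 3) (e 2) = - m (e 2) (e 3)"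
    "m (e 4) (e 1) = - m (e 1) (e 4)" "m (e 4) (e 2) = - m (e 2) (e 4)" "m (e 4) (e 3) = - m (e 3) (e 4)"
    by (rule alternating_swap[OF m])+
  have "m u v = block_algebra N R \<rho> u v" for u v
  proof -
    have "m u v = m (u $ 1 *s e 1 + u $ 2 *s e 2 + u $ 3 *s e 3 + u $ 4 *s e 4)
        (v $ 1 *s e 1 + v $ 2 *s e 2 + v $ 3 *s e 3 + v $ 4 *s e 4)"
      using exp[of u] exp[of v] by simp
    also have "\<dots> = (u $ 2 * v $ 3 - u $ 3 * v $ 2) *s m (e 2) (e 3) - (u $ 3 * v $ 1 - u $ 1 * v $ 3) *s m (e 1) (e 3)
        + (u $ 1 * v $ 2 - u $ 2 * v $ 1) *s m (e 1) (e 2) + (u $ 1 * v $ 4 - u $ 4 * v $ 1) *s m (e 1) (e 4)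
        + (u $ 2 * v $ 4 - u $ 4 * v $ 2) *s m (e 2) (e 4) + (u $ 3 * v $ 4 - u $ 4 * v $ 3) *s m (e 3) (e 4)"
      unfolding alternating_bilinear[OF m] sw by (simp add: vec_eq_iff algebra_simps)
    also have "\<dots> = block_algebra N R \<rho> u v"
      using z[of 1 2] z[of 1 3] z[of 2 3]
      by (simp add: vec_eq_iff forall_4 block_algebra_def moment_def direction_def N_def R_def \<rho>_def sw
          matrix_vector_mult_def sum_3 cdot_3 algebra_simps vector_3)
    finally show ?thesis .
  qed
  then show ?thesis using that[of N R \<rho>] by blast
qed

text \<open>The gain of these coordinates: \<open>N\<close> and \<open>\<rho>\<close> enter only
  through \<open>T\<close>, and up to sign three of the four components are those of a single
  vector.\<close>

lemma wedge_block_algebra: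
  fixes N R \<rho>
  defines "T \<equiv> N + skew \<rho>"
  assumes f: "f = join n c" and h: "h = join n' c'"
  shows "wedge (block_algebra N R \<rho>) f h (axis 1 1) (axis 2 1) (axis 3 1) + wedge (block_algebra N R \<rho>) h f (axis 1 1) (axis 2 1) (axis 3 1)
      = n \<cdot> (T *v n') + n' \<cdot> (T *v n)"
    and "wedge (block_algebra N R \<rho>) f h (axis 2 1) (axis 3 1) (axis 4 1) + wedge (block_algebra N R \<rho>) h f (axis 2 1) (axis 3 1) (axis 4 1)
      = (c *s (n' v* T) + c' *s (n v* T) + ccross n (n' v* R) + ccross n' (n v* R)) $ 1"
    and "wedge (block_algebra N R \<rho>) f h (axis 1 1) (axis 3 1) (axis 4 1) + wedge (block_algebra N R \<rho>) h f (axis 1 1) (axis 3 1) (axis 4 1)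
      = - (c *s (n' v* T) + c' *s (n v* T) + ccross n (n' v* R) + ccross n' (n v* R)) $ 2"
    and "wedge (block_algebra N R \<rho>) f h (axis 1 1) (axis 2 1) (axis 4 1) + wedge (block_algebra N R \<rho>) h f (axis 1 1) (axis 2 1) (axis 4 1)
      = (c *s (n' v* T) + c' *s (n v* T) + ccross n (n' v* R) + ccross n' (n v* R)) $ 3"
  unfolding wedge_def block_algebra_def f h T_def skew_def vector_matrix_3 moment_def direction_def
  by (simp_all add: cdot_4 cdot_3 matrix_vector_mult_def sum_3 axis_def vector_3 algebra_simps)

lemma polar_block_algebra:
  fixes N R \<rho>
  defines "T \<equiv> N + skew \<rho>"
  assumes alt: "alternating (block_algebra N R \<rho>)"
  shows "(\<forall>u v w. wedge (block_algebra N R \<rho>) (join n c) (join n' c') u v w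
      + wedge (block_algebra N R \<rho>) (join n' c') (join n c) u v w = 0) \<longleftrightarrow>
    n \<cdot> (T *v n') + n' \<cdot> (T *v n) = 0 \<and>
    c *s (n' v* T) + c' *s (n v* T) + ccross n (n' v* R) + ccross n' (n v* R) = 0" (is "?l \<longleftrightarrow> ?r")
proof -
  note W = wedge_block_algebra[OF refl refl, of N R \<rho> n c n' c', folded T_def]
  show ?thesis
  proof
    assume l: ?l
    have "(c *s (n' v* T) + c' *s (n v* T) + ccross n (n' v* R) + ccross n' (n v* R)) $ k = 0" for k
      using W(2-4)[unfolded l[rule_format]] exhaust_3[of k]
      by (metis neg_equal_0_iff_equal)
    then show ?r using W(1)[unfolded l[rule_format]] by (simp add: vec_eq_iff)
  next
    assume r: ?r
    show ?l
      by (intro allI, rule polar_wedge_zero[OF alt]) (use W r in auto)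
  qed
qed

lemma sub_covector_block_algebra:
  fixes N R \<rho>
  defines "T \<equiv> N + skew \<rho>"
  assumes alt: "alternating (block_algebra N R \<rho>)"
  shows "sub_covector (block_algebra N R \<rho>) (join n c) \<longleftrightarrow>
    n \<cdot> (T *v n) = 0 \<and> c *s (n v* T) + ccross n (n v* R) = 0"
proof -
  have "sub_covector (block_algebra N R \<rho>) (join n c) \<longleftrightarrow>
    (\<forall>u v w. wedge (block_algebra N R \<rho>) (join n c) (join n c) u v w
      + wedge (block_algebra N R \<rho>) (join n c) (join n c) u v w = 0)"
    by (simp add: sub_covector_def)
  also have "\<dots> \<longleftrightarrow> n \<cdot> (T *v n) = 0 \<and> c *s (n v* T) + ccross n (n v* R) = 0"
  proof -
    have e2: "c *s (n v* T) + c *s (n v* T) + ccross n (n v* R) + ccross n (n v* R)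
        = 2 *s (c *s (n v* T) + ccross n (n v* R))" by (simp add: vec_eq_iff algebra_simps)
    have d: "a + a = 0 \<longleftrightarrow> a = 0" for a :: complex by simp
    show ?thesis
      unfolding polar_block_algebra[OF alt, folded T_def]
      unfolding e2 d vec.scale_eq_0_iff by simp
  qed
  finally show ?thesis .
qed

text \<open>At the covector \<open>join 0 1\<close> the derivative in the direction
  \<open>join y 0\<close> is \<open>y v* T\<close>. A vector \<open>y\<close> in the kernel would be
  a tangent direction excluded by nondegeneracy.\<close>

lemma invertible_block:
  assumes alt: "alternating (block_algebra N R \<rho>)" and nd: "nondegenerate (block_algebra N R \<rho>)"
  shows "invertible (N + skew \<rho>)"
proof -
  let ?T = "N + skew \<rho>"
  have "y = 0" if y: "transpose ?T *v y = 0" for y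
  proof -
    have y': "y v* ?T = 0" using y by simp
    have "join 0 1 \<noteq> 0" by (simp add: vec_eq_iff forall_4)
    moreover have "sub_covector (block_algebra N R \<rho>) (join 0 1)"
      unfolding sub_covector_block_algebra[OF alt] by (simp add: vec_eq_iff forall_3 vector_matrix_3 vector_3)
    moreover have "\<forall>u v w. wedge (block_algebra N R \<rho>) (join 0 1) (join y 0) u v w
      + wedge (block_algebra N R \<rho>) (join y 0) (join 0 1) u v w = 0"
      unfolding polar_block_algebra[OF alt] using y' by (simp add: vec_eq_iff forall_3 vector_matrix_3 vector_3)
    ultimately obtain c where "join y 0 = c *s join 0 1"
      using nd unfolding nondegenerate_def by blast
    then show "y = 0" by (auto simp: vec_eq_iff forall_4 forall_3)
  qed
  then have "invertible (transpose ?T)"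
    unfolding invertible_left_inverse matrix_left_invertible_ker by blast
  then show ?thesis by (simp add: invertible_det_nz)
qed

section \<open>Reduction to two conics\<close>

lemma ccross_triple: "ccross g (ccross x y) = (g \<cdot> y) *s x - (g \<cdot> x) *s y"
  by (simp add: vec_eq_iff forall_3 cdot_3 algebra_simps)

lemma ccross_linear:
  "ccross g (x + y) = ccross g x + ccross g y" "ccross g (c *s x) = c *s ccross g x"
  "ccross (x + y) g = ccross x g + ccross y g" "ccross (c *s x) g = c *s ccross x g"
  "ccross g (- x) = - ccross g x" "ccross x x = 0" "ccross 0 x = 0" "ccross x 0 = 0"
  by (simp_all add: vec_eq_iff forall_3 algebra_simps)

lemma ccross_swap: "ccross x y = - ccross y x"
  by (simp add: vec_eq_iff forall_3)

definition sym_part :: "complex^3^3 \<Rightarrow> complex^3^3" where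
  "sym_part M = M + transpose M"

lemma sym_part:
  "transpose (sym_part M) = sym_part M" "x \<cdot> (sym_part M *v y) = x \<cdot> (M *v y) + y \<cdot> (M *v x)"
proof -
  show "transpose (sym_part M) = sym_part M"
    by (simp add: sym_part_def transpose_def vec_eq_iff)
  have "x \<cdot> (transpose M *v y) = y \<cdot> (M *v x)"
    using cdot_matrix_vector[of y M x] cdot_commute by metis
  then show "x \<cdot> (sym_part M *v y) = x \<cdot> (M *v y) + y \<cdot> (M *v x)"
    by (simp only: sym_part_def matrix_vector_mult_add_rdistrib cdot_add)
qed

text \<open>Put \<open>g = n v* T\<close>. The vector equation says that
  \<open>ccross n (n v* R)\<close> is a multiple of \<open>g\<close>, and by the triple product
  formula this holds once \<open>g\<close> is orthogonal to \<open>n\<close> and to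
  \<open>n v* R\<close>. With \<open>n = g v* L\<close> these are the two conics in
  \<open>g\<close>, and \<open>c\<close> is the factor of proportionality. The same computation with
  first derivatives turns nondegeneracy into transversality.\<close>

lemma transversal_block:
  fixes N R \<rho>
  defines "L \<equiv> matrix_inv (N + skew \<rho>)"
  assumes alt: "alternating (block_algebra N R \<rho>)" and nd: "nondegenerate (block_algebra N R \<rho>)"
  shows "transversal (sym_part L) (sym_part (L ** R))"
    and "sub_covector (block_algebra N R \<rho>) (join n c) \<Longrightarrow> n \<noteq> 0 \<Longrightarrow>
      \<exists>g. n = g v* L \<and> g \<noteq> 0 \<and> g \<cdot> (sym_part L *v g) = 0 \<and> g \<cdot> (sym_part (L ** R) *v g) = 0"
    and "g \<noteq> 0 \<Longrightarrow> g \<cdot> (sym_part L *v g) = 0 \<Longrightarrow> g \<cdot> (sym_part (L ** R) *v g) = 0 \<Longrightarrow>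
      \<exists>c. sub_covector (block_algebra N R \<rho>) (join (g v* L) c)"
    and "sub_covector (block_algebra N R \<rho>) (join n c) \<Longrightarrow> sub_covector (block_algebra N R \<rho>) (join n c') \<Longrightarrow>
      n \<noteq> 0 \<Longrightarrow> c = c'"
proof -
  define T where "T = N + skew \<rho>"
  have T: "invertible T" unfolding T_def by (rule invertible_block[OF alt nd])
  have TL: "T ** L = mat 1" "L ** T = mat 1" using matrix_inv_mult[OF T] by (simp_all add: L_def T_def)
  have gL: "(g v* L) v* T = g" "(g v* T) v* L = g" for g
    by (simp_all add: vector_matrix_mul_assoc TL)
  have LR: "g \<cdot> ((L ** R) *v y) = (g v* L) \<cdot> (R *v y)" for g y
    by (simp add: matrix_vector_mul_assoc[symmetric] cdot_vector_matrix)
  have L: "g \<cdot> (L *v y) = (g v* L) \<cdot> y" for g y by (rule cdot_vector_matrix)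
  have nT: "n \<cdot> (T *v y) = (n v* T) \<cdot> y" for n y by (rule cdot_vector_matrix)
  have Rn: "n \<cdot> (R *v y) = y \<cdot> (n v* R)" for n y using cdot_vector_matrix cdot_commute by metis
  note sc = sub_covector_block_algebra[OF alt, folded T_def]
  note pol = polar_block_algebra[OF alt, folded T_def]
  have base: "\<exists>c. c *s g + ccross (g v* L) ((g v* L) v* R) = 0"
    if g: "g \<noteq> 0" "g \<cdot> (L *v g) = 0" "g \<cdot> ((L ** R) *v g) = 0" for g
  proof -
    let ?n = "g v* L" let ?w = "ccross ?n (?n v* R)"
    have "g \<cdot> ?n = 0" using g(2) by (simp add: L cdot_commute)
    moreover have "g \<cdot> (?n v* R) = 0" using g(3) by (simp add: LR Rn)
    ultimately have "ccross g ?w = 0" by (simp add: ccross_triple)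
    then obtain k where "?w = k *s g" using ccross_eq_0[OF g(1)] by blast
    then have "(- k) *s g + ?w = 0" by (simp add: vec_eq_iff)
    then show ?thesis by blast
  qed
  show ex: "\<exists>c. sub_covector (block_algebra N R \<rho>) (join (g v* L) c)"
    if "g \<noteq> 0" "g \<cdot> (sym_part L *v g) = 0" "g \<cdot> (sym_part (L ** R) *v g) = 0" for g
  proof -
    have "g \<cdot> (L *v g) = 0" "g \<cdot> ((L ** R) *v g) = 0" using that(2,3) by (simp_all add: sym_part(2))
    moreover have "(g v* L) \<cdot> (T *v (g v* L)) = g \<cdot> (L *v g)" by (simp add: nT gL L cdot_commute)
    ultimately show ?thesis using base[OF that(1)] by (simp add: sc gL)
  qed
  show "\<exists>g. n = g v* L \<and> g \<noteq> 0 \<and> g \<cdot> (sym_part L *v g) = 0 \<and> g \<cdot> (sym_part (L ** R) *v g) = 0"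
    if s: "sub_covector (block_algebra N R \<rho>) (join n c)" and n: "n \<noteq> 0" for n c
  proof (intro exI conjI)
    let ?g = "n v* T"
    show "n = ?g v* L" by (simp add: gL)
    show "?g \<noteq> 0" using n gL(2)[of n] by (metis transpose_matrix_vector matrix_vector_mult_0_right)
    have "n \<cdot> (T *v n) = 0" and e: "c *s ?g + ccross n (n v* R) = 0" using s by (simp_all add: sc)
    then show "?g \<cdot> (sym_part L *v ?g) = 0" by (simp add: sym_part(2) L gL nT cdot_commute)
    have "?g \<cdot> (n v* R) = 0"
    \<comment> \<open>For \<open>c = 0\<close> the cross product vanishes, so \<open>n v* R\<close>
      is a multiple of \<open>n\<close> and the first equation gives the orthogonality. Otherwise
      \<open>g\<close> is a multiple of the cross product.\<close>
    proof (cases "c = 0")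
      case True
      then obtain k where "n v* R = k *s n" using e ccross_eq_0[OF n] by auto
      then show ?thesis using \<open>n \<cdot> (T *v n) = 0\<close> by (simp add: nT)
    next
      case False
      have "(n v* R) \<cdot> (c *s ?g + ccross n (n v* R)) = 0" by (simp add: e)
      then have "c * ((n v* R) \<cdot> ?g) = 0" by (simp add: cdot_3 algebra_simps)
      then show ?thesis using False by (simp add: cdot_commute)
    qed
    then show "?g \<cdot> (sym_part (L ** R) *v ?g) = 0" by (simp add: sym_part(2) LR gL Rn)
  qed
  show "c = c'" if "sub_covector (block_algebra N R \<rho>) (join n c)" "sub_covector (block_algebra N R \<rho>) (join n c')" "n \<noteq> 0"
    for n c c'
  proof -
    have "c *s (n v* T) = c' *s (n v* T)" using that(1,2) by (metis sc add_right_cancel)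
    moreover have "n v* T \<noteq> 0" using that(3) gL(2)[of n] by (metis transpose_matrix_vector matrix_vector_mult_0_right)
    ultimately show ?thesis by (auto simp: vec_eq_iff)
  qed
  show "transversal (sym_part L) (sym_part (L ** R))"
    unfolding transversal_def
  proof (intro conjI allI impI)
    fix g y
    assume g: "g \<noteq> 0" "g \<cdot> (sym_part L *v g) = 0" "g \<cdot> (sym_part (L ** R) *v g) = 0"
      and y: "g \<cdot> (sym_part L *v y) = 0" "g \<cdot> (sym_part (L ** R) *v y) = 0"
    let ?n = "g v* L" and ?n' = "y v* L"
    obtain c where c: "sub_covector (block_algebra N R \<rho>) (join ?n c)" using ex[OF g] by blast
    then have cg: "c *s g = - ccross ?n (?n v* R)"
      by (simp add: sc gL eq_neg_iff_add_eq_0)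
    have z: "g \<cdot> ?n = 0" "g \<cdot> (?n v* R) = 0"
      using g(2,3) by (simp add: sym_part(2) L cdot_commute) (use g(3) in \<open>simp add: sym_part(2) LR Rn\<close>)
    have y1: "g \<cdot> ?n' + y \<cdot> ?n = 0" and y2: "g \<cdot> (?n' v* R) + y \<cdot> (?n v* R) = 0"
      using y(1) by (simp add: sym_part(2) L cdot_commute add.commute)
        (use y(2) in \<open>simp add: sym_part(2) LR Rn add.commute\<close>)
    \<comment> \<open>The vector component of the polar form, up to the term from the last
      coordinate of the direction, which is a multiple of \<open>g\<close>. Tangency to both conics
      makes \<open>?w\<close> parallel to \<open>g\<close>, so this coordinate can be chosen as
      \<open>- k\<close> to cancel it.\<close>
    let ?w = "c *s y + ccross ?n (?n' v* R) + ccross ?n' (?n v* R)"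
    have "ccross g (c *s y) = ccross (c *s g) y" by (simp add: ccross_linear)
    also have "\<dots> = ccross y (ccross ?n (?n v* R))"
      unfolding cg by (simp add: ccross_swap[of _ y] ccross_linear)
    finally have "ccross g ?w = (g \<cdot> (?n' v* R) + y \<cdot> (?n v* R)) *s ?n - (g \<cdot> ?n' + y \<cdot> ?n) *s (?n v* R)"
      using z by (simp add: ccross_linear ccross_triple vec_eq_iff algebra_simps)
    then have "ccross g ?w = 0" by (simp add: y1 y2)
    then obtain k where k: "?w = k *s g" using ccross_eq_0[OF g(1)] by blast
    have "?n \<cdot> (T *v ?n') + ?n' \<cdot> (T *v ?n) = 0"
      using y1 by (simp add: nT gL cdot_commute)
    moreover have "c *s (?n' v* T) + (- k) *s (?n v* T) + ccross ?n (?n' v* R) + ccross ?n' (?n v* R) = 0"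
      using k by (simp add: gL vec_eq_iff algebra_simps)
    ultimately have "\<forall>u v w. wedge (block_algebra N R \<rho>) (join ?n c) (join ?n' (- k)) u v w
      + wedge (block_algebra N R \<rho>) (join ?n' (- k)) (join ?n c) u v w = 0"
      unfolding pol by blast
    moreover have "?n \<noteq> 0" using g(1) gL(1)[of g] by (metis transpose_matrix_vector matrix_vector_mult_0_right)
    then have "join ?n c \<noteq> 0" by (auto simp: vec_eq_iff forall_4 forall_3)
    ultimately obtain d where "join ?n' (- k) = d *s join ?n c"
      using nd c unfolding nondegenerate_def by blast
    then have "?n' = d *s ?n" by (simp add: vec_eq_iff forall_4 forall_3)
    then have "y = d *s g" using gL(1)[of y] gL(1)[of g] by (metis vector_matrix_linear(2))
    then show "\<exists>d. y = d *s g" by blast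
  qed (rule sym_part(1))+
qed

section \<open>The remaining four invariant hyperplanes\<close>

lemma third_index: "\<exists>l::4. l \<noteq> i \<and> l \<noteq> j"
proof (rule ccontr)
  assume "\<not> ?thesis"
  then have "(UNIV :: 4 set) \<subseteq> {i, j}" by blast
  then have "CARD(4) \<le> card {i, j}" by (intro card_mono) simp_all
  also have "\<dots> \<le> 2" by (simp add: card_insert_if)
  finally show False by simp
qed

text \<open>Taking \<open>head\<close> is the projection from the covector \<open>axis 4 1\<close>.
  It carries every other zero to a base point of the pencil (multiplied by \<open>L\<close>), over
  which the last coordinate is unique. Noncollinearity of three base points becomes independence of
  three zeros together with \<open>axis 4 1\<close>.\<close>

lemma star_axis:
  assumes alt: "alternating m" and nd: "nondegenerate m" and sub: "sub_covector m (axis 4 1)"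
  obtains G :: "4 \<Rightarrow> complex^4" where
    "\<And>i. sub_covector m (G i)"
    "\<And>h. sub_covector m h \<Longrightarrow> (\<exists>c. h = c *s axis 4 1) \<or> (\<exists>i c. h = c *s G i)"
    "\<And>i j l w x y z. i \<noteq> j \<Longrightarrow> j \<noteq> l \<Longrightarrow> i \<noteq> l \<Longrightarrow>
       w *s axis 4 1 + x *s G i + y *s G j + z *s G l = 0 \<Longrightarrow> w = 0 \<and> x = 0 \<and> y = 0 \<and> z = 0"
proof -
  obtain N R \<rho> where m: "m = block_algebra N R \<rho>" using block_algebra_exists[OF alt sub] by blast
  note alt' = alt[unfolded m] and nd' = nd[unfolded m]
  define L where "L = matrix_inv (N + skew \<rho>)"
  note tb = transversal_block[OF alt' nd', folded L_def m]
  obtain p :: "4 \<Rightarrow> complex^3" where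
    base: "\<And>x. x \<cdot> (sym_part L *v x) = 0 \<and> x \<cdot> (sym_part (L ** R) *v x) = 0 \<longleftrightarrow> (\<exists>i c. x = c *s p i)"
    and ind: "\<And>i j l a b c. i \<noteq> j \<Longrightarrow> j \<noteq> l \<Longrightarrow> i \<noteq> l \<Longrightarrow> a *s p i + b *s p j + c *s p l = 0 \<Longrightarrow> a = 0 \<and> b = 0 \<and> c = 0"
    using pencil_points[OF tb(1)] by blast
  have "invertible L"
    unfolding L_def by (intro invertible_matrix_inv invertible_block[OF alt' nd'])
  then have Linj: "x v* L = y v* L \<Longrightarrow> x = y" for x y by (rule vector_matrix_inj)
  have p0: "p i \<noteq> 0" for i
  proof
    assume "p i = 0"
    obtain j where "j \<noteq> i" using third_index[of i i] by blast
    moreover obtain l where "l \<noteq> i" "l \<noteq> j" using third_index[of i j] by blast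
    ultimately have "i \<noteq> j" "j \<noteq> l" "i \<noteq> l" by auto
    then show False using ind[of i j l 1 0 0] \<open>p i = 0\<close> by simp
  qed
  have "\<forall>i. \<exists>c. sub_covector m (join (p i v* L) c)"
  proof
    fix i
    have "p i \<cdot> (sym_part L *v p i) = 0 \<and> p i \<cdot> (sym_part (L ** R) *v p i) = 0"
      unfolding base by (intro exI[of _ i] exI[of _ 1]) simp
    then show "\<exists>c. sub_covector m (join (p i v* L) c)" using tb(3)[OF p0] by simp
  qed
  then obtain c where c: "\<And>i. sub_covector m (join (p i v* L) (c i))" by metis
  define G where "G i = join (p i v* L) (c i)" for i
  have join_lin: "head (x + y) = head x + head y" "head (k *s x) = k *s head x" for x y k
    by (simp_all add: vec_eq_iff forall_3)
  show ?thesis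
  proof (rule that[of G])
    show "sub_covector m (G i)" for i using c by (simp add: G_def)
    show "(\<exists>c. h = c *s axis 4 1) \<or> (\<exists>i c. h = c *s G i)" if h: "sub_covector m h" for h
    proof (cases "head h = 0")
      case True
      then have "h = (h $ 4) *s axis 4 1" by (simp add: vec_eq_iff forall_4 forall_3 axis_def)
      then show ?thesis by blast
    next
      case False
      have h': "sub_covector m (join (head h) (h $ 4))" using h by (simp add: join_head)
      then obtain g where g: "head h = g v* L" "g \<noteq> 0" "g \<cdot> (sym_part L *v g) = 0"
          "g \<cdot> (sym_part (L ** R) *v g) = 0"
        using tb(2)[OF h' False] by (elim exE conjE)
      then obtain i k where k: "g = k *s p i" using base by blast
      have "head h = k *s (p i v* L)" using g(1) k by (simp add: vector_matrix_linear)
      moreover have "k *s G i = join (k *s (p i v* L)) (k * c i)" by (simp add: G_def vec_eq_iff forall_4)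
      ultimately have "k *s G i = join (head h) (k * c i)" by simp
      moreover have "sub_covector m (k *s G i)"
        using c[of i] by (simp add: G_def sub_covector_def wedge_covector_linear)
      ultimately have "h $ 4 = k * c i" using tb(4)[OF h' _ False, of "k * c i"] by simp
      then have "h = k *s G i" using \<open>k *s G i = join (head h) (k * c i)\<close> join_head[of h] by simp
      then show ?thesis by blast
    qed
    show "w = 0 \<and> x = 0 \<and> y = 0 \<and> z = 0" if ne: "i \<noteq> j" "j \<noteq> l" "i \<noteq> l"
      and rel: "w *s axis 4 1 + x *s G i + y *s G j + z *s G l = 0" for i j l w x y z
    proof -
      have "head (axis 4 1) = 0" by (simp add: vec_eq_iff forall_3 axis_def)
      then have "head (w *s axis 4 1 + x *s G i + y *s G j + z *s G l)
          = (x *s p i + y *s p j + z *s p l) v* L"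
        unfolding join_lin by (simp add: G_def vector_matrix_linear)
      moreover have "head 0 = 0" by (simp add: vec_eq_iff forall_3)
      ultimately have "(x *s p i + y *s p j + z *s p l) v* L = 0 v* L" using rel by simp
      then have "x = 0 \<and> y = 0 \<and> z = 0" using Linj ind[OF ne] by blast
      then show ?thesis using rel by (simp add: vec_eq_iff forall_4 axis_def)
    qed
  qed
qed

lemma star:
  assumes alt: "alternating m" and nd: "nondegenerate m" and f: "f \<noteq> 0" "sub_covector m f"
  obtains G :: "4 \<Rightarrow> complex^4" where
    "\<And>i. sub_covector m (G i)"
    "\<And>h. sub_covector m h \<Longrightarrow> (\<exists>c. h = c *s f) \<or> (\<exists>i c. h = c *s G i)"
    "\<And>i j l w x y z. i \<noteq> j \<Longrightarrow> j \<noteq> l \<Longrightarrow> i \<noteq> l \<Longrightarrow>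
       w *s f + x *s G i + y *s G j + z *s G l = 0 \<Longrightarrow> w = 0 \<and> x = 0 \<and> y = 0 \<and> z = 0"
proof -
  obtain g :: "complex^4^4" where g: "invertible g" and axis_g: "axis 4 1 v* g = f"
    using complete_row[OF f(1)] by blast
  let ?m = "gl_act g m"
  have "sub_covector ?m (axis 4 1)" using f(2) by (simp add: sub_covector_gl_act[OF g] axis_g)
  from star_axis[OF alternating_gl_act[OF alt] nondegenerate_gl_act[OF g nd] this]
  obtain G :: "4 \<Rightarrow> complex^4" where G: "\<And>i. sub_covector ?m (G i)"
    "\<And>h. sub_covector ?m h \<Longrightarrow> (\<exists>c. h = c *s axis 4 1) \<or> (\<exists>i c. h = c *s G i)"
    "\<And>i j l w x y z. i \<noteq> j \<Longrightarrow> j \<noteq> l \<Longrightarrow> i \<noteq> l \<Longrightarrow>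
       w *s axis 4 1 + x *s G i + y *s G j + z *s G l = 0 \<Longrightarrow> w = 0 \<and> x = 0 \<and> y = 0 \<and> z = 0"
    by blast
  show ?thesis
  proof (rule that[of "\<lambda>i. G i v* g"])
    show "sub_covector m (G i v* g)" for i using G(1) sub_covector_gl_act[OF g] by blast
    show "(\<exists>c. h = c *s f) \<or> (\<exists>i c. h = c *s (G i v* g))" if h: "sub_covector m h" for h
    proof -
      have e: "(h v* matrix_inv g) v* g = h"
        by (simp add: vector_matrix_mul_assoc matrix_inv_mult[OF g])
      then have "sub_covector ?m (h v* matrix_inv g)" using h by (simp add: sub_covector_gl_act[OF g])
      from G(2)[OF this] show ?thesis
      proof
        assume "\<exists>c. h v* matrix_inv g = c *s axis 4 1"
        then obtain c where "h v* matrix_inv g = c *s axis 4 1" by blast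
        then have "h = c *s f" using e by (simp add: vector_matrix_linear axis_g)
        then show ?thesis by blast
      next
        assume "\<exists>i c. h v* matrix_inv g = c *s G i"
        then obtain i c where "h v* matrix_inv g = c *s G i" by blast
        then have "h = c *s (G i v* g)" using e by (simp add: vector_matrix_linear)
        then show ?thesis by blast
      qed
    qed
    show "w = 0 \<and> x = 0 \<and> y = 0 \<and> z = 0" if ne: "i \<noteq> j" "j \<noteq> l" "i \<noteq> l"
      and rel: "w *s f + x *s (G i v* g) + y *s (G j v* g) + z *s (G l v* g) = 0" for i j l w x y z
    proof -
      have "(w *s axis 4 1 + x *s G i + y *s G j + z *s G l) v* g = 0 v* g"
        using rel by (simp add: vector_matrix_linear axis_g)
      then show ?thesis using vector_matrix_inj[OF g] G(3)[OF ne] by blast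
    qed
  qed
qed

text \<open>Seen from \<open>f 1\<close>, the other three are nonzero multiples of distinct members
  of its star.\<close>

lemma sub_covectors_independent:
  assumes alt: "alternating m" and nd: "nondegenerate m"
    and f: "\<And>i::4. sub_covector m (f i)" "\<And>i. f i \<noteq> 0" "\<And>i j c. i \<noteq> j \<Longrightarrow> f i \<noteq> c *s f j"
    and rel: "w *s f 1 + x *s f 2 + y *s f 3 + z *s f 4 = 0"
  shows "w = 0 \<and> x = 0 \<and> y = 0 \<and> z = 0"
proof -
  from star[OF alt nd f(2)[of 1] f(1)[of 1]]
  obtain G :: "4 \<Rightarrow> complex^4" where "\<And>i. sub_covector m (G i)" and G:
    "\<And>h. sub_covector m h \<Longrightarrow> (\<exists>c. h = c *s f 1) \<or> (\<exists>i c. h = c *s G i)"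
    "\<And>i j l w x y z. i \<noteq> j \<Longrightarrow> j \<noteq> l \<Longrightarrow> i \<noteq> l \<Longrightarrow>
       w *s f 1 + x *s G i + y *s G j + z *s G l = 0 \<Longrightarrow> w = 0 \<and> x = 0 \<and> y = 0 \<and> z = 0"
    by blast
  define kc where "kc i = (SOME kc. f i = snd kc *s G (fst kc))" for i
  define k where "k i = fst (kc i)" for i
  define c where "c i = snd (kc i)" for i
  have kc: "f i = c i *s G (k i)" if "i \<noteq> 1" for i
  proof -
    have "\<exists>kc. f i = snd kc *s G (fst kc)"
      using G(1)[OF f(1)[of i]] f(3)[OF that] by fastforce
    then show ?thesis unfolding c_def k_def kc_def by (rule someI_ex)
  qed
  have c0: "c i \<noteq> 0" if "i \<noteq> 1" for i using kc[OF that] f(2)[of i] by auto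
  have kne: "k i \<noteq> k j" if "i \<noteq> 1" "j \<noteq> 1" "i \<noteq> j" for i j
  proof
    assume "k i = k j"
    then have "f i = (c i / c j) *s f j" using kc that c0[of j] by simp
    then show False using f(3)[OF that(3)] by blast
  qed
  have "w *s f 1 + (x * c 2) *s G (k 2) + (y * c 3) *s G (k 3) + (z * c 4) *s G (k 4) = 0"
    using rel kc[of 2] kc[of 3] kc[of 4] by simp
  then have "w = 0 \<and> x * c 2 = 0 \<and> y * c 3 = 0 \<and> z * c 4 = 0"
    by (intro G(2)[of "k 2" "k 3" "k 4"] kne) simp_all
  then show ?thesis using c0 by simp
qed

text \<open>The index type \<open>4 option\<close> serves as a set with five elements.\<close>
theorem five_sub_covectors:
  assumes alt: "alternating m" and nd: "nondegenerate m"
  obtains F :: "4 option \<Rightarrow> complex^4" where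
    "\<And>i. F i \<noteq> 0" "\<And>i. sub_covector m (F i)" "\<And>i j c. i \<noteq> j \<Longrightarrow> F i \<noteq> c *s F j"
    "\<And>h. sub_covector m h \<Longrightarrow> \<exists>i c. h = c *s F i"
proof -
  obtain f where f: "f \<noteq> 0" "sub_covector m f" using exists_sub_covector[OF alt] by blast
  obtain G :: "4 \<Rightarrow> complex^4" where G: "\<And>i. sub_covector m (G i)"
    "\<And>h. sub_covector m h \<Longrightarrow> (\<exists>c. h = c *s f) \<or> (\<exists>i c. h = c *s G i)"
    "\<And>i j l w x y z. i \<noteq> j \<Longrightarrow> j \<noteq> l \<Longrightarrow> i \<noteq> l \<Longrightarrow>
       w *s f + x *s G i + y *s G j + z *s G l = 0 \<Longrightarrow> w = 0 \<and> x = 0 \<and> y = 0 \<and> z = 0"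
    using star[OF alt nd f] by blast
  have G2: "x = 0 \<and> y = 0 \<and> w = 0" if ij: "i \<noteq> j" and rel: "w *s f + x *s G i + y *s G j = 0" for i j w x y
  proof -
    obtain l where "l \<noteq> i" "l \<noteq> j" using third_index by blast
    then show ?thesis using G(3)[of i j l w x y 0] ij rel by auto
  qed
  have G1: "x = 0 \<and> w = 0" if rel: "w *s f + x *s G i = 0" for i w x
  proof -
    obtain j where "j \<noteq> i" using third_index by blast
    then show ?thesis using G2[of i j w x 0] rel by auto
  qed
  define F where "F i = (case i of None \<Rightarrow> f | Some i \<Rightarrow> G i)" for i
  show ?thesis
  proof (rule that[of F])
    show "F i \<noteq> 0" for i
      using f(1) G1[of 0 1] by (auto simp: F_def split: option.split)
    show "sub_covector m (F i)" for i
      using f(2) G(1) by (auto simp: F_def split: option.split)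
    show "F i \<noteq> c *s F j" if ij: "i \<noteq> j" for i j c
    proof
      assume e: "F i = c *s F j"
      show False
      proof (cases i)
        case None
        then obtain b where "j = Some b" using ij by (cases j) auto
        then show False using e None G1[of 1 "- c" b] by (simp add: F_def)
      next
        case (Some a)
        show False
        proof (cases j)
          case None
          then show False using e Some G1[of "- c" 1 a] by (simp add: F_def)
        next
          case (Some b)
          then show False using e \<open>i = Some a\<close> ij G2[of a b 0 1 "- c"] by (simp add: F_def)
        qed
      qed
    qed
    show "\<exists>i c. h = c *s F i" if "sub_covector m h" for h
      using G(2)[OF that]
    proof
      assume "\<exists>c. h = c *s f"
      then show ?thesis by (intro exI[of _ None]) (simp add: F_def)
    next
      assume "\<exists>i c. h = c *s G i"
      then obtain i where "\<exists>c. h = c *s G i" by blast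
      then show ?thesis by (intro exI[of _ "Some i"]) (simp add: F_def)
    qed
  qed
qed

section \<open>The five hyperplanes, ideals, and fans\<close>

lemma subalgebras_of_dim_3:
  fixes F :: "'i \<Rightarrow> complex^4"
  assumes alt: "alternating m" and F: "\<And>i. F i \<noteq> 0" "\<And>i. sub_covector m (F i)"
    "\<And>h. sub_covector m h \<Longrightarrow> \<exists>i c. h = c *s F i"
  shows "subalgebras_of_dim m 3 = range (\<lambda>i. {x. F i \<cdot> x = 0})"
proof (intro set_eqI iffI)
  fix S assume "S \<in> subalgebras_of_dim m 3"
  then have S: "subalgebra m S" "vec.dim S = 3" by (auto simp: subalgebras_of_dim_def)
  then obtain f where f: "f \<noteq> 0" "S = {x. f \<cdot> x = 0}"
    using hyperplane_eq_kernel[of S] by (auto simp: subalgebra_def)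
  then have "sub_covector m f" using S sub_covector_iff[OF alt] by simp
  then obtain i c where "f = c *s F i" using F(3) by blast
  then have "S = {x. F i \<cdot> x = 0}" using f by auto
  then show "S \<in> range (\<lambda>i. {x. F i \<cdot> x = 0})" by blast
next
  fix S assume "S \<in> range (\<lambda>i. {x. F i \<cdot> x = 0})"
  then obtain i where "S = {x. F i \<cdot> x = 0}" by blast
  then show "S \<in> subalgebras_of_dim m 3"
    using F(2)[of i] F(1)[of i] sub_covector_iff[OF alt] dim_kernel[OF F(1)[of i]]
    by (simp add: subalgebras_of_dim_def)
qed

lemma kernel_inj:
  fixes F :: "'i \<Rightarrow> complex^'n::finite"
  assumes "\<And>i j c. i \<noteq> j \<Longrightarrow> F i \<noteq> c *s F j"
  shows "inj (\<lambda>i. {x. F i \<cdot> x = 0})"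
proof (rule injI, rule ccontr)
  fix i j assume e: "{x. F i \<cdot> x = 0} = {x. F j \<cdot> x = 0}" and ij: "i \<noteq> j"
  have "F i \<cdot> x = 0" if "F j \<cdot> x = 0" for x using e that by blast
  then obtain c where "F i = c *s F j" using kernel_eq_imp_multiple by blast
  then show False using assms[OF ij] by blast
qed

lemma rows_invertible:
  fixes M :: "complex^4^4"
  assumes "\<And>w x y z. w *s M $ 1 + x *s M $ 2 + y *s M $ 3 + z *s M $ 4 = 0 \<Longrightarrow> w = 0 \<and> x = 0 \<and> y = 0 \<and> z = 0"
  shows "invertible M"
proof -
  have "v = 0" if v: "transpose M *v v = 0" for v
  proof -
    have "v $ 1 *s M $ 1 + v $ 2 *s M $ 2 + v $ 3 *s M $ 3 + v $ 4 *s M $ 4 = transpose M *v v"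
      by (simp add: vec_eq_iff vector_matrix_mult_def sum_4 mult.commute)
    then have "v $ 1 *s M $ 1 + v $ 2 *s M $ 2 + v $ 3 *s M $ 3 + v $ 4 *s M $ 4 = 0" using v by simp
    from assms[OF this] show ?thesis by (simp add: vec_eq_iff forall_4)
  qed
  then have "invertible (transpose M)"
    unfolding invertible_left_inverse matrix_left_invertible_ker by blast
  then show ?thesis by (simp add: invertible_det_nz)
qed

lemma matrix_vector_row: "(M *v x) $ i = (M $ i) \<cdot> x" for M :: "complex^'n::finite^'m::finite"
  by (simp add: matrix_vector_mult_def cdot_def)

lemma generic_kernels:
  fixes F :: "4 option \<Rightarrow> complex^4"
  assumes ind: "\<And>\<sigma> w x y z. inj \<sigma> \<Longrightarrow>
      w *s F (\<sigma> 1) + x *s F (\<sigma> 2) + y *s F (\<sigma> 3) + z *s F (\<sigma> (4::4)) = 0 \<Longrightarrow> w = 0 \<and> x = 0 \<and> y = 0 \<and> z = 0"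
    and F0: "\<And>i. F i \<noteq> 0" and F: "\<And>i j c. i \<noteq> j \<Longrightarrow> F i \<noteq> c *s F j"
  shows "generic_five_hyperplanes (range (\<lambda>i. {x. F i \<cdot> x = 0}))"
proof -
  let ?K = "\<lambda>i. {x. F i \<cdot> x = 0}"
  have inj: "inj ?K" by (rule kernel_inj[OF F])
  have inv: "invertible (\<chi> k. F (\<sigma> k))" if "inj \<sigma>" for \<sigma> :: "4 \<Rightarrow> 4 option"
    by (rule rows_invertible) (use ind[OF that] in simp)
  have "card (range ?K) = 5" using inj by (simp add: card_image)
  moreover have "vec.subspace (?K i) \<and> vec.dim (?K i) = 3" for i
    using dim_kernel[OF F0[of i]] subspace_kernel by simp
  moreover have "vec.dim (\<Inter>T) = 1" if T: "T \<subseteq> range ?K" "card T = 3" for T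
  proof -
    obtain I where I: "T = ?K ` I" using T(1) by (auto simp: subset_image_iff)
    then have "card I = 3" using T(2) inj by (simp add: card_image inj_on_subset)
    then obtain a b c where abc: "I = {a, b, c}" "a \<noteq> b" "b \<noteq> c" "a \<noteq> c" by (auto simp: card_3_iff)
    \<comment> \<open>A fourth index completes the three covectors to the rows of an invertible
      matrix \<open>M\<close>; the intersection is the line on which the first three coordinates of
      \<open>M *v x\<close> vanish.\<close>
    have "I \<noteq> UNIV" using \<open>card I = 3\<close> by auto
    then obtain d where d: "d \<notin> I" by blast
    define \<sigma> where "\<sigma> k = (if k = 1 then a else if k = 2 then b else if k = 3 then c else d)" for k :: 4
    have "inj \<sigma>"
    proof (rule injI)
      fix k l assume "\<sigma> k = \<sigma> l"
      then show "k = l" using abc d exhaust_4[of k] exhaust_4[of l] by (auto simp: \<sigma>_def split: if_splits)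
    qed
    define M where "M = (\<chi> k. F (\<sigma> k))"
    have M: "invertible M" unfolding M_def by (rule inv[OF \<open>inj \<sigma>\<close>])
    have "\<Inter>T = {x. (M *v x) $ 1 = 0 \<and> (M *v x) $ 2 = 0 \<and> (M *v x) $ 3 = 0}"
      by (auto simp: I abc(1) matrix_vector_row M_def \<sigma>_def)
    also have "\<dots> = vec.span {matrix_inv M *v axis 4 1}"
    proof (intro set_eqI iffI)
      fix x assume "x \<in> {x. (M *v x) $ 1 = 0 \<and> (M *v x) $ 2 = 0 \<and> (M *v x) $ 3 = 0}"
      then have "M *v x = (M *v x) $ 4 *s axis 4 1" by (simp add: vec_eq_iff forall_4 axis_def)
      then obtain t where t: "M *v x = t *s axis 4 1" by blast
      have "x = t *s (matrix_inv M *v axis 4 1)"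
        using matrix_inv_vector(2)[OF M, of x] unfolding t by (simp add: vec.scale)
      then show "x \<in> vec.span {matrix_inv M *v axis 4 1}" by (auto simp: vec.span_singleton)
    next
      fix x assume "x \<in> vec.span {matrix_inv M *v axis 4 1}"
      then obtain k where "x = k *s (matrix_inv M *v axis 4 1)" by (auto simp: vec.span_singleton)
      then have "M *v x = k *s axis 4 1" by (simp add: vec.scale matrix_inv_vector[OF M])
      then show "x \<in> {x. (M *v x) $ 1 = 0 \<and> (M *v x) $ 2 = 0 \<and> (M *v x) $ 3 = 0}" by (simp add: axis_def)
    qed
    finally have e: "\<Inter>T = vec.span {matrix_inv M *v axis 4 1}" .
    have "matrix_inv M *v axis 4 1 \<noteq> 0"
    proof
      assume "matrix_inv M *v axis 4 1 = 0"
      then have "M *v (matrix_inv M *v axis 4 1) = 0" by simp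
      then show False unfolding matrix_inv_vector[OF M] by (simp add: axis_eq_0_iff)
    qed
    then show ?thesis unfolding e by (simp add: vec.dim_eq_card_independent)
  qed
  moreover have "\<Inter>T = {0}" if T: "T \<subseteq> range ?K" "card T = 4" for T
  proof -
    obtain I where I: "T = ?K ` I" using T(1) by (auto simp: subset_image_iff)
    then have "card I = CARD(4)" using T(2) inj by (simp add: card_image inj_on_subset)
    then obtain \<sigma> where \<sigma>: "bij_betw \<sigma> (UNIV :: 4 set) I"
      using finite_same_card_bij[of "UNIV :: 4 set" I] by auto
    then have "inj \<sigma>" "I = range \<sigma>" by (auto simp: bij_betw_def)
    define M where "M = (\<chi> k. F (\<sigma> k))"
    have M: "invertible M" unfolding M_def by (rule inv[OF \<open>inj \<sigma>\<close>])
    have "\<Inter>T = {x. M *v x = 0}"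
      by (auto simp: I \<open>I = range \<sigma>\<close> vec_eq_iff matrix_vector_row M_def)
    also have "\<dots> = {0}"
    proof (intro set_eqI iffI)
      fix x assume "x \<in> {x. M *v x = 0}"
      then show "x \<in> {0}" using matrix_inv_vector(2)[OF M, of x] by simp
    qed simp
    finally show ?thesis .
  qed
  ultimately show ?thesis unfolding generic_five_hyperplanes_def by blast
qed

lemma axis_vector_matrix: "axis k 1 v* g = g $ k" for g :: "complex^'n::finite^'n"
proof -
  have "transpose g *v axis k 1 = column k (transpose g)" by (rule matrix_vector_axis)
  then have "axis k 1 v* g = column k (transpose g)" by simp
  also have "\<dots> = g $ k" by (simp add: column_def transpose_def vec_eq_iff)
  finally show ?thesis .
qed

theorem three_dim_subalgebras:
  assumes alt: "alternating m" and nd: "nondegenerate m"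
  shows "card (subalgebras_of_dim m 3) = 5" "generic_five_hyperplanes (subalgebras_of_dim m 3)"
    "\<exists>g. invertible g \<and> subalgebras_of_dim (gl_act g m) 3 = sylvester_pentahedron"
proof -
  obtain F :: "4 option \<Rightarrow> complex^4" where F: "\<And>i. F i \<noteq> 0" "\<And>i. sub_covector m (F i)"
    "\<And>i j c. i \<noteq> j \<Longrightarrow> F i \<noteq> c *s F j" "\<And>h. sub_covector m h \<Longrightarrow> \<exists>i c. h = c *s F i"
    using five_sub_covectors[OF alt nd] by blast
  have ind: "w = 0 \<and> x = 0 \<and> y = 0 \<and> z = 0" if "inj \<sigma>"
    "w *s F (\<sigma> 1) + x *s F (\<sigma> 2) + y *s F (\<sigma> 3) + z *s F (\<sigma> (4::4)) = 0" for \<sigma> w x y z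
  proof (rule sub_covectors_independent[OF alt nd, of "\<lambda>i. F (\<sigma> i)"])
    show "F (\<sigma> i) \<noteq> c *s F (\<sigma> j)" if "i \<noteq> j" for i j c
      using F(3) injD[OF \<open>inj \<sigma>\<close>, of i j] that by blast
  qed (use F(1,2) that(2) in simp_all)
  have H: "subalgebras_of_dim m 3 = range (\<lambda>i. {x. F i \<cdot> x = 0})"
    by (rule subalgebras_of_dim_3[OF alt F(1,2,4)])
  show gen: "generic_five_hyperplanes (subalgebras_of_dim m 3)"
    unfolding H by (rule generic_kernels[OF ind F(1,3)])
  then show "card (subalgebras_of_dim m 3) = 5" by (simp add: generic_five_hyperplanes_def)
  define M where "M = (\<chi> k. F (Some k))"
  have "inj (Some :: 4 \<Rightarrow> 4 option)" by simp
  then have M: "invertible M"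
    by (intro rows_invertible) (use ind[of Some] in \<open>simp add: M_def\<close>)
  \<comment> \<open>The coordinates of the fifth covector in the basis formed by the other
    four.\<close>
  define a where "a = F None v* matrix_inv M"
  have "a v* M = F None" by (simp add: a_def vector_matrix_mul_assoc matrix_inv_mult[OF M])
  then have aF: "F None = a $ 1 *s F (Some 1) + a $ 2 *s F (Some 2) + a $ 3 *s F (Some 3) + a $ 4 *s F (Some 4)"
    by (simp add: vec_eq_iff vector_matrix_mult_def sum_4 M_def mult.commute)
  have a0: "a $ k \<noteq> 0" for k
  proof
    assume ak: "a $ k = 0"
    \<comment> \<open>The fifth covector replaces the one with index \<open>k\<close>. If its
      coefficient there were zero, these four covectors would be dependent.\<close>
    define \<sigma> where "\<sigma> j = (if j = k then None else Some j)" for j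
    have inj: "inj \<sigma>" by (auto simp: inj_def \<sigma>_def)
    define b where "b j = (if j = k then 1 else - a $ j)" for j
    have t: "b j *s F (\<sigma> j) = (if j = k then F None else - (a $ j *s F (Some j)))" for j
      by (simp add: b_def \<sigma>_def)
    have "b 1 *s F (\<sigma> 1) + b 2 *s F (\<sigma> 2) + b 3 *s F (\<sigma> 3) + b 4 *s F (\<sigma> 4) = 0"
      unfolding t using exhaust_4[of k] ak by (auto simp: aF)
    then have "b k = 0" using ind[OF inj] exhaust_4[of k] by blast
    then show False by (simp add: b_def)
  qed
  \<comment> \<open>Rescaling the basis covectors by their coefficients makes the fifth one their
    plain sum.\<close>
  define g where "g = (\<chi> k. a $ k *s F (Some k))"
  have g: "invertible g"
  proof (rule rows_invertible)
    fix w x y z assume "w *s g $ 1 + x *s g $ 2 + y *s g $ 3 + z *s g $ 4 = 0"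
    then have "w * a $ 1 = 0 \<and> x * a $ 2 = 0 \<and> y * a $ 3 = 0 \<and> z * a $ 4 = 0"
      by (intro ind[of Some]) (simp_all add: g_def)
    then show "w = 0 \<and> x = 0 \<and> y = 0 \<and> z = 0" using a0 by simp
  qed
  define F' :: "4 option \<Rightarrow> complex^4" where "F' i = (case i of None \<Rightarrow> vector [1, 1, 1, 1] | Some k \<Rightarrow> axis k 1)" for i
  have F'None: "F' None v* g = F None"
    by (simp add: F'_def aF vec_eq_iff vector_matrix_mult_def sum_4 g_def)
  have F'Some: "F' (Some k) v* g = a $ k *s F (Some k)" for k
    by (simp add: F'_def axis_vector_matrix g_def)
  have F': "F' i v* g = (case i of None \<Rightarrow> 1 | Some k \<Rightarrow> a $ k) *s F i" for i
    using F'None F'Some by (cases i) simp_all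
  have "subalgebras_of_dim (gl_act g m) 3 = range (\<lambda>i. {x. F' i \<cdot> x = 0})"
  proof (rule subalgebras_of_dim_3[OF alternating_gl_act[OF alt]])
    show "F' i \<noteq> 0" for i
      by (auto simp: F'_def vec_eq_iff forall_4 axis_def split: option.split)
    show "sub_covector (gl_act g m) (F' i)" for i
      using F(2)[of i] unfolding sub_covector_gl_act[OF g] F' by (simp add: sub_covector_def wedge_covector_linear)
    show "\<exists>i c. h = c *s F' i" if h: "sub_covector (gl_act g m) h" for h
    proof -
      obtain i c where "h v* g = c *s F i" using F(4) h sub_covector_gl_act[OF g] by blast
      then have "h v* g = (c / (case i of None \<Rightarrow> 1 | Some k \<Rightarrow> a $ k) *s F' i) v* g"
        using a0 by (simp add: vector_matrix_linear F' split: option.split)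
      then show ?thesis using vector_matrix_inj[OF g] by blast
    qed
  qed
  also have "\<dots> = sylvester_pentahedron"
  proof -
    have "range (\<lambda>i. {x. F' i \<cdot> x = 0}) = {{x. F' None \<cdot> x = 0}, {x. F' (Some 1) \<cdot> x = 0}, {x. F' (Some 2) \<cdot> x = 0},
        {x. F' (Some 3) \<cdot> x = 0}, {x. F' (Some 4) \<cdot> x = 0}}"
      unfolding UNIV_option_conv UNIV_4 by simp
    then show ?thesis by (simp add: F'_def sylvester_pentahedron_def cdot_4[of "vector _"] insert_commute)
  qed
  finally show "\<exists>g. invertible g \<and> subalgebras_of_dim (gl_act g m) 3 = sylvester_pentahedron"
    using g by blast
qed

section \<open>Exclusion of small ideals\<close>

text \<open>All covectors killing \<open>axis 1 1\<close> are eigencovectors for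
  \<open>\<mu>\<close>, so on this three-dimensional space the section reduces to one quadratic form
  \<open>?W\<close>. It has a zero \<open>F x\<close>. Vanishing of its polar at \<open>x\<close> is
  a single linear condition, whose two-dimensional solution space would have to lie in the line of
  \<open>F x\<close>.\<close>

lemma not_scalar_axis:
  assumes alt: "alternating m" and nd: "nondegenerate m"
    and ideal: "\<And>x. \<exists>c. m (axis 1 1) x = \<mu> *s x + c *s axis 1 1"
  shows False
proof -
  define F :: "complex^3 \<Rightarrow> complex^4" where "F x = vector [0, x $ 1, x $ 2, x $ 3]" for x
  let ?W = "\<lambda>f h. wedge m f h (axis 2 1) (axis 3 1) (axis 4 1)"
  have Flin: "F (p *s x + q *s y) = p *s F x + q *s F y" for p q x y
    by (simp add: F_def vec_eq_iff forall_4 algebra_simps)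
  have e1: "F x \<cdot> m (axis 1 1) y = \<mu> * (F x \<cdot> y)" "F x \<cdot> m y (axis 1 1) = - \<mu> * (F x \<cdot> y)" for x y
  proof -
    obtain c where "m (axis 1 1) y = \<mu> *s y + c *s axis 1 1" using ideal by blast
    then show "F x \<cdot> m (axis 1 1) y = \<mu> * (F x \<cdot> y)" by (simp add: F_def)
    then show "F x \<cdot> m y (axis 1 1) = - \<mu> * (F x \<cdot> y)" by (simp add: alternating_swap[OF alt, of y])
  qed
  have F1: "F x \<cdot> axis 1 1 = 0" for x by (simp add: F_def)
  have polar: "wedge m (F x) (F y) u v w + wedge m (F y) (F x) u v w = 0"
    if "?W (F x) (F y) + ?W (F y) (F x) = 0" for x y u v w
    by (rule polar_wedge_zero[OF alt]) (use that in \<open>auto simp: wedge_def e1 F1 simp del: cdot_axis\<close>)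
  obtain s t where st: "(s, t) \<noteq> (0, 0)" "?W (F (axis 1 1)) (F (axis 1 1)) * s\<^sup>2
      + (?W (F (axis 1 1)) (F (axis 2 1)) + ?W (F (axis 2 1)) (F (axis 1 1))) * s * t
      + ?W (F (axis 2 1)) (F (axis 2 1)) * t\<^sup>2 = 0"
    using binary_quadratic_root by blast
  define x :: "complex^3" where "x = s *s axis 1 1 + t *s axis 2 1"
  have x0: "F x \<noteq> 0" using st(1) by (auto simp: F_def x_def vec_eq_iff forall_4 axis_def)
  have Wx: "?W (F x) (F x) = 0"
    using st(2) unfolding x_def Flin by (simp add: wedge_covector_linear power2_eq_square algebra_simps)
  have sub: "sub_covector m (F x)"
    using polar[of x x] Wx by (simp add: sub_covector_def)
  define r :: "complex^3" where "r = (\<chi> k. ?W (F x) (F (axis k 1)) + ?W (F (axis k 1)) (F x))"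
  have r: "r \<cdot> y = ?W (F x) (F y) + ?W (F y) (F x)" for y
  proof -
    have "F y = y $ 1 *s F (axis 1 1) + y $ 2 *s F (axis 2 1) + y $ 3 *s F (axis 3 1)"
      by (simp add: F_def vec_eq_iff forall_4 axis_def)
    then show ?thesis
      by (simp add: r_def cdot_3 wedge_covector_linear algebra_simps)
  qed
  obtain a b where ab: "r \<cdot> a = 0" "r \<cdot> b = 0" "\<And>x y. x *s a + y *s b = 0 \<Longrightarrow> x = 0 \<and> y = 0"
    using two_in_kernel by blast
  have "\<exists>c. F y = c *s F x" if "r \<cdot> y = 0" for y
    using nd x0 sub polar[of x y] that unfolding nondegenerate_def r by blast
  then obtain c d where cd: "F a = c *s F x" "F b = d *s F x" using ab by blast
  have "F (d *s a + (- c) *s b) = 0" unfolding Flin cd by (simp add: vec_eq_iff)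
  then have "d *s a + (- c) *s b = 0" by (simp add: F_def vec_eq_iff forall_4 forall_3)
  from ab(3)[OF this] have "c = 0" by simp
  then have "1 *s a + 0 *s b = 0" using cd(1) by (simp add: F_def vec_eq_iff forall_4 forall_3)
  from ab(3)[OF this] show False by simp
qed

text \<open>For covectors killing the ideal, all forms involved come from the two-dimensional
  quotient, which carries no nonzero 3-forms. So \<open>axis 3 1\<close> would be a zero with the
  tangent direction \<open>axis 4 1\<close>.\<close>

lemma no_ideal_plane:
  assumes alt: "alternating m" and nd: "nondegenerate m"
    and ideal: "\<And>x. \<exists>c d. m (axis 1 1) x = c *s axis 1 1 + d *s axis 2 1"
      "\<And>x. \<exists>c d. m (axis 2 1) x = c *s axis 1 1 + d *s axis 2 1"
  shows False
proof -
  have m: "m (axis 1 1) x $ k = 0" "m (axis 2 1) x $ k = 0" "m x (axis 1 1) $ k = 0" "m x (axis 2 1) $ k = 0"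
    if "k = 3 \<or> k = 4" for x k
  proof -
    obtain c d where "m (axis 1 1) x = c *s axis 1 1 + d *s axis 2 1" using ideal by blast
    then show "m (axis 1 1) x $ k = 0" using that by (auto simp: axis_def)
    then show "m x (axis 1 1) $ k = 0" by (simp add: alternating_swap[OF alt, of x])
    obtain c d where "m (axis 2 1) x = c *s axis 1 1 + d *s axis 2 1" using ideal by blast
    then show "m (axis 2 1) x $ k = 0" using that by (auto simp: axis_def)
    then show "m x (axis 2 1) $ k = 0" by (simp add: alternating_swap[OF alt, of x])
  qed
  have ax: "axis k 1 $ l = (if k = l then 1 else (0::complex))" for k l :: 4
    by (simp add: axis_def)
  have polar: "wedge m (axis k 1) (axis l 1) u v w + wedge m (axis l 1) (axis k 1) u v w = 0"
    if "k = 3 \<or> k = 4" "l = 3 \<or> l = 4" for k l u v w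
    by (rule polar_wedge_zero[OF alt]) (use that in \<open>auto simp: wedge_def m ax\<close>)
  have "sub_covector m (axis 3 1)"
    using polar[of 3 3] by (simp add: sub_covector_def)
  moreover have "axis 3 1 \<noteq> (0 :: complex^4)" by (simp add: axis_eq_0_iff)
  ultimately obtain c where "axis 4 1 = c *s (axis 3 1 :: complex^4)"
    using nd polar[of 3 4] unfolding nondegenerate_def by blast
  from arg_cong[OF this, of "\<lambda>v. v $ 4"] show False by (simp add: axis_def)
qed

lemma not_scalar:
  assumes alt: "alternating m" and nd: "nondegenerate m" and v: "v \<noteq> 0"
    and scalar: "\<And>x. \<exists>c. m v x = \<mu> *s x + c *s v"
  shows False
proof -
  obtain g :: "complex^4^4" where g: "invertible g" "column 1 g = v" using complete_column[OF v] by blast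
  let ?h = "matrix_inv g"
  have gv: "g *v axis 1 1 = v" by (simp add: matrix_vector_axis g(2))
  then have hv: "?h *v v = axis 1 1" using matrix_inv_vector(2)[OF g(1), of "axis 1 1"] by simp
  show False
  proof (rule not_scalar_axis)
    show "alternating (gl_act ?h m)" "nondegenerate (gl_act ?h m)"
      using alternating_gl_act[OF alt] nondegenerate_gl_act[OF invertible_matrix_inv(1)[OF g(1)] nd] by auto
    show "\<exists>c. gl_act ?h m (axis 1 1) x = \<mu> *s x + c *s axis 1 1" for x
    proof -
      obtain c where "m v (g *v x) = \<mu> *s (g *v x) + c *s v" using scalar by blast
      then have "gl_act ?h m (axis 1 1) x = \<mu> *s x + c *s axis 1 1"
        by (simp add: gl_act_def invertible_matrix_inv[OF g(1)] gv hv matrix_vector_right_distrib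
            vec.scale matrix_inv_vector[OF g(1)])
      then show ?thesis by blast
    qed
  qed
qed

theorem no_small_ideals:
  assumes alt: "alternating m" and nd: "nondegenerate m" and I: "alg_ideal m I"
  shows "vec.dim I \<noteq> 1" "vec.dim I \<noteq> 2"
proof -
  have sub: "vec.subspace I" and ideal: "\<And>u v. u \<in> I \<Longrightarrow> m u v \<in> I"
    using I by (auto simp: alg_ideal_def)
  show "vec.dim I \<noteq> 1"
  proof
    assume "vec.dim I = 1"
    then obtain a where a: "a \<noteq> 0" "I = vec.span {a}" using line_span[OF sub] by blast
    have "a \<in> I" by (simp add: a(2) vec.span_base)
    have "\<exists>c. m a x = 0 *s x + c *s a" for x
    proof -
      have "m a x \<in> vec.span {a}" using ideal[OF \<open>a \<in> I\<close>] a(2) by blast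
      then show ?thesis by (auto simp: vec.span_singleton)
    qed
    with a(1) show False by (rule not_scalar[OF alt nd])
  qed
  show "vec.dim I \<noteq> 2"
  proof
    assume dim: "vec.dim I = 2"
    obtain B where B: "B \<subseteq> I" "vec.independent B" "I \<subseteq> vec.span B" "card B = vec.dim I"
      by (rule vec.basis_exists[of I])
    then obtain a b where ab: "B = {a, b}" "a \<noteq> b" using dim by (metis card_2_iff)
    have "a \<noteq> 0" "b \<notin> vec.span {a}"
      using B(2) ab vec.independent_insert[of b "{a}"] by (auto simp: insert_commute)
    then have "\<nexists>c. b = c *s a" by (auto simp: vec.span_singleton)
    then obtain g :: "complex^4^4" where g: "invertible g" "column 1 g = a" "column 2 g = b"
      using complete_pair[OF \<open>a \<noteq> 0\<close>] by blast
    have gab: "g *v axis 1 1 = a" "g *v axis 2 1 = b" by (simp_all add: matrix_vector_axis g(2,3))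
    then have gab': "matrix_inv g *v a = axis 1 1" "matrix_inv g *v b = axis 2 1"
      using matrix_inv_vector(2)[OF g(1), of "axis 1 1"] matrix_inv_vector(2)[OF g(1), of "axis 2 1"] by simp_all
    let ?h = "matrix_inv g"
    have comb: "\<exists>c d. ?h *v u = c *s axis 1 1 + d *s axis 2 1" if u: "u \<in> I" for u
    proof -
      have "u \<in> vec.span {a, b}" using u B(3) ab(1) by blast
      then obtain c d where "u = c *s a + d *s b"
        by (auto simp: vec.span_insert vec.span_singleton) (metis add.commute diff_add_cancel)
      then show ?thesis by (intro exI[of _ c] exI[of _ d]) (simp add: matrix_vector_right_distrib vec.scale gab')
    qed
    have "a \<in> I" "b \<in> I" using B(1) ab by auto
    show False
    proof (rule no_ideal_plane)
      show "alternating (gl_act ?h m)" "nondegenerate (gl_act ?h m)"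
        using alternating_gl_act[OF alt] nondegenerate_gl_act[OF invertible_matrix_inv(1)[OF g(1)] nd] by auto
      show "\<exists>c d. gl_act ?h m (axis 1 1) x = c *s axis 1 1 + d *s axis 2 1"
        "\<exists>c d. gl_act ?h m (axis 2 1) x = c *s axis 1 1 + d *s axis 2 1" for x
        using comb[OF ideal[OF \<open>a \<in> I\<close>]] comb[OF ideal[OF \<open>b \<in> I\<close>]]
        by (simp_all add: gl_act_def invertible_matrix_inv[OF g(1)] gab)
    qed
  qed
qed

section \<open>Fans and pairs of hyperplanes\<close>

definition polar :: "alg \<Rightarrow> complex^4 \<Rightarrow> complex^4 \<Rightarrow> complex^4 \<Rightarrow> complex^4 \<Rightarrow> complex^4 \<Rightarrow> complex" where
  "polar m f h u v w = wedge m f h u v w + wedge m h f u v w"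

lemma polar_linear:
  assumes "alternating m"
  shows "polar m f h (u + u') v w = polar m f h u v w + polar m f h u' v w"
    "polar m f h (c *s u) v w = c * polar m f h u v w"
    "polar m f h u v w = polar m f h v w u" "polar m f h v u w = - polar m f h u v w"
    "polar m (f + f') h u v w = polar m f h u v w + polar m f' h u v w"
    "polar m (c *s f) h u v w = c * polar m f h u v w"
    "polar m f (h + h') u v w = polar m f h u v w + polar m f h' u v w"
    "polar m f (c *s h) u v w = c * polar m f h u v w"
    "polar m f h u v w = polar m h f u v w"
proof -
  show "polar m f h u v w = polar m f h v w u"
    using wedge_cyc[of m f h u v w] wedge_cyc[of m h f u v w] by (simp add: polar_def)
  show "polar m f h v u w = - polar m f h u v w"
    using wedge_swap[OF assms, of f h v u w] wedge_swap[OF assms, of h f v u w] by (simp add: polar_def)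
qed (simp_all add: polar_def wedge_linear[OF assms] wedge_covector_linear algebra_simps)

lemma sub_covector_polar: "sub_covector m f \<longleftrightarrow> (\<forall>u v w. polar m f f u v w = 0)"
  by (simp add: sub_covector_def polar_def)

lemma nondegenerate_polar:
  assumes "nondegenerate m" "f \<noteq> 0" "sub_covector m f" "\<And>u v w. polar m f h u v w = 0"
  shows "\<exists>c. h = c *s f"
  using assms unfolding nondegenerate_def polar_def by blast

lemma polar_zero_basis:
  fixes g :: "complex^4^4"
  assumes alt: "alternating m" and g: "invertible g"
    and z: "polar m f h (column 1 g) (column 2 g) (column 3 g) = 0"
      "polar m f h (column 1 g) (column 2 g) (column 4 g) = 0"
      "polar m f h (column 1 g) (column 3 g) (column 4 g) = 0"
      "polar m f h (column 2 g) (column 3 g) (column 4 g) = 0"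
  shows "polar m f h u v w = 0"
proof -
  note pl = polar_linear[OF alt]
  have "polar m f h (g *v u) (g *v v) (g *v w) = 0" for u v w
  proof (rule alternating_trilinear_zero[where F = "\<lambda>u v w. polar m f h (g *v u) (g *v v) (g *v w)"])
    show "polar m f h (g *v (u + u')) (g *v v) (g *v w) = polar m f h (g *v u) (g *v v) (g *v w)
        + polar m f h (g *v u') (g *v v) (g *v w)" for u u' v w
      by (simp only: matrix_vector_right_distrib pl(1))
    show "polar m f h (g *v (c *s u)) (g *v v) (g *v w) = c * polar m f h (g *v u) (g *v v) (g *v w)" for c u v w
      by (simp only: vec.scale pl(2))
    show "polar m f h (g *v u) (g *v v) (g *v w) = polar m f h (g *v v) (g *v w) (g *v u)" for u v w
      by (rule pl(3))
    show "polar m f h (g *v v) (g *v u) (g *v w) = - polar m f h (g *v u) (g *v v) (g *v w)" for u v w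
      by (rule pl(4))
  qed (use z in \<open>simp_all add: matrix_vector_axis\<close>)
  from this[of "matrix_inv g *v u" "matrix_inv g *v v" "matrix_inv g *v w"]
  show ?thesis by (simp add: matrix_inv_vector[OF g])
qed

text \<open>Since \<open>m v v = 0\<close>, \<open>m v\<close> acts on the quotient by
  \<open>v\<close>. These are the eigencovectors of that action, with zero included.\<close>

definition eigencovectors :: "alg \<Rightarrow> complex^4 \<Rightarrow> complex \<Rightarrow> (complex^4) set" where
  "eigencovectors m v \<mu> = {f. f \<cdot> v = 0 \<and> (\<forall>w. f \<cdot> m v w = \<mu> * (f \<cdot> w))}"

text \<open>The preimage of an eigenspace of the action on the quotient by \<open>v\<close>; it
  contains \<open>v\<close> for every \<open>\<mu>\<close>.\<close>

definition eigenspace :: "alg \<Rightarrow> complex^4 \<Rightarrow> complex \<Rightarrow> (complex^4) set" where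
  "eigenspace m v \<mu> = {w. \<exists>c. m v w = \<mu> *s w + c *s v}"

text \<open>Contracting \<open>wedge m f h\<close> with \<open>v\<close> gives, up to sign,
  \<open>\<mu>\<close> times the exterior product of \<open>f\<close> and \<open>h\<close>, and
  symmetrising in \<open>f\<close> and \<open>h\<close> kills it.\<close>

lemma polar_eigencovectors:
  assumes alt: "alternating m" and "f \<in> eigencovectors m v \<mu>" "h \<in> eigencovectors m v \<mu>"
  shows "polar m f h v x y = 0"
  using assms(2,3) unfolding eigencovectors_def
  by (simp add: polar_def wedge_def alternating_swap[OF alt, of y v] algebra_simps)

lemma eigencovectors_linear:
  "f \<in> eigencovectors m v \<mu> \<Longrightarrow> h \<in> eigencovectors m v \<mu> \<Longrightarrow> f + h \<in> eigencovectors m v \<mu>"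
  "f \<in> eigencovectors m v \<mu> \<Longrightarrow> c *s f \<in> eigencovectors m v \<mu>"
  by (simp_all add: eigencovectors_def algebra_simps)

text \<open>In a basis of four vectors containing \<open>v\<close> and \<open>v'\<close>, every
  triple contains one of them.\<close>

lemma polar_zero_two:
  assumes alt: "alternating m" and v: "v \<noteq> 0" "\<nexists>c. v' = c *s v"
    and "\<And>x y. polar m f h v x y = 0" "\<And>x y. polar m f h v' x y = 0"
  shows "polar m f h u w z = 0"
proof -
  obtain g :: "complex^4^4" where g: "invertible g" "column 1 g = v" "column 2 g = v'" using complete_pair[OF v] by blast
  show ?thesis by (rule polar_zero_basis[OF alt g(1)]) (use assms(4,5) g(2,3) in simp_all)
qed

lemma three_covectors_kernel:
  fixes a b c :: "complex^4"
  obtains v where "v \<noteq> 0" "a \<cdot> v = 0" "b \<cdot> v = 0" "c \<cdot> v = 0"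
proof -
  define M :: "complex^4^4" where "M = vector [a, b, c, 0]"
  have "\<not> invertible M"
  proof
    assume M: "invertible M"
    have "(M *v (matrix_inv M *v axis 4 1)) $ 4 = 0"
      unfolding matrix_vector_row by (simp add: M_def vector_def)
    then show False unfolding matrix_inv_vector[OF M] by simp
  qed
  then obtain v where v: "v \<noteq> 0" "M *v v = 0"
    using matrix_left_invertible_ker invertible_left_inverse by blast
  have "M $ k \<cdot> v = 0" for k using v(2) matrix_vector_row[of M v k] by simp
  from this[of 1] this[of 2] this[of 3] show ?thesis
    by (intro that[OF v(1)]) (simp_all add: M_def vector_def)
qed

text \<open>A zero \<open>f\<close> of the section is an eigencovector for every \<open>v\<close> it
  kills, and the eigenvalue is linear in \<open>v\<close>. Being killed by \<open>f\<close> and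
  \<open>h\<close> with equal eigenvalues is thus three linear conditions on \<open>v\<close> in
  four-space; \<open>\<gamma>\<close> is the difference of the eigenvalues up to sign.\<close>

lemma common_eigencovector:
  assumes alt: "alternating m" and f: "f \<noteq> 0" "sub_covector m f" and h: "h \<noteq> 0" "sub_covector m h"
  obtains v \<mu> where "v \<noteq> 0" "f \<in> eigencovectors m v \<mu>" "h \<in> eigencovectors m v \<mu>"
proof -
  have eig: "f \<in> eigencovectors m v (- (f \<cdot> m z v))"
    if "sub_covector m f" "f \<cdot> z = 1" "f \<cdot> v = 0" for f z v
  proof -
    have "f \<cdot> m v w = - (f \<cdot> m z v) * (f \<cdot> w)" for w
      using that(1)[unfolded sub_covector_def, rule_format, of v w z] that(2,3)
      by (simp add: wedge_def eq_neg_iff_add_eq_0 mult.commute)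
    then show ?thesis using that(3) by (simp add: eigencovectors_def)
  qed
  obtain y where y: "f \<cdot> y = 1" using nonzero_cdot[OF f(1)] by blast
  obtain z where z: "h \<cdot> z = 1" using nonzero_cdot[OF h(1)] by blast
  define \<gamma> :: "complex^4" where "\<gamma> = (\<chi> k. f \<cdot> m y (axis k 1) - h \<cdot> m z (axis k 1))"
  have \<gamma>: "\<gamma> \<cdot> v = f \<cdot> m y v - h \<cdot> m z v" for v
  proof -
    have "m x v = v $ 1 *s m x (axis 1 1) + v $ 2 *s m x (axis 2 1)
        + v $ 3 *s m x (axis 3 1) + v $ 4 *s m x (axis 4 1)" for x
      by (subst axis_expansion_4[of v]) (simp only: alternating_bilinear[OF alt])
    note e = this
    show ?thesis
      unfolding cdot_4[of \<gamma>] by (subst (1 2) e) (simp add: \<gamma>_def algebra_simps)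
  qed
  obtain v where v: "v \<noteq> 0" "f \<cdot> v = 0" "h \<cdot> v = 0" "\<gamma> \<cdot> v = 0"
    using three_covectors_kernel by blast
  have "f \<cdot> m y v = h \<cdot> m z v" using v(4) by (simp add: \<gamma>)
  then show ?thesis
    using that[of v "- (f \<cdot> m y v)"] v(1) eig[OF f(2) y v(2)] eig[OF h(2) z v(3)] by simp
qed

locale five_sub_covector_algebra =
  fixes m :: alg and F :: "4 option \<Rightarrow> complex^4"
  assumes alt: "alternating m" and nd: "nondegenerate m"
    and F0: "F i \<noteq> 0" and Fsub: "sub_covector m (F i)"
    and Fne: "i \<noteq> j \<Longrightarrow> F i \<noteq> c *s F j"
    and Fall: "sub_covector m h \<Longrightarrow> \<exists>i c. h = c *s F i"
begin

text \<open>Three independent eigencovectors span the annihilator of \<open>v\<close>. Then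
  \<open>m v\<close> would be the scalar \<open>\<mu>\<close> modulo \<open>v\<close>, which
  \<open>not_scalar\<close> excludes. The fourth index \<open>l\<close> allows independence of four
  covectors to be applied.\<close>

lemma eigencovectors_no_three:
  assumes v: "v \<noteq> 0" and ijk: "i \<noteq> j" "j \<noteq> k" "i \<noteq> k"
    and e: "F i \<in> eigencovectors m v \<mu>" "F j \<in> eigencovectors m v \<mu>" "F k \<in> eigencovectors m v \<mu>"
  shows False
proof (rule not_scalar[OF alt nd v])
  fix x
  have "card {i, j, k} \<noteq> CARD(4 option)" using ijk by simp
  then have "{i, j, k} \<noteq> UNIV" by (intro notI) simp
  then obtain l where l: "l \<noteq> i" "l \<noteq> j" "l \<noteq> k" by blast
  define \<sigma> where "\<sigma> a = (if a = 1 then i else if a = 2 then j else if a = 3 then k else l)" for a :: 4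
  have inj: "a \<noteq> b \<Longrightarrow> \<sigma> a \<noteq> \<sigma> b" for a b
    using exhaust_4[of a] exhaust_4[of b] ijk l by (auto simp: \<sigma>_def)
  define M where "M = (\<chi> a. F (\<sigma> a))"
  have M: "invertible M"
  proof (rule rows_invertible)
    fix w x y z assume "w *s M $ 1 + x *s M $ 2 + y *s M $ 3 + z *s M $ 4 = 0"
    then have "w *s F (\<sigma> 1) + x *s F (\<sigma> 2) + y *s F (\<sigma> 3) + z *s F (\<sigma> 4) = 0" by (simp add: M_def)
    from sub_covectors_independent[OF alt nd, of "\<lambda>a. F (\<sigma> a)", OF Fsub F0 Fne[OF inj] this]
    show "w = 0 \<and> x = 0 \<and> y = 0 \<and> z = 0" .
  qed
  have ker: "M *v x = (M *v x) $ 4 *s axis 4 1" if "F i \<cdot> x = 0" "F j \<cdot> x = 0" "F k \<cdot> x = 0" for x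
    using that by (simp add: vec_eq_iff forall_4 axis_def matrix_vector_row) (simp add: M_def \<sigma>_def)
  define y where "y = m v x - \<mu> *s x"
  obtain t where t: "M *v y = t *s axis 4 1"
    using ker[of y] e by (auto simp: y_def eigencovectors_def)
  obtain s where s: "M *v v = s *s axis 4 1"
    using ker[of v] e by (auto simp: eigencovectors_def)
  have "s \<noteq> 0" using s matrix_inv_vector(2)[OF M, of v] v by auto
  have "M *v (y - (t / s) *s v) = 0"
    using \<open>s \<noteq> 0\<close> by (simp add: matrix_vector_mult_diff_distrib vec.scale t s)
  then have "y - (t / s) *s v = 0" using matrix_inv_vector(2)[OF M, of "y - (t / s) *s v"] by simp
  then show "\<exists>c. m v x = \<mu> *s x + c *s v"
    by (intro exI[of _ "t / s"]) (simp add: y_def algebra_simps)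
qed

text \<open>If \<open>v\<close> and \<open>v'\<close> were independent, contraction with either
  would kill the polar form of \<open>F i\<close> and \<open>F j\<close>. It would vanish
  identically, and \<open>F j\<close> would be a tangent direction at the zero
  \<open>F i\<close>.\<close>

lemma eigencovector_unique:
  assumes ij: "i \<noteq> j" and v: "v \<noteq> 0"
    and e: "F i \<in> eigencovectors m v \<mu>" "F j \<in> eigencovectors m v \<mu>"
      "F i \<in> eigencovectors m v' \<mu>'" "F j \<in> eigencovectors m v' \<mu>'"
  shows "\<exists>c. v' = c *s v \<and> \<mu>' = c * \<mu>"
proof -
  have "\<exists>c. v' = c *s v"
  proof (rule ccontr)
    assume n: "\<nexists>c. v' = c *s v"
    have "polar m (F i) (F j) u w z = 0" for u w z
      by (rule polar_zero_two[OF alt v n]) (use polar_eigencovectors[OF alt] e in blast)+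
    then obtain c where "F j = c *s F i" using nondegenerate_polar[OF nd F0 Fsub] by blast
    then show False using Fne[of j i c] ij by simp
  qed
  then obtain c where c: "v' = c *s v" by blast
  obtain z where z: "F i \<cdot> z = 1" using nonzero_cdot[OF F0] by blast
  have "F i \<cdot> m v' z = \<mu>'" "F i \<cdot> m v z = \<mu>" using e z by (simp_all add: eigencovectors_def)
  then have "\<mu>' = c * \<mu>" by (simp add: c alternating_bilinear[OF alt])
  then show ?thesis using c by blast
qed

text \<open>The two eigencovectors kill the image of \<open>m v - \<mu>\<close>, so modulo
  \<open>v\<close> this map has rank at most one and is measured by a third covector
  \<open>q\<close>. It does not vanish, by \<open>not_scalar\<close>.\<close>

lemma eigenspace_hyperplane:
  assumes v: "v \<noteq> 0" and ij: "i \<noteq> j" and e: "F i \<in> eigencovectors m v \<mu>" "F j \<in> eigencovectors m v \<mu>"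
  obtains r where "r \<noteq> 0" "eigenspace m v \<mu> = {w. r \<cdot> w = 0}"
proof -
  obtain g :: "complex^4^4" where g: "invertible g" "column 1 g = F i" "column 2 g = F j"
    using complete_pair[OF F0[of i], of "F j"] Fne[OF ij[symmetric]] by blast
  define M where "M = transpose g"
  have M: "invertible M" using g(1) by (simp add: M_def invertible_det_nz)
  have M12: "M $ 1 = F i" "M $ 2 = F j"
    using g(2,3) by (simp_all add: M_def transpose_def column_def vec_eq_iff)
  \<comment> \<open>The combination of the remaining two rows that kills \<open>v\<close>; with
    \<open>F i\<close> and \<open>F j\<close> it cuts out the line of \<open>v\<close>.\<close>
  define q where "q = (M *v v) $ 3 *s M $ 4 - (M *v v) $ 4 *s M $ 3"
  have Mv: "(M *v v) $ 1 = 0" "(M *v v) $ 2 = 0"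
    using e by (simp_all add: matrix_vector_row M12 eigencovectors_def)
  have qv: "q \<cdot> v = 0" by (simp add: q_def matrix_vector_row mult.commute)
  have q: "\<exists>c. x = c *s v" if x: "F i \<cdot> x = 0" "F j \<cdot> x = 0" "q \<cdot> x = 0" for x
  proof -
    have Mx: "(M *v x) $ 1 = 0" "(M *v x) $ 2 = 0" using x by (simp_all add: matrix_vector_row M12)
    have c: "(M *v v) $ 3 * (M *v x) $ 4 = (M *v v) $ 4 * (M *v x) $ 3"
      using x(3) by (simp add: q_def matrix_vector_row)
    have "M *v v \<noteq> 0" using matrix_inv_vector(2)[OF M, of v] v by auto
    then consider "(M *v v) $ 3 \<noteq> 0" | "(M *v v) $ 4 \<noteq> 0"
      using Mv by (auto simp: vec_eq_iff forall_4)
    then obtain t where "M *v x = t *s (M *v v)"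
    proof cases
      case 1
      then have "M *v x = ((M *v x) $ 3 / (M *v v) $ 3) *s (M *v v)"
        using Mx Mv c by (simp add: vec_eq_iff forall_4 field_simps)
      then show ?thesis using that by blast
    next
      case 2
      then have "M *v x = ((M *v x) $ 4 / (M *v v) $ 4) *s (M *v v)"
        using Mx Mv c by (simp add: vec_eq_iff forall_4 field_simps)
      then show ?thesis using that by blast
    qed
    then have "x = t *s v"
      using matrix_inv_vector(2)[OF M, of x] matrix_inv_vector(2)[OF M, of v] by (simp add: vec.scale)
    then show ?thesis by blast
  qed
  define r where "r = (\<chi> k. q \<cdot> (m v (axis k 1) - \<mu> *s axis k 1))"
  have r: "r \<cdot> w = q \<cdot> (m v w - \<mu> *s w)" for w
  proof -
    have "m v w - \<mu> *s w = w $ 1 *s (m v (axis 1 1) - \<mu> *s axis 1 1) + w $ 2 *s (m v (axis 2 1) - \<mu> *s axis 2 1)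
        + w $ 3 *s (m v (axis 3 1) - \<mu> *s axis 3 1) + w $ 4 *s (m v (axis 4 1) - \<mu> *s axis 4 1)"
      by (subst (1 2) axis_expansion_4[of w]) (simp add: alternating_bilinear[OF alt] vec_eq_iff algebra_simps)
    note e' = this
    show ?thesis unfolding cdot_4[of r] e' by (simp add: r_def algebra_simps)
  qed
  have W: "eigenspace m v \<mu> = {w. r \<cdot> w = 0}"
  proof (intro set_eqI iffI)
    fix w assume "w \<in> eigenspace m v \<mu>"
    then show "w \<in> {w. r \<cdot> w = 0}" by (auto simp: eigenspace_def r qv)
  next
    fix w assume "w \<in> {w. r \<cdot> w = 0}"
    then have "q \<cdot> (m v w - \<mu> *s w) = 0" by (simp add: r)
    moreover have "F i \<cdot> (m v w - \<mu> *s w) = 0" "F j \<cdot> (m v w - \<mu> *s w) = 0"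
      using e by (simp_all add: eigencovectors_def)
    ultimately obtain c where "m v w - \<mu> *s w = c *s v" using q by blast
    then show "w \<in> eigenspace m v \<mu>"
      unfolding eigenspace_def by (auto simp: diff_eq_eq add.commute)
  qed
  moreover have "r \<noteq> 0"
  proof
    assume "r = 0"
    then have "\<exists>c. m v x = \<mu> *s x + c *s v" for x using W by (auto simp: eigenspace_def)
    then show False using not_scalar[OF alt nd v] by blast
  qed
  ultimately show ?thesis using that by blast
qed

text \<open>A plane through \<open>v\<close> is spanned by \<open>v\<close> and some
  \<open>u\<close>, and all its products are multiples of \<open>m v u\<close>, which lies in it
  because \<open>u\<close> is in the eigenspace.\<close>

lemma fan_of_eigencovectors:
  assumes v: "v \<noteq> 0" and ij: "i \<noteq> j" and e: "F i \<in> eigencovectors m v \<mu>" "F j \<in> eigencovectors m v \<mu>"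
  shows "(vec.span {v}, eigenspace m v \<mu>) \<in> alg_fans m"
proof -
  obtain r where r: "r \<noteq> 0" "eigenspace m v \<mu> = {w. r \<cdot> w = 0}" using eigenspace_hyperplane[OF assms] by blast
  have "m v v = \<mu> *s v + (- \<mu>) *s v" by (simp add: alternating_bilinear(9)[OF alt] vec_eq_iff)
  then have "v \<in> eigenspace m v \<mu>" unfolding eigenspace_def by blast
  then have sub: "vec.span {v} \<subseteq> eigenspace m v \<mu>"
    unfolding r(2) by (intro vec.span_minimal subspace_kernel) simp
  have "subalgebra m U" if U: "vec.subspace U" "vec.dim U = 2" "vec.span {v} \<subseteq> U" "U \<subseteq> eigenspace m v \<mu>" for U
  proof -
    have vU: "v \<in> U" using U(3) vec.span_base by blast
    have "\<not> U \<subseteq> vec.span {v}"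
    proof
      assume "U \<subseteq> vec.span {v}"
      then have "vec.dim U \<le> card {v}" by (rule vec.dim_le_card) simp
      then show False using U(2) by simp
    qed
    then obtain u where u: "u \<in> U" "u \<notin> vec.span {v}" by blast
    then have "\<nexists>c. u = c *s v" by (auto simp: vec.span_singleton)
    note ind = pair_independent[OF v this]
    have "vec.span {v, u} = U"
    proof (rule vec.subspace_dim_equal)
      show "vec.span {v, u} \<subseteq> U" using vU u U(1) by (intro vec.span_minimal) auto
      have "vec.dim {v, u} = 2" using ind by (simp add: vec.dim_eq_card_independent)
      then show "vec.dim U \<le> vec.dim (vec.span {v, u})" using U(2) by (simp only: vec.dim_span)
    qed (use U(1) in simp_all)
    then have rep: "\<exists>a b. x = a *s v + b *s u" if "x \<in> U" for x
      using that by (force simp: vec.span_insert vec.span_singleton algebra_simps)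
    obtain c where c: "m v u = \<mu> *s u + c *s v" using u U(4) by (auto simp: eigenspace_def)
    then have mvu: "m v u \<in> U" using u(1) vU U(1) by (simp add: vec.subspace_add vec.subspace_scale)
    have "m x y \<in> U" if xy: "x \<in> U" "y \<in> U" for x y
    proof -
      obtain a b where x: "x = a *s v + b *s u" using rep[OF xy(1)] by blast
      obtain c d where y: "y = c *s v + d *s u" using rep[OF xy(2)] by blast
      have "m x y = (a * d - b * c) *s m v u"
        unfolding x y alternating_bilinear[OF alt] alternating_swap[OF alt, of u v] by (simp add: vec_eq_iff algebra_simps)
      then show ?thesis by (simp only: vec.subspace_scale[OF U(1) mvu])
    qed
    then show ?thesis using U(1) by (simp add: subalgebra_def)
  qed
  moreover have "vec.dim (vec.span {v}) = 1" using v by (simp add: vec.dim_eq_card_independent)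
  moreover have "vec.dim (eigenspace m v \<mu>) = 3" using dim_kernel[OF r(1)] by (simp add: r(2))
  ultimately show ?thesis
    using sub subspace_kernel by (auto simp: alg_fans_def r(2))
qed

text \<open>Invariance of all intermediate planes makes every nonzero vector of \<open>V3\<close>
  modulo \<open>V1\<close> an eigenvector of \<open>m v\<close>. Comparing \<open>w\<close>,
  \<open>w1\<close> and their sum shows that the eigenvalue is constant. Equality with the
  eigenspace follows by dimension, as the eigenspace is not the whole space.\<close>

lemma fan_eigenspace:
  assumes fan: "(V1, V3) \<in> alg_fans m"
  obtains v \<mu> where "v \<noteq> 0" "V1 = vec.span {v}" "V3 = eigenspace m v \<mu>"
proof -
  have V: "vec.subspace V1" "vec.dim V1 = 1" "vec.subspace V3" "vec.dim V3 = 3" "V1 \<subseteq> V3"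
    and mid: "\<And>U. vec.subspace U \<Longrightarrow> vec.dim U = 2 \<Longrightarrow> V1 \<subseteq> U \<Longrightarrow> U \<subseteq> V3 \<Longrightarrow> subalgebra m U"
    using fan by (auto simp: alg_fans_def)
  obtain v where v: "v \<noteq> 0" "V1 = vec.span {v}" using line_span[OF V(1,2)] by blast
  have vV: "v \<in> V3" using v V(5) vec.span_base by blast
  have eig: "\<exists>a b. m v w = a *s w + b *s v" if w: "w \<in> V3" "\<nexists>c. w = c *s v" for w
  proof -
    let ?U = "vec.span {v, w}"
    have "vec.dim ?U = 2" using pair_independent[OF v(1) w(2)] by (simp add: vec.dim_eq_card_independent)
    moreover have "V1 \<subseteq> ?U" unfolding v(2) by (rule vec.span_mono) simp
    moreover have "?U \<subseteq> V3" using vV w(1) V(3) by (intro vec.span_minimal) auto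
    ultimately have "subalgebra m ?U" by (intro mid) simp_all
    then have "m v w \<in> ?U" by (simp add: subalgebra_def vec.span_base)
    then show ?thesis by (force simp: vec.span_insert vec.span_singleton algebra_simps)
  qed
  have "\<not> V3 \<subseteq> vec.span {v}"
  proof
    assume "V3 \<subseteq> vec.span {v}"
    then have "vec.dim V3 \<le> card {v}" by (rule vec.dim_le_card) simp
    then show False using V(4) by simp
  qed
  then obtain w1 where w1: "w1 \<in> V3" "\<nexists>c. w1 = c *s v" by (auto simp: vec.span_singleton)
  obtain \<mu> b1 where \<mu>: "m v w1 = \<mu> *s w1 + b1 *s v" using eig[OF w1] by blast
  have "V3 \<subseteq> eigenspace m v \<mu>"
  proof
    fix w assume w: "w \<in> V3"
    show "w \<in> eigenspace m v \<mu>"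
    proof (cases "\<exists>a b. w = a *s v + b *s w1")
      case True
      then obtain a b where wab: "w = a *s v + b *s w1" by blast
      have "m v w = \<mu> *s w + (b * b1 - \<mu> * a) *s v"
        unfolding wab by (simp add: alternating_bilinear[OF alt] \<mu> vec_eq_iff algebra_simps)
      then show ?thesis unfolding eigenspace_def by blast
    next
      case False
      have nw: "\<nexists>c. w = c *s v"
      proof
        assume "\<exists>c. w = c *s v"
        then obtain c where "w = c *s v + 0 *s w1" by auto
        then show False using False by blast
      qed
      have nw1: "\<nexists>c. w + w1 = c *s v"
      proof
        assume "\<exists>c. w + w1 = c *s v"
        then obtain c where "w = c *s v + (- 1) *s w1" by (auto simp: eq_diff_eq)
        then show False using False by blast
      qed
      obtain a b where ab: "m v w = a *s w + b *s v" using eig[OF w nw] by blast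
      obtain c d where cd: "m v (w + w1) = c *s (w + w1) + d *s v"
        using eig[OF vec.subspace_add[OF V(3) w w1(1)] nw1] by blast
      have e: "(c - a) *s w + (c - \<mu>) *s w1 + (d - b - b1) *s v = 0"
        using cd by (simp add: alternating_bilinear[OF alt] ab \<mu> vec_eq_iff algebra_simps)
      have "c = a"
      proof (rule ccontr)
        assume "c \<noteq> a"
        have "(c - a) *s w = ((c - a) *s w + (c - \<mu>) *s w1 + (d - b - b1) *s v)
            - (d - b - b1) *s v - (c - \<mu>) *s w1" by (simp only: add_diff_cancel_right')
        also have "\<dots> = (- (d - b - b1)) *s v + (- (c - \<mu>)) *s w1" unfolding e by (simp add: vec_eq_iff)
        finally have cw: "(c - a) *s w = (- (d - b - b1)) *s v + (- (c - \<mu>)) *s w1" .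
        have "1 / (c - a) * (c - a) = 1" using \<open>c \<noteq> a\<close> by simp
        then have "w = (1 / (c - a)) *s ((c - a) *s w)" by (simp only: vec.scale_scale vec.scale_one)
        also have "\<dots> = (1 / (c - a) * (- (d - b - b1))) *s v + (1 / (c - a) * (- (c - \<mu>))) *s w1"
          unfolding cw by (simp only: vec.scale_right_distrib vec.scale_scale)
        finally show False using False by blast
      qed
      have "c = \<mu>"
      proof (rule ccontr)
        assume "c \<noteq> \<mu>"
        then have "w1 = (- (d - b - b1) / (c - \<mu>)) *s v"
          using e \<open>c = a\<close> by (simp add: vec_eq_iff field_simps add_eq_0_iff)
        then show False using w1(2) by blast
      qed
      then have "m v w = \<mu> *s w + b *s v" using ab \<open>c = a\<close> by simp
      then show ?thesis unfolding eigenspace_def by blast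
    qed
  qed
  have sub: "vec.subspace (eigenspace m v \<mu>)"
    unfolding vec.subspace_def
  proof (intro conjI ballI allI)
    show "0 \<in> eigenspace m v \<mu>" by (auto simp: eigenspace_def alternating_bilinear[OF alt] intro: exI[of _ 0])
    show "x + y \<in> eigenspace m v \<mu>" if xy: "x \<in> eigenspace m v \<mu>" "y \<in> eigenspace m v \<mu>" for x y
    proof -
      obtain a b where "m v x = \<mu> *s x + a *s v" "m v y = \<mu> *s y + b *s v" using xy by (auto simp: eigenspace_def)
      then have "m v (x + y) = \<mu> *s (x + y) + (a + b) *s v"
        by (simp add: alternating_bilinear[OF alt] vec_eq_iff algebra_simps)
      then show ?thesis unfolding eigenspace_def by blast
    qed
    show "c *s x \<in> eigenspace m v \<mu>" if x: "x \<in> eigenspace m v \<mu>" for c x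
    proof -
      obtain a where "m v x = \<mu> *s x + a *s v" using x by (auto simp: eigenspace_def)
      then have "m v (c *s x) = \<mu> *s (c *s x) + (c * a) *s v"
        by (simp add: alternating_bilinear[OF alt] vec_eq_iff algebra_simps)
      then show ?thesis unfolding eigenspace_def by blast
    qed
  qed
  have "eigenspace m v \<mu> \<noteq> UNIV"
  proof
    assume "eigenspace m v \<mu> = UNIV"
    then have "\<exists>c. m v x = \<mu> *s x + c *s v" for x by (auto simp: eigenspace_def)
    then show False using not_scalar[OF alt nd v(1)] by blast
  qed
  have "vec.dim (eigenspace m v \<mu>) \<noteq> 4"
  proof
    assume "vec.dim (eigenspace m v \<mu>) = 4"
    then have "eigenspace m v \<mu> = UNIV"
      by (intro vec.subspace_dim_equal[OF sub]) (simp_all add: card_cart_basis)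
    then show False using \<open>eigenspace m v \<mu> \<noteq> UNIV\<close> by blast
  qed
  moreover have "vec.dim (eigenspace m v \<mu>) \<le> 4"
    using vec.dim_subset[OF subset_UNIV, of "eigenspace m v \<mu>"] unfolding vec_dim_card by simp
  ultimately have "V3 = eigenspace m v \<mu>"
    using V \<open>V3 \<subseteq> eigenspace m v \<mu>\<close> sub by (intro vec.subspace_dim_equal) auto
  then show ?thesis using that v by blast
qed

text \<open>The covectors \<open>G 3\<close> and \<open>G 4\<close> kill \<open>v\<close> and the
  image of \<open>m v - \<mu>\<close>, so their span consists of eigencovectors. There the section
  reduces to one binary quadratic form. By nondegeneracy its zero \<open>f\<close> is not double, so
  a second zero \<open>h = h0 + \<kappa> *s f\<close> exists; both zeros come from the five
  covectors.\<close>

lemma fan_eigencovectors: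
  assumes fan: "(vec.span {v}, eigenspace m v \<mu>) \<in> alg_fans m" and v: "v \<noteq> 0"
  obtains i j where "i \<noteq> j" "F i \<in> eigencovectors m v \<mu>" "F j \<in> eigencovectors m v \<mu>"
proof -
  have V: "vec.subspace (eigenspace m v \<mu>)" "vec.dim (eigenspace m v \<mu>) = 3"
    using fan by (auto simp: alg_fans_def)
  obtain \<phi> where \<phi>: "\<phi> \<noteq> 0" "eigenspace m v \<mu> = {x. \<phi> \<cdot> x = 0}"
    using hyperplane_eq_kernel[OF V(1)] V(2) by auto
  obtain z where z: "\<phi> \<cdot> z = 1" using nonzero_cdot[OF \<phi>(1)] by blast
  define y where "y = m v z - \<mu> *s z"
  have ynv: "\<nexists>c. y = c *s v"
  proof
    assume "\<exists>c. y = c *s v"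
    then have "z \<in> eigenspace m v \<mu>" by (auto simp: eigenspace_def y_def diff_eq_eq add.commute)
    then show False using z \<phi>(2) by simp
  qed
  obtain g :: "complex^4^4" where g: "invertible g" "column 1 g = v" "column 2 g = y"
    using complete_pair[OF v ynv] by blast
  define G where "G k = matrix_inv g $ k" for k
  have Gg: "G k \<cdot> column l g = (if k = l then 1 else 0)" for k l
  proof -
    have "G k \<cdot> column l g = (matrix_inv g *v (g *v axis l 1)) $ k"
      by (simp add: matrix_vector_axis matrix_vector_row G_def)
    then show ?thesis by (simp add: matrix_inv_vector[OF g(1)] axis_def)
  qed
  have K: "f \<in> eigencovectors m v \<mu>" if f: "f \<cdot> v = 0" "f \<cdot> y = 0" for f
  proof -
    have "f \<cdot> m v w = \<mu> * (f \<cdot> w)" for w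
    proof -
      have "\<phi> \<cdot> (w - (\<phi> \<cdot> w) *s z) = 0" using z by simp
      then have "w - (\<phi> \<cdot> w) *s z \<in> eigenspace m v \<mu>" using \<phi>(2) by blast
      then obtain c where "m v (w - (\<phi> \<cdot> w) *s z) = \<mu> *s (w - (\<phi> \<cdot> w) *s z) + c *s v"
        by (auto simp: eigenspace_def)
      then have "m v w = \<mu> *s w + (\<phi> \<cdot> w) *s y + c *s v"
        by (simp add: alternating_bilinear[OF alt] y_def vec_eq_iff algebra_simps)
      then show ?thesis using f by simp
    qed
    then show ?thesis using f(1) by (simp add: eigencovectors_def)
  qed
  have G34: "G 3 \<in> eigencovectors m v \<mu>" "G 4 \<in> eigencovectors m v \<mu>"
    using K Gg[of 3 1] Gg[of 3 2] Gg[of 4 1] Gg[of 4 2] g(2,3) by simp_all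
  let ?Q = "\<lambda>f h. polar m f h (column 2 g) (column 3 g) (column 4 g)"
  note pl = polar_linear[OF alt]
  have zero: "polar m f h u w x = 0"
    if "f \<in> eigencovectors m v \<mu>" "h \<in> eigencovectors m v \<mu>" "?Q f h = 0" for f h u w x
    by (rule polar_zero_basis[OF alt g(1)]) (use that polar_eigencovectors[OF alt that(1,2)] g(2) in simp_all)
  obtain s t where st: "(s, t) \<noteq> (0, 0)" "?Q (G 3) (G 3) * s\<^sup>2 + (2 * ?Q (G 3) (G 4)) * s * t + ?Q (G 4) (G 4) * t\<^sup>2 = 0"
    using binary_quadratic_root by blast
  define f where "f = s *s G 3 + t *s G 4"
  have fK: "f \<in> eigencovectors m v \<mu>"
    unfolding f_def by (intro eigencovectors_linear G34)
  have "f \<cdot> column 3 g = s" "f \<cdot> column 4 g = t" by (simp_all add: f_def Gg)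
  then have f0: "f \<noteq> 0" using st(1) by auto
  have "?Q f f = 0"
    using st(2) unfolding f_def by (simp add: pl(5-8) pl(9)[of "G 4" "G 3"] power2_eq_square algebra_simps)
  then have fsub: "sub_covector m f" using zero[OF fK fK] by (simp add: sub_covector_polar)
  define h0 where "h0 = (if s = 0 then G 3 else G 4)"
  have h0K: "h0 \<in> eigencovectors m v \<mu>" using G34 by (simp add: h0_def)
  have h0f: "h0 \<noteq> c *s f" for c
  proof
    assume "h0 = c *s f"
    then have "h0 \<cdot> column 3 g = c * s" "h0 \<cdot> column 4 g = c * t" by (simp_all add: f_def Gg)
    then show False using st(1) by (auto simp: h0_def Gg split: if_splits)
  qed
  have Qfh: "?Q f h0 \<noteq> 0"
    using nondegenerate_polar[OF nd f0 fsub, of h0] zero[OF fK h0K] h0f by blast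
  define \<kappa> where "\<kappa> = - (?Q h0 h0) / (2 * ?Q f h0)"
  have \<kappa>: "2 * \<kappa> * ?Q f h0 = - ?Q h0 h0" using Qfh by (simp add: \<kappa>_def)
  define h where "h = h0 + \<kappa> *s f"
  have hK: "h \<in> eigencovectors m v \<mu>" unfolding h_def by (intro eigencovectors_linear fK h0K)
  have "?Q h h = 0"
    using \<open>?Q f f = 0\<close> \<kappa> unfolding h_def
    by (simp add: pl(5-8) pl(9)[of h0 f] mult.assoc)
  then have hsub: "sub_covector m h" using zero[OF hK hK] by (simp add: sub_covector_polar)
  have hf: "h \<noteq> c *s f" for c
  proof
    assume "h = c *s f"
    then have "h0 = (c - \<kappa>) *s f" by (simp add: h_def vec_eq_iff algebra_simps eq_diff_eq)
    then show False using h0f by blast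
  qed
  obtain i c where i: "f = c *s F i" using Fall[OF fsub] by blast
  obtain j d where j: "h = d *s F j" using Fall[OF hsub] by blast
  have c0: "c \<noteq> 0" using i f0 by auto
  have d0: "d \<noteq> 0" using j hf[of 0] by auto
  have "F i = (1 / c) *s f" "F j = (1 / d) *s h" using i j c0 d0 by simp_all
  then have "F i \<in> eigencovectors m v \<mu>" "F j \<in> eigencovectors m v \<mu>"
    using eigencovectors_linear(2) fK hK by simp_all
  moreover have "i \<noteq> j"
  proof
    assume "i = j"
    then have "h = (d / c) *s f" using i j c0 by simp
    then show False using hf by blast
  qed
  ultimately show ?thesis using that by blast
qed

text \<open>A relation, since a pair determines \<open>v\<close> and \<open>\<mu>\<close> only up to
  a common factor. It becomes a bijection between fans and two-element subsets of five indices,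
  which gives the number ten.\<close>

definition fan_of_pair where
  "fan_of_pair fan P \<longleftrightarrow> (\<exists>v \<mu> i j. v \<noteq> 0 \<and> i \<noteq> j \<and> F i \<in> eigencovectors m v \<mu> \<and> F j \<in> eigencovectors m v \<mu> \<and>
     fan = (vec.span {v}, eigenspace m v \<mu>) \<and> P = {i, j})"

lemma scaled_eigen:
  assumes "c \<noteq> 0"
  shows "eigencovectors m (c *s v) (c * \<mu>) = eigencovectors m v \<mu>"
    "eigenspace m (c *s v) (c * \<mu>) = eigenspace m v \<mu>" "vec.span {c *s v} = vec.span {v}"
proof -
  show "eigencovectors m (c *s v) (c * \<mu>) = eigencovectors m v \<mu>"
    using assms by (simp add: eigencovectors_def alternating_bilinear[OF alt])
  have "c *s m v w = (c * \<mu>) *s w + (k * c) *s v \<longleftrightarrow> m v w = \<mu> *s w + k *s v" for k w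
  proof -
    have "(c * \<mu>) *s w + (k * c) *s v = c *s (\<mu> *s w + k *s v)" by (simp add: vec_eq_iff algebra_simps)
    then show ?thesis using assms by (simp only: vec.scale_cancel_left simp_thms)
  qed
  then show "eigenspace m (c *s v) (c * \<mu>) = eigenspace m v \<mu>"
    by (simp add: eigenspace_def alternating_bilinear[OF alt])
  show "vec.span {c *s v} = vec.span {v}"
  proof -
    have "(1 / c) *s (c *s v) \<in> vec.span {c *s v}" by (intro vec.span_scale vec.span_base) simp
    then have "v \<in> vec.span {c *s v}" using assms by simp
    moreover have "c *s v \<in> vec.span {v}" by (intro vec.span_scale vec.span_base) simp
    ultimately show ?thesis by (simp add: vec.span_eq)
  qed
qed

lemma fan_unique:
  assumes "fan_of_pair fan P" "fan_of_pair fan' P"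
  shows "fan = fan'"
proof -
  obtain v \<mu> i j where 1: "v \<noteq> 0" "i \<noteq> j" "F i \<in> eigencovectors m v \<mu>" "F j \<in> eigencovectors m v \<mu>"
     "fan = (vec.span {v}, eigenspace m v \<mu>)" "P = {i, j}"
    using assms(1) unfolding fan_of_pair_def by blast
  obtain v' \<mu>' i' j' where 2: "v' \<noteq> 0" "i' \<noteq> j'" "F i' \<in> eigencovectors m v' \<mu>'" "F j' \<in> eigencovectors m v' \<mu>'"
     "fan' = (vec.span {v'}, eigenspace m v' \<mu>')" "P = {i', j'}"
    using assms(2) unfolding fan_of_pair_def by blast
  have "F i \<in> eigencovectors m v' \<mu>'" "F j \<in> eigencovectors m v' \<mu>'"
    using 1(6) 2(3,4,6) by (auto simp: doubleton_eq_iff)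
  then obtain c where c: "v' = c *s v" "\<mu>' = c * \<mu>"
    using eigencovector_unique[OF 1(2,1,3,4)] by blast
  then have "c \<noteq> 0" using 2(1) by auto
  then show ?thesis using 1(5) 2(5) c scaled_eigen by simp
qed

text \<open>Equality of the lines gives \<open>v' = c *s v\<close>, and a vector of the eigenspace
  outside the line then forces \<open>\<mu>' = c * \<mu>\<close>. So all four covectors are
  eigencovectors for the same data, and three of them cannot be distinct.\<close>

lemma pair_unique:
  assumes "fan_of_pair fan P" "fan_of_pair fan P'"
  shows "P = P'"
proof -
  obtain v \<mu> i j where 1: "v \<noteq> 0" "i \<noteq> j" "F i \<in> eigencovectors m v \<mu>" "F j \<in> eigencovectors m v \<mu>"
     "fan = (vec.span {v}, eigenspace m v \<mu>)" "P = {i, j}"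
    using assms(1) unfolding fan_of_pair_def by blast
  obtain v' \<mu>' i' j' where 2: "v' \<noteq> 0" "i' \<noteq> j'" "F i' \<in> eigencovectors m v' \<mu>'" "F j' \<in> eigencovectors m v' \<mu>'"
     "fan = (vec.span {v'}, eigenspace m v' \<mu>')" "P' = {i', j'}"
    using assms(2) unfolding fan_of_pair_def by blast
  have "v' \<in> vec.span {v}" using 1(5) 2(5) vec.span_base[of v' "{v'}"] by simp
  then obtain c where c: "v' = c *s v" by (auto simp: vec.span_singleton)
  have "vec.dim (eigenspace m v \<mu>) = 3"
    using fan_of_eigencovectors[OF 1(1-4)] by (simp add: alg_fans_def)
  then have "\<not> eigenspace m v \<mu> \<subseteq> vec.span {v}"
    using vec.dim_le_card[of "eigenspace m v \<mu>" "{v}"] by auto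
  then obtain w where w: "w \<in> eigenspace m v \<mu>" "w \<notin> vec.span {v}" by blast
  obtain a where a: "m v w = \<mu> *s w + a *s v" using w(1) by (auto simp: eigenspace_def)
  have "w \<in> eigenspace m v' \<mu>'" using w(1) 1(5) 2(5) by simp
  then obtain b where b: "m v' w = \<mu>' *s w + b *s v'" by (auto simp: eigenspace_def)
  have e: "(\<mu>' - c * \<mu>) *s w = (c * a - b * c) *s v"
    using a b by (simp add: c alternating_bilinear[OF alt] vec_eq_iff algebra_simps)
  have \<mu>: "\<mu>' = c * \<mu>"
  proof (rule ccontr)
    assume "\<mu>' \<noteq> c * \<mu>"
    then have "w = ((c * a - b * c) / (\<mu>' - c * \<mu>)) *s v"
      using e by (simp add: vec_eq_iff field_simps)
    then show False using w(2) by (auto simp: vec.span_singleton)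
  qed
  have "c \<noteq> 0" using c 2(1) by auto
  then have e': "F i' \<in> eigencovectors m v \<mu>" "F j' \<in> eigencovectors m v \<mu>"
    using 2(3,4) scaled_eigen(1) by (simp_all add: c \<mu>)
  have "i' = i \<or> i' = j" using eigencovectors_no_three[OF 1(1,2) _ _ 1(3,4) e'(1)] by blast
  moreover have "j' = i \<or> j' = j" using eigencovectors_no_three[OF 1(1,2) _ _ 1(3,4) e'(2)] by blast
  ultimately show ?thesis using 1(6) 2(2,6) 1(2) by auto
qed

theorem card_fans: "card (alg_fans m) = 10"
proof -
  let ?Ps = "{P :: 4 option set. P \<subseteq> UNIV \<and> card P = 2}"
  have 1: "\<exists>P\<in>?Ps. fan_of_pair fan P" if f: "fan \<in> alg_fans m" for fan
  proof -
    obtain V1 V3 where "fan = (V1, V3)" by (cases fan)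
    then have "(V1, V3) \<in> alg_fans m" using f by simp
    then obtain v \<mu> where v: "v \<noteq> 0" "V1 = vec.span {v}" "V3 = eigenspace m v \<mu>"
      using fan_eigenspace by blast
    then have v': "(vec.span {v}, eigenspace m v \<mu>) \<in> alg_fans m" "fan = (vec.span {v}, eigenspace m v \<mu>)"
      using \<open>(V1, V3) \<in> alg_fans m\<close> \<open>fan = (V1, V3)\<close> by auto
    then obtain i j where "i \<noteq> j" "F i \<in> eigencovectors m v \<mu>" "F j \<in> eigencovectors m v \<mu>"
      using fan_eigencovectors v(1) by blast
    then have "fan_of_pair fan {i, j}" "{i, j} \<in> ?Ps" using v(1) v'(2) by (auto simp: fan_of_pair_def)
    then show ?thesis by blast
  qed
  have 2: "\<exists>fan\<in>alg_fans m. fan_of_pair fan P" if P: "P \<in> ?Ps" for P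
  proof -
    obtain i j where ij: "P = {i, j}" "i \<noteq> j" using P by (auto simp: card_2_iff)
    obtain v \<mu> where v: "v \<noteq> 0" "F i \<in> eigencovectors m v \<mu>" "F j \<in> eigencovectors m v \<mu>"
      using common_eigencovector[OF alt F0 Fsub F0 Fsub] by blast
    then have "fan_of_pair (vec.span {v}, eigenspace m v \<mu>) P" using ij by (auto simp: fan_of_pair_def)
    then show ?thesis using fan_of_eigencovectors[OF v(1) ij(2) v(2,3)] by blast
  qed
  define \<phi> where "\<phi> fan = (SOME P. P \<in> ?Ps \<and> fan_of_pair fan P)" for fan
  define \<psi> where "\<psi> P = (SOME fan. fan \<in> alg_fans m \<and> fan_of_pair fan P)" for P
  have \<phi>: "\<phi> fan \<in> ?Ps \<and> fan_of_pair fan (\<phi> fan)" if f: "fan \<in> alg_fans m" for fan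
    unfolding \<phi>_def by (rule someI_ex) (use 1[OF f] in blast)
  have \<psi>: "\<psi> P \<in> alg_fans m \<and> fan_of_pair (\<psi> P) P" if P: "P \<in> ?Ps" for P
    unfolding \<psi>_def by (rule someI_ex) (use 2[OF P] in blast)
  have "bij_betw \<phi> (alg_fans m) ?Ps"
  proof (rule bij_betw_byWitness[where f' = \<psi>])
    show "\<forall>fan\<in>alg_fans m. \<psi> (\<phi> fan) = fan"
      using \<phi> \<psi> fan_unique by blast
    show "\<forall>P\<in>?Ps. \<phi> (\<psi> P) = P"
      using \<phi> \<psi> pair_unique by blast
  qed (use \<phi> \<psi> in blast)+
  then have "card (alg_fans m) = card ?Ps" by (rule bij_betw_same_card)
  also have "\<dots> = CARD(4 option) choose 2" by (rule n_subsets) simp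
  also have "\<dots> = 10" by (simp add: choose_two)
  finally show ?thesis .
qed

end

theorem ten_fans:
  assumes alt: "alternating m" and nd: "nondegenerate m"
  shows "card (alg_fans m) = 10"
proof -
  obtain F :: "4 option \<Rightarrow> complex^4" where F:
    "\<And>i. F i \<noteq> 0" "\<And>i. sub_covector m (F i)" "\<And>i j c. i \<noteq> j \<Longrightarrow> F i \<noteq> c *s F j"
    "\<And>h. sub_covector m h \<Longrightarrow> \<exists>i c. h = c *s F i"
    using five_sub_covectors[OF alt nd] by blast
  interpret five_sub_covector_algebra m F by unfold_locales (fact alt nd F)+
  show ?thesis by (rule card_fans)
qed

section \<open>Multihomogeneous maps\<close>

lemma multihomogeneous_coordinate: "multihomogeneous (\<lambda>j. if j = i then 1 else 0) (\<lambda>x. x $ i $ k)"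
proof -
  have "(\<lambda>x. x $ i $ k) \<in> polynomial_functions (\<lambda>c x. \<chi> i. c *s x $ i) UNIV"
    by (rule polynomial_functions.linear) (simp add: linear_functional_def)
  moreover have "(\<Prod>j\<in>UNIV. t j ^ (if j = i then 1 else 0)) = t i" for t :: "'a \<Rightarrow> complex"
  proof -
    have "(\<Prod>j\<in>UNIV. t j ^ (if j = i then 1 else 0)) = (\<Prod>j\<in>UNIV. if j = i then t j else 1)"
      by (rule prod.cong) auto
    then show ?thesis by simp
  qed
  ultimately show ?thesis by (simp add: multihomogeneous_def)
qed

lemma multihomogeneous_mult:
  assumes "multihomogeneous d p" "multihomogeneous e q"
  shows "multihomogeneous (d + e) (\<lambda>x. p x * q x)"
  using assms
  by (auto simp: multihomogeneous_def polynomial_functions.mult plus_fun_def power_add prod.distrib)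

lemma multihomogeneous_add:
  assumes "multihomogeneous d p" "multihomogeneous d q"
  shows "multihomogeneous d (\<lambda>x. p x + q x)"
  using assms
  by (auto simp: multihomogeneous_def polynomial_functions.add algebra_simps)

lemma multihomogeneous_const_mult:
  assumes "multihomogeneous d p"
  shows "multihomogeneous d (\<lambda>x. c * p x)"
  using assms
  by (auto simp: multihomogeneous_def intro: polynomial_functions.mult polynomial_functions.const)

lemma multihomogeneous_uminus:
  assumes "multihomogeneous d p"
  shows "multihomogeneous d (\<lambda>x. - p x)"
  using multihomogeneous_const_mult[OF assms, of "- 1"] by simp

lemma multihomogeneous_diff:
  assumes "multihomogeneous d p" "multihomogeneous d q"
  shows "multihomogeneous d (\<lambda>x. p x - q x)"
  using multihomogeneous_add[OF assms(1) multihomogeneous_uminus[OF assms(2)]] by simp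

lemma multihomogeneous_zero: "multihomogeneous d (\<lambda>_. 0)"
  by (simp add: multihomogeneous_def polynomial_functions.const)

lemma multihomogeneous_sum:
  assumes "\<And>a. a \<in> A \<Longrightarrow> multihomogeneous d (p a)"
  shows "multihomogeneous d (\<lambda>x. \<Sum>a\<in>A. p a x)"
  using assms by (induction A rule: infinite_finite_induct)
    (auto intro: multihomogeneous_zero multihomogeneous_add)

definition vhom :: "('i \<Rightarrow> nat) \<Rightarrow> (complex^'n::finite^'i::finite \<Rightarrow> complex^'m::finite) \<Rightarrow> bool" where
  "vhom d F \<longleftrightarrow> (\<forall>k. multihomogeneous d (\<lambda>x. F x $ k))"

lemma vhom_coordinate: "vhom (\<lambda>j. if j = i then 1 else 0) (\<lambda>x. x $ i)"
  by (simp add: vhom_def multihomogeneous_coordinate)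

lemma vhom_scale: "multihomogeneous d p \<Longrightarrow> vhom e F \<Longrightarrow> vhom (d + e) (\<lambda>x. p x *s F x)"
  by (simp add: vhom_def multihomogeneous_mult)

lemma vhom_add: "vhom d F \<Longrightarrow> vhom d G \<Longrightarrow> vhom d (\<lambda>x. F x + G x)"
  by (simp add: vhom_def multihomogeneous_add)

lemma vhom_diff: "vhom d F \<Longrightarrow> vhom d G \<Longrightarrow> vhom d (\<lambda>x. F x - G x)"
  by (simp add: vhom_def multihomogeneous_diff)

lemma vhom_matrix: "vhom d F \<Longrightarrow> vhom d (\<lambda>x. M *v F x)"
  by (simp add: vhom_def matrix_vector_mult_def multihomogeneous_sum multihomogeneous_const_mult)

lemma vhom_cdot: "vhom d F \<Longrightarrow> vhom e G \<Longrightarrow> multihomogeneous (d + e) (\<lambda>x. F x \<cdot> G x)"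
  by (simp add: vhom_def cdot_def multihomogeneous_sum multihomogeneous_mult)

lemma vhom_cdot_const: "vhom d F \<Longrightarrow> multihomogeneous d (\<lambda>x. c \<cdot> F x)"
  by (simp add: vhom_def cdot_def multihomogeneous_sum multihomogeneous_const_mult)

lemma vhom_scale_const: "multihomogeneous d p \<Longrightarrow> vhom d (\<lambda>x. p x *s c)"
  using multihomogeneous_const_mult[of d p "c $ _"] by (simp add: vhom_def mult.commute)

lemma vhom_ccross: "vhom d F \<Longrightarrow> vhom e G \<Longrightarrow> vhom (d + e) (\<lambda>x. ccross (F x) (G x))"
  by (simp add: vhom_def forall_3 multihomogeneous_diff multihomogeneous_mult)

lemma vhom_ccross_const: "vhom d F \<Longrightarrow> vhom d (\<lambda>x. ccross (F x) c)"
  by (simp add: vhom_def forall_3 multihomogeneous_diff multihomogeneous_const_mult mult.commute[of _ "c $ _"])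

section \<open>Planes and Pluecker vectors\<close>

definition pair :: "4 \<Rightarrow> 4 \<Rightarrow> 2 \<Rightarrow> 4" where
  "pair i j = (\<lambda>a. if a = 1 then i else j)"

lemma pair_eta: "pair (s 1) (s 2) = s"
  unfolding pair_def fun_eq_iff using exhaust_2 by metis

lemma pair_nth [simp]: "pair i j 1 = i" "pair i j 2 = j"
  by (simp_all add: pair_def)

lemma plucker_pair: "plucker B $ pair i j = B $ i $ 1 * B $ j $ 2 - B $ i $ 2 * B $ j $ 1"
  by (simp add: plucker_def det_2)

lemma eq_pair: "w = w' \<longleftrightarrow> (\<forall>i j. w $ pair i j = w' $ pair i j)" for w w' :: "complex^(2 \<Rightarrow> 4)"
  unfolding vec_eq_iff by (metis pair_eta)

definition antisymmetric :: "complex^(2 \<Rightarrow> 4) \<Rightarrow> bool" where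
  "antisymmetric w \<longleftrightarrow> (\<forall>i j. w $ pair i j + w $ pair j i = 0)"

text \<open>The classical line coordinates: in the affine chart of the fourth coordinate, the halves
  \<open>wdir\<close> and \<open>wmom\<close> are the direction and the moment of the projective
  line. The index pair 3, 1 gives the cyclic sign of the cross product.\<close>

definition wdir :: "complex^(2 \<Rightarrow> 4) \<Rightarrow> complex^3" where
  "wdir w = vector [w $ pair 1 4, w $ pair 2 4, w $ pair 3 4]"

definition wmom :: "complex^(2 \<Rightarrow> 4) \<Rightarrow> complex^3" where
  "wmom w = vector [w $ pair 2 3, w $ pair 3 1, w $ pair 1 2]"

definition bivector :: "complex^3 \<Rightarrow> complex^3 \<Rightarrow> complex^(2 \<Rightarrow> 4)" where
  "bivector x n = (\<chi> s. (vector [vector [0, n $ 3, - n $ 2, x $ 1], vector [- n $ 3, 0, n $ 1, x $ 2],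
     vector [n $ 2, - n $ 1, 0, x $ 3], vector [- x $ 1, - x $ 2, - x $ 3, 0]] :: complex^4^4) $ s 1 $ s 2)"

lemma wdir_nth [simp]: "wdir w $ 1 = w $ pair 1 4" "wdir w $ 2 = w $ pair 2 4" "wdir w $ 3 = w $ pair 3 4"
  by (simp_all add: wdir_def)

lemma wmom_nth [simp]: "wmom w $ 1 = w $ pair 2 3" "wmom w $ 2 = w $ pair 3 1" "wmom w $ 3 = w $ pair 1 2"
  by (simp_all add: wmom_def)

lemma wdir_bivector [simp]: "wdir (bivector x n) = x"
  by (simp add: vec_eq_iff forall_3 bivector_def)

lemma wmom_bivector [simp]: "wmom (bivector x n) = n"
  by (simp add: vec_eq_iff forall_3 bivector_def)

lemma antisymmetric_bivector: "antisymmetric (bivector x n)"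
  by (simp add: antisymmetric_def bivector_def forall_4)

lemma bivector_eta: assumes "antisymmetric w" shows "bivector (wdir w) (wmom w) = w"
proof -
  have a: "w $ pair j i = - w $ pair i j" for i j
    using assms by (simp add: antisymmetric_def eq_neg_iff_add_eq_0)
  have d: "w $ pair i i = 0" for i using a[of i i] by simp
  show ?thesis
    unfolding eq_pair forall_4
    by (simp add: bivector_def d a[of 2 1] a[of 1 3] a[of 3 2] a[of 4 1] a[of 4 2] a[of 4 3])
qed

lemma bivector_scale: "bivector (c *s x) (c *s n) = c *s bivector x n"
  unfolding eq_pair forall_4 by (simp add: bivector_def)

lemma antisymmetric_plucker: "antisymmetric (plucker B)"
  by (simp add: antisymmetric_def plucker_pair)

lemma plucker_columns:
  "wdir (plucker B) = direction (column 1 B) (column 2 B)" "wmom (plucker B) = moment (column 1 B) (column 2 B)"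
  by (simp_all add: vec_eq_iff forall_3 direction_def moment_def plucker_pair column_def algebra_simps)

definition exterior_square :: "complex^4^4 \<Rightarrow> complex^(2 \<Rightarrow> 4) \<Rightarrow> complex^(2 \<Rightarrow> 4)" where
  "exterior_square g w = (\<chi> s. \<Sum>i\<in>UNIV. \<Sum>j\<in>UNIV. g $ s 1 $ i * g $ s 2 $ j * w $ pair i j)"

lemma exterior_square_pair: "exterior_square g w $ pair k l = (\<Sum>i\<in>UNIV. \<Sum>j\<in>UNIV. g $ k $ i * g $ l $ j * w $ pair i j)"
  by (simp add: exterior_square_def)

lemma exterior_square_plucker: "exterior_square g (plucker B) = plucker (g ** B)"
proof -
  have p: "(\<Sum>i\<in>UNIV. f i) * (\<Sum>j\<in>UNIV. h j) = (\<Sum>i\<in>UNIV. \<Sum>j\<in>UNIV. f i * h j)" for f h :: "4 \<Rightarrow> complex"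
    by (rule sum_product)
  show ?thesis
    unfolding eq_pair exterior_square_pair plucker_pair matrix_matrix_mult_def vec_lambda_beta p sum_subtractf[symmetric]
    by (intro allI sum.cong refl) (simp add: algebra_simps)
qed

lemma exterior_square_scale: "exterior_square g (c *s w) = c *s exterior_square g w"
  by (simp add: eq_pair exterior_square_pair sum_distrib_left mult_ac)

text \<open>For the matrix of coordinates the action is a congruence, so compatibility with products
  of matrices reduces to associativity.\<close>

lemma exterior_square_matrix: "(\<chi> i j. exterior_square g w $ pair i j) = g ** (\<chi> i j. w $ pair i j) ** transpose g"
  by (simp add: vec_eq_iff exterior_square_pair matrix_matrix_mult_def transpose_def sum_distrib_left sum_distrib_right mult_ac)
    (intro allI sum.swap)

lemma exterior_square_mult: "exterior_square g (exterior_square h w) = exterior_square (g ** h) w"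
proof -
  have "(\<chi> i j. exterior_square g (exterior_square h w) $ pair i j) = (\<chi> i j. exterior_square (g ** h) w $ pair i j)"
    by (simp only: exterior_square_matrix matrix_transpose_mul matrix_mul_assoc)
  then show ?thesis by (simp add: eq_pair vec_eq_iff)
qed

lemma exterior_square_one: "exterior_square (mat 1) w = w"
proof -
  have "(\<chi> i j. exterior_square (mat 1) w $ pair i j) = (\<chi> i j. w $ pair i j)"
    by (simp only: exterior_square_matrix transpose_mat matrix_mul_lid matrix_mul_rid)
  then show ?thesis by (simp add: eq_pair vec_eq_iff)
qed

lemma exterior_square_inverse:
  assumes "invertible g" shows "exterior_square (matrix_inv g) (exterior_square g w) = w" "exterior_square g (exterior_square (matrix_inv g) w) = w"
  by (simp_all add: exterior_square_mult matrix_inv_mult[OF assms] exterior_square_one)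

lemma vhom_exterior_square: assumes "vhom d F" shows "vhom d (\<lambda>x. exterior_square g (F x))"
  using assms by (simp add: vhom_def exterior_square_def multihomogeneous_sum multihomogeneous_const_mult mult.assoc)

lemma vhom_wdir: "vhom d F \<Longrightarrow> vhom d (\<lambda>x. wdir (F x))"
  by (simp add: vhom_def forall_3)

lemma vhom_wmom: "vhom d F \<Longrightarrow> vhom d (\<lambda>x. wmom (F x))"
  by (simp add: vhom_def forall_3)

lemma vhom_bivector: assumes "vhom d F" "vhom d G" shows "vhom d (\<lambda>x. bivector (F x) (G x))"
proof -
  have "\<forall>i j. multihomogeneous d (\<lambda>x. bivector (F x) (G x) $ pair i j)"
    using assms unfolding forall_4
    by (simp add: vhom_def bivector_def multihomogeneous_zero multihomogeneous_uminus)
  then have "multihomogeneous d (\<lambda>x. bivector (F x) (G x) $ pair (k 1) (k 2))" for k :: "2 \<Rightarrow> 4"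
    by blast
  then show ?thesis by (simp only: vhom_def pair_eta simp_thms)
qed

lemma exterior_square_nonzero:
  assumes g: "invertible g" and w: "w \<noteq> 0"
  shows "exterior_square g w \<noteq> 0"
proof
  assume "exterior_square g w = 0"
  moreover have "exterior_square (matrix_inv g) 0 = 0" using exterior_square_scale[of "matrix_inv g" 0 0] by simp
  ultimately show False using exterior_square_inverse(1)[OF g, of w] w by simp
qed

lemma ccross_solve:
  assumes "x \<noteq> 0" "x \<cdot> n = 0"
  obtains y where "ccross x y = n"
proof -
  obtain q where "x \<cdot> q = 1" using nonzero_cdot[OF assms(1)] by blast
  \<comment> \<open>By the triple product formula, \<open>ccross n q\<close> is a solution as soon
    as \<open>x \<cdot> q = 1\<close> and \<open>x\<close> is orthogonal to
    \<open>n\<close>.\<close>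
  then have "ccross x (ccross n q) = n" using assms(2) by (simp add: ccross_triple)
  then show ?thesis using that by blast
qed

lemma column_span_iff: "a \<in> column_span B \<longleftrightarrow> (\<exists>\<alpha> \<beta>. a = \<alpha> *s column 1 B + \<beta> *s column 2 B)"
  for B :: "complex^2^4"
proof -
  have e: "B *v y = y $ 1 *s column 1 B + y $ 2 *s column 2 B" for y
    by (simp add: matrix_mult_sum sum_2)
  show ?thesis
  proof
    assume "a \<in> column_span B"
    then show "\<exists>\<alpha> \<beta>. a = \<alpha> *s column 1 B + \<beta> *s column 2 B" using e by (auto simp: column_span_def)
  next
    assume "\<exists>\<alpha> \<beta>. a = \<alpha> *s column 1 B + \<beta> *s column 2 B"
    then obtain \<alpha> \<beta> where "a = \<alpha> *s column 1 B + \<beta> *s column 2 B" by blast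
    then have "a = B *v vector [\<alpha>, \<beta>]" by (simp add: e)
    then show "a \<in> column_span B" by (auto simp: column_span_def)
  qed
qed

lemma column_span_span: "column_span B = vec.span {column 1 B, column 2 B}" for B :: "complex^2^4"
proof (intro set_eqI iffI)
  fix a assume "a \<in> column_span B"
  then obtain \<alpha> \<beta> where a: "a = \<alpha> *s column 1 B + \<beta> *s column 2 B" by (auto simp: column_span_iff)
  show "a \<in> vec.span {column 1 B, column 2 B}"
    unfolding a by (intro vec.span_add vec.span_scale vec.span_base) simp_all
next
  fix a assume "a \<in> vec.span {column 1 B, column 2 B}"
  then show "a \<in> column_span B"
    unfolding column_span_iff by (force simp: vec.span_insert vec.span_singleton algebra_simps)
qed

lemma plucker_nonzero_iff: "plucker B \<noteq> 0 \<longleftrightarrow> vec.dim (column_span B) = 2" for B :: "complex^2^4"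
proof
  assume w: "plucker B \<noteq> 0"
  then obtain i j where ij: "plucker B $ pair i j \<noteq> 0" using eq_pair[of "plucker B" 0] by auto
  have "column 1 B \<noteq> 0"
  proof
    assume "column 1 B = 0"
    then have "B $ k $ 1 = 0" for k by (simp add: column_def vec_eq_iff)
    then show False using ij by (simp add: plucker_pair)
  qed
  moreover have "\<nexists>c. column 2 B = c *s column 1 B"
  proof
    assume "\<exists>c. column 2 B = c *s column 1 B"
    then obtain c where "\<And>k. B $ k $ 2 = c * B $ k $ 1" by (auto simp: column_def vec_eq_iff)
    then show False using ij by (simp add: plucker_pair)
  qed
  ultimately have "vec.independent {column 1 B, column 2 B}" "column 1 B \<noteq> column 2 B"
    using pair_independent by blast+
  then show "vec.dim (column_span B) = 2"
    by (simp add: column_span_span vec.dim_eq_card_independent)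
next
  assume d: "vec.dim (column_span B) = 2"
  show "plucker B \<noteq> 0"
  proof
    assume "plucker B = 0"
    then have z: "B $ i $ 1 * B $ j $ 2 = B $ i $ 2 * B $ j $ 1" for i j
      using plucker_pair[of B i j] by simp
    have "\<exists>c. {column 1 B, column 2 B} \<subseteq> vec.span {c}"
    proof (cases "column 1 B = 0")
      case True
      then show ?thesis by (intro exI[of _ "column 2 B"]) (auto simp: vec.span_zero vec.span_base)
    next
      case False
      then obtain i where i: "B $ i $ 1 \<noteq> 0" by (auto simp: column_def vec_eq_iff)
      have "column 2 B = (B $ i $ 2 / B $ i $ 1) *s column 1 B"
        using i z[of i] by (simp add: column_def vec_eq_iff field_simps)
      then have "column 2 B \<in> vec.span {column 1 B}" by (metis vec.span_base vec.span_scale singletonI)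
      then show ?thesis by (intro exI[of _ "column 1 B"]) (auto simp: vec.span_base)
    qed
    then obtain c where "{column 1 B, column 2 B} \<subseteq> vec.span {c}" by blast
    then have "vec.dim {column 1 B, column 2 B} \<le> card {c}" by (rule vec.dim_le_card) simp
    then show False using d by (simp add: column_span_span)
  qed
qed

lemma mem_column_span:
  fixes B :: "complex^2^4"
  defines "w \<equiv> plucker B"
  assumes w: "w \<noteq> 0"
  shows "a \<in> column_span B \<longleftrightarrow> head a \<cdot> wmom w = 0 \<and> ccross (head a) (wdir w) + a $ 4 *s wmom w = 0"
proof
  assume "a \<in> column_span B"
  then obtain \<alpha> \<beta> where a: "a = \<alpha> *s column 1 B + \<beta> *s column 2 B" by (auto simp: column_span_iff)
  show "head a \<cdot> wmom w = 0 \<and> ccross (head a) (wdir w) + a $ 4 *s wmom w = 0"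
    unfolding w_def plucker_columns a
    by (simp add: cdot_3 vec_eq_iff forall_3 moment_def direction_def algebra_simps)
next
  assume h: "head a \<cdot> wmom w = 0 \<and> ccross (head a) (wdir w) + a $ 4 *s wmom w = 0"
  \<comment> \<open>\<open>T i j k\<close> are the components of the exterior product of
    \<open>a\<close> with \<open>w\<close>; the hypothesis consists of the four with distinct
    indices.\<close>
  define T where "T i j k = a $ i * w $ pair j k + a $ j * w $ pair k i + a $ k * w $ pair i j" for i j k
  have s: "w $ pair j i = - w $ pair i j" for i j
    by (simp add: w_def plucker_pair)
  have d: "w $ pair i i = 0" for i by (simp add: w_def plucker_pair)
  have cyc: "T i j k = T j k i" for i j k by (simp add: T_def)
  have swap: "T j i k = - T i j k" for i j k
    unfolding T_def s[of i j] s[of k i] s[of k j] by simp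
  have perm: "T i j k = 0 \<Longrightarrow> T j k i = 0 \<and> T k i j = 0 \<and> T j i k = 0 \<and> T i k j = 0 \<and> T k j i = 0" for i j k
    using cyc[of i j k] cyc[of j k i] swap[of i j k] swap[of j k i] swap[of k i j] by simp
  have rep: "T i i k = 0" "T i k i = 0" "T k i i = 0" for i k
    by (simp_all add: T_def d s[of k i])
  have zero: "T 1 2 3 = 0" "T 1 2 4 = 0" "T 1 3 4 = 0" "T 2 3 4 = 0"
    using h by (simp_all add: T_def vec_eq_iff forall_3 cdot_3 s[of 4 1] s[of 4 2] s[of 4 3] s[of 1 3] algebra_simps)
  have "\<forall>i j k. T i j k = 0"
    unfolding forall_4 using zero[THEN perm] zero by (simp add: rep)
  then have T0: "T i j k = 0" for i j k by blast
  obtain i j where ij: "w $ pair i j \<noteq> 0" using eq_pair[of w 0] w by auto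
  \<comment> \<open>Cramer's rule in the rows \<open>i\<close> and \<open>j\<close>, where the minor
    is nonzero; row \<open>k\<close> follows from \<open>T i j k = 0\<close>.\<close>
  have "a $ k = ((a $ i * B $ j $ 2 - a $ j * B $ i $ 2) / w $ pair i j) * B $ k $ 1
      + ((B $ i $ 1 * a $ j - B $ j $ 1 * a $ i) / w $ pair i j) * B $ k $ 2" for k
  proof -
    have "a $ k * w $ pair i j = (a $ i * B $ j $ 2 - a $ j * B $ i $ 2) * B $ k $ 1
      + (B $ i $ 1 * a $ j - B $ j $ 1 * a $ i) * B $ k $ 2"
      using T0[of i j k] unfolding T_def w_def plucker_pair by algebra
    then have "a $ k = ((a $ i * B $ j $ 2 - a $ j * B $ i $ 2) * B $ k $ 1
      + (B $ i $ 1 * a $ j - B $ j $ 1 * a $ i) * B $ k $ 2) / w $ pair i j"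
      by (simp only: nonzero_eq_divide_eq[OF ij])
    then show ?thesis by (simp add: add_divide_distrib)
  qed
  note ak = this
  have "a = ((a $ i * B $ j $ 2 - a $ j * B $ i $ 2) / w $ pair i j) *s column 1 B
      + ((B $ i $ 1 * a $ j - B $ j $ 1 * a $ i) / w $ pair i j) *s column 2 B" (is "a = ?r")
  proof -
    have "a $ k = ?r $ k" for k
      by (subst ak) (simp add: column_def)
    then show ?thesis by (rule vec_eq_iff[THEN iffD2, OF allI])
  qed
  then show "a \<in> column_span B" unfolding column_span_iff by blast
qed

text \<open>Another basis of the plane differs by a square matrix \<open>C\<close>, which multiplies
  all minors by \<open>det C\<close>.\<close>

lemma plucker_line_column_span:
  fixes B :: "complex^2^4"
  shows "(plucker_line (column_span B) :: (complex^(2 \<Rightarrow> 4)) set) = vec.span {plucker B}"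
proof -
  have "plucker B' \<in> vec.span {plucker B}" if B': "column_span B' = column_span B" for B' :: "complex^2^4"
  proof -
    have "\<exists>c. B' *v axis j 1 = B *v c" for j
    proof -
      have "B' *v axis j 1 \<in> column_span B'" by (simp add: column_span_def)
      then show ?thesis unfolding B' by (auto simp: column_span_def)
    qed
    then obtain c where c: "\<And>j. B' *v axis j 1 = B *v c j" by metis
    define C :: "complex^2^2" where "C = (\<chi> i j. c j $ i)"
    have "B' $ i $ j = (B *v c j) $ i" for i j
      using arg_cong[OF c[of j], of "\<lambda>v. v $ i"] unfolding matrix_vector_axis by (simp add: column_def)
    then have "B' = B ** C"
      by (simp add: vec_eq_iff C_def matrix_matrix_mult_def matrix_vector_mult_def)
    have "plucker B' = det C *s plucker B"
    proof -
      have e: "(\<chi> i. (B ** C) $ s i) = (\<chi> i. B $ s i) ** C" for s :: "2 \<Rightarrow> 4"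
        by (simp add: vec_eq_iff matrix_matrix_mult_def)
      have "plucker (B ** C) $ s = det C * plucker B $ s" for s
        unfolding plucker_def vec_lambda_beta e det_mul by (rule mult.commute)
      then show ?thesis unfolding \<open>B' = B ** C\<close> by (simp add: vec_eq_iff)
    qed
    then show ?thesis by (auto simp: vec.span_singleton)
  qed
  then show ?thesis
    unfolding plucker_line_def by (subst vec.span_eq) (auto intro: vec.span_base)
qed

lemma exists_column_span:
  assumes "vec.subspace U" "vec.dim U = 2"
  obtains B :: "complex^2^4" where "column_span B = U"
proof (rule vec.basis_exists[of U])
  fix A assume A: "A \<subseteq> U" "vec.independent A" "U \<subseteq> vec.span A" "card A = vec.dim U"
  then obtain a b where ab: "A = {a, b}" using assms(2) by (metis card_2_iff)
  define B :: "complex^2^4" where "B = (\<chi> r c. if c = 1 then a $ r else b $ r)"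
  have "column 1 B = a" "column 2 B = b" by (simp_all add: B_def column_def vec_eq_iff)
  then have "column_span B = U"
    using vec.span_subspace[OF A(1) A(3) assms(1)] ab by (simp add: column_span_span)
  then show thesis using that by blast
qed

text \<open>The condition \<open>x \<cdot> n = 0\<close> is the Klein quadric. If
  \<open>x \<noteq> 0\<close>, a solution \<open>y\<close> of \<open>ccross x y = n\<close> gives
  the basis \<open>join x 0\<close>, \<open>join y 1\<close>; if \<open>x = 0\<close>, the plane
  lies in the hyperplane where the fourth coordinate vanishes.\<close>

lemma exists_plucker:
  assumes "x \<cdot> n = 0" "bivector x n \<noteq> 0"
  obtains B :: "complex^2^4" where "plucker B = bivector x n"
proof -
  have "\<exists>u v. direction u v = x \<and> moment u v = n"
  proof (cases "x = 0")
    case False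
    then obtain y where "ccross x y = n" using ccross_solve assms(1) by blast
    then show ?thesis
      by (intro exI[of _ "join x 0"] exI[of _ "join y 1"]) (simp add: direction_def moment_def)
  next
    case True
    have "\<exists>a. a \<noteq> 0 \<and> a \<cdot> n = 0"
    proof -
      obtain a b where ab: "n \<cdot> a = 0" "n \<cdot> b = 0" "\<And>x y. x *s a + y *s b = 0 \<Longrightarrow> x = 0 \<and> y = 0"
        using two_in_kernel by blast
      have "a \<noteq> 0" using ab(3)[of 1 0] by auto
      then show ?thesis using ab(1) by (auto simp: cdot_commute)
    qed
    then obtain a where a: "a \<noteq> 0" "a \<cdot> n = 0" by blast
    then obtain b where "ccross a b = n" using ccross_solve by blast
    then show ?thesis
      using True by (intro exI[of _ "join a 0"] exI[of _ "join b 0"]) (simp add: direction_def moment_def)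
  qed
  then obtain u v where uv: "direction u v = x" "moment u v = n" by blast
  define B :: "complex^2^4" where "B = (\<chi> r c. if c = 1 then u $ r else v $ r)"
  have "column 1 B = u" "column 2 B = v" by (simp_all add: B_def column_def vec_eq_iff)
  then have "plucker B = bivector x n"
    using bivector_eta[OF antisymmetric_plucker[of B]] uv by (simp add: plucker_columns)
  then show ?thesis using that by blast
qed

lemma column_span_mult: "column_span (g ** B) = (*v) g ` column_span B" for g :: "complex^4^4" and B :: "complex^2^4"
  by (simp add: column_span_def image_image matrix_vector_mul_assoc)

lemma subalgebra_column_span:
  fixes B :: "complex^2^4"
  assumes alt: "alternating m"
  shows "subalgebra m (column_span B) \<longleftrightarrow> m (column 1 B) (column 2 B) \<in> column_span B"
proof
  assume "subalgebra m (column_span B)"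
  then show "m (column 1 B) (column 2 B) \<in> column_span B"
    by (simp add: subalgebra_def column_span_span vec.span_base)
next
  assume e: "m (column 1 B) (column 2 B) \<in> column_span B"
  have sub: "vec.subspace (column_span B)" by (simp add: column_span_span)
  have "m x y \<in> column_span B" if xy: "x \<in> column_span B" "y \<in> column_span B" for x y
  proof -
    obtain a b where x: "x = a *s column 1 B + b *s column 2 B" using xy(1) by (auto simp: column_span_iff)
    obtain c d where y: "y = c *s column 1 B + d *s column 2 B" using xy(2) by (auto simp: column_span_iff)
    have "m x y = (a * d - b * c) *s m (column 1 B) (column 2 B)"
      unfolding x y alternating_bilinear[OF alt] alternating_swap[OF alt, of "column 2 B" "column 1 B"]
      by (simp add: vec_eq_iff algebra_simps)
    then show ?thesis by (simp only: vec.subspace_scale[OF sub e])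
  qed
  then show "subalgebra m (column_span B)" using sub by (simp add: subalgebra_def)
qed

section \<open>The surface of two-dimensional subalgebras\<close>

text \<open>In coordinates in which \<open>x\<^sub>4 = 0\<close> is a subalgebra, a plane with Pluecker vector
  \<open>(x, n)\<close> is a subalgebra iff \<open>z = T n + R x\<close> is parallel to \<open>x\<close> and orthogonal to \<open>n\<close>.
  Writing \<open>x = \<kappa> q\<close> and \<open>z = \<alpha> q\<close> embeds the surface into the product of the plane and
  the line, where it is the graph of the pencil of conics.\<close>
locale pencil_surface =
  fixes m :: alg and g :: "complex^4^4" and N R :: "complex^3^3" and \<rho> :: "complex^3" and p :: "4 \<Rightarrow> complex^3"
    and T L P Q :: "complex^3^3"
  assumes g: "invertible g" and gl: "gl_act g m = block_algebra N R \<rho>"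
    and alt: "alternating (block_algebra N R \<rho>)"
    and T_def: "T = N + skew \<rho>" and T: "invertible T" and L_def: "L = matrix_inv T"
    and P_def: "P = sym_part L" and Q_def: "Q = sym_part (L ** R)"
    and tv: "transversal P Q"
    and base: "x \<cdot> (P *v x) = 0 \<and> x \<cdot> (Q *v x) = 0 \<longleftrightarrow> (\<exists>i c. x = c *s p i)"
    and ind: "i \<noteq> j \<Longrightarrow> j \<noteq> l \<Longrightarrow> i \<noteq> l \<Longrightarrow> a *s p i + b *s p j + c *s p l = 0 \<Longrightarrow> a = 0 \<and> b = 0 \<and> c = 0"
begin

section \<open>Equations of the surface\<close>

definition X :: "complex^(2 \<Rightarrow> 4) \<Rightarrow> complex^3" where "X w = wdir (exterior_square g w)"

definition M :: "complex^(2 \<Rightarrow> 4) \<Rightarrow> complex^3" where "M w = wmom (exterior_square g w)"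

definition Z :: "complex^(2 \<Rightarrow> 4) \<Rightarrow> complex^3" where "Z w = T *v M w + R *v X w"

text \<open>For nonzero \<open>w\<close> the first two conditions say that it is the Pluecker vector
  of a plane, the last two that this plane is a subalgebra.\<close>

definition admissible :: "complex^(2 \<Rightarrow> 4) \<Rightarrow> bool" where
  "admissible w \<longleftrightarrow> antisymmetric (exterior_square g w) \<and> X w \<cdot> M w = 0 \<and> ccross (Z w) (X w) = 0 \<and> Z w \<cdot> M w = 0"

lemma TL: "T *v (L *v x) = x" "L *v (T *v x) = x"
  using matrix_inv_vector[OF T] by (simp_all add: L_def)

lemma skew_vector: "skew \<rho> *v x = ccross \<rho> x"
  by (simp add: skew_def vec_eq_iff forall_3 matrix_vector_mult_def sum_3 vector_3)

lemma scale_linear: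
  "X (c *s w) = c *s X w" "M (c *s w) = c *s M w" "Z (c *s w) = c *s Z w"
proof -
  show 1: "X (c *s w) = c *s X w" "M (c *s w) = c *s M w"
    by (simp_all add: X_def M_def exterior_square_scale vec_eq_iff forall_3)
  show "Z (c *s w) = c *s Z w"
    by (simp add: Z_def 1 vec.scale vec.scale_right_distrib)
qed

lemma admissible_scale: "admissible w \<Longrightarrow> admissible (c *s w)"
  by (simp add: admissible_def scale_linear exterior_square_scale ccross_linear)
    (simp add: antisymmetric_def distrib_left[symmetric])

text \<open>Membership of the product in the plane involves \<open>\<rho>\<close> through its fourth
  coordinate. Adding \<open>ccross \<rho> (M w)\<close> to the head absorbs this: the added vector
  is orthogonal to \<open>M w\<close>, and since \<open>X w \<cdot> M w = 0\<close> its cross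
  product with \<open>X w\<close> is \<open>(\<rho> \<cdot> X w) *s M w\<close>. The corrected head
  is \<open>Z w\<close>.\<close>

lemma subalgebra_plucker:
  fixes B :: "complex^2^4"
  assumes w: "plucker B \<noteq> 0" and wB: "plucker B = exterior_square g w"
  shows "subalgebra (block_algebra N R \<rho>) (column_span B) \<longleftrightarrow> admissible w"
proof -
  let ?u = "column 1 B" and ?v = "column 2 B"
  have x: "direction ?u ?v = X w" and n: "moment ?u ?v = M w"
    using plucker_columns[of B] wB by (simp_all add: X_def M_def)
  have xn: "X w \<cdot> M w = 0"
    unfolding x[symmetric] n[symmetric] by (simp add: cdot_3 direction_def moment_def algebra_simps)
  have Zw: "Z w = N *v M w + ccross \<rho> (M w) + R *v X w"
  proof -
    have "T *v M w = N *v M w + ccross \<rho> (M w)"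
      unfolding T_def matrix_vector_mult_add_rdistrib skew_vector by (rule refl)
    then show ?thesis by (simp add: Z_def)
  qed
  have Zn: "Z w \<cdot> M w = (N *v M w + R *v X w) \<cdot> M w"
    unfolding Zw by (simp add: cdot_3 algebra_simps)
  have Zx: "ccross (Z w) (X w) = ccross (N *v M w + R *v X w) (X w) + (\<rho> \<cdot> X w) *s M w"
  proof -
    have "ccross (ccross \<rho> (M w)) (X w) = (\<rho> \<cdot> X w) *s M w - (X w \<cdot> M w) *s \<rho>"
      by (simp add: vec_eq_iff forall_3 cdot_3 algebra_simps)
    then show ?thesis unfolding Zw xn by (simp add: ccross_linear)
  qed
  have "subalgebra (block_algebra N R \<rho>) (column_span B) \<longleftrightarrow> block_algebra N R \<rho> ?u ?v \<in> column_span B"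
    by (rule subalgebra_column_span[OF alt])
  also have "\<dots> \<longleftrightarrow> Z w \<cdot> M w = 0 \<and> ccross (Z w) (X w) = 0"
    unfolding mem_column_span[OF w] Zn Zx
    by (simp add: block_algebra_def x n wB X_def[symmetric] M_def[symmetric])
  also have "\<dots> \<longleftrightarrow> admissible w"
    using xn antisymmetric_plucker[of B] by (auto simp: admissible_def wB)
  finally show ?thesis .
qed

lemma surface_iff:
  "Pt \<in> surface_of_2dim_subalgebras m \<longleftrightarrow> (\<exists>w. w \<noteq> 0 \<and> admissible w \<and> Pt = (\<lambda>_. vec.span {w}))"
proof
  assume "Pt \<in> surface_of_2dim_subalgebras m"
  then obtain U where U: "subalgebra m U" "vec.dim U = 2" "Pt = (\<lambda>_. plucker_line U)"
    by (auto simp: surface_of_2dim_subalgebras_def subalgebras_of_dim_def)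
  then obtain B :: "complex^2^4" where B: "column_span B = U"
    using exists_column_span[of U] by (auto simp: subalgebra_def)
  have w0: "plucker B \<noteq> 0" using U(2) B by (simp add: plucker_nonzero_iff)
  have gw: "plucker (g ** B) = exterior_square g (plucker B)" by (simp add: exterior_square_plucker)
  have "exterior_square g (plucker B) \<noteq> 0" by (rule exterior_square_nonzero[OF g w0])
  moreover have "subalgebra (block_algebra N R \<rho>) (column_span (g ** B))"
    unfolding column_span_mult B using gl_act_image[OF g, of m U] U(1) gl by simp
  ultimately have "admissible (plucker B)" using subalgebra_plucker[OF _ gw] gw by simp
  then show "\<exists>w. w \<noteq> 0 \<and> admissible w \<and> Pt = (\<lambda>_. vec.span {w})"
    using w0 U(3) B plucker_line_column_span[of B] by (intro exI[of _ "plucker B"]) auto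
next
  assume "\<exists>w. w \<noteq> 0 \<and> admissible w \<and> Pt = (\<lambda>_. vec.span {w})"
  then obtain w where w: "w \<noteq> 0" "admissible w" "Pt = (\<lambda>_. vec.span {w})" by blast
  have e: "bivector (X w) (M w) = exterior_square g w"
    using bivector_eta w(2) by (simp add: admissible_def X_def M_def)
  have "exterior_square g w \<noteq> 0" by (rule exterior_square_nonzero[OF g w(1)])
  then obtain B' :: "complex^2^4" where B': "plucker B' = exterior_square g w"
    using exists_plucker[of "X w" "M w"] e w(2) by (auto simp: admissible_def)
  have sub': "subalgebra (block_algebra N R \<rho>) (column_span B')"
    using subalgebra_plucker[OF _ B'] \<open>exterior_square g w \<noteq> 0\<close> B' w(2) by simp
  define B where "B = matrix_inv g ** B'"
  have gB: "g ** B = B'" by (simp add: B_def matrix_mul_assoc matrix_inv_mult[OF g])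
  have "plucker B = w" by (simp add: B_def exterior_square_plucker[symmetric] B' exterior_square_inverse[OF g])
  moreover have "subalgebra m (column_span B)"
    using sub' gl_act_image[OF g, of m "column_span B"] by (simp add: gl column_span_mult[symmetric] gB)
  ultimately show "Pt \<in> surface_of_2dim_subalgebras m"
    using w(1,3) plucker_nonzero_iff[of B] plucker_line_column_span[of B]
    by (auto simp: surface_of_2dim_subalgebras_def subalgebras_of_dim_def intro!: image_eqI[of _ _ "column_span B"])
qed

lemma vhom_X: "vhom (\<lambda>_. 1) (\<lambda>x :: complex^(2 \<Rightarrow> 4)^unit. X (x $ ()))"
  and vhom_M: "vhom (\<lambda>_. 1) (\<lambda>x :: complex^(2 \<Rightarrow> 4)^unit. M (x $ ()))"
  and vhom_Z: "vhom (\<lambda>_. 1) (\<lambda>x :: complex^(2 \<Rightarrow> 4)^unit. Z (x $ ()))"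
proof -
  have c: "vhom (\<lambda>_. 1) (\<lambda>x :: complex^(2 \<Rightarrow> 4)^unit. x $ ())"
    using vhom_coordinate[of "()"] by simp
  show X: "vhom (\<lambda>_. 1) (\<lambda>x :: complex^(2 \<Rightarrow> 4)^unit. X (x $ ()))"
    unfolding X_def by (intro vhom_wdir vhom_exterior_square c)
  show M: "vhom (\<lambda>_. 1) (\<lambda>x :: complex^(2 \<Rightarrow> 4)^unit. M (x $ ()))"
    unfolding M_def by (intro vhom_wmom vhom_exterior_square c)
  show "vhom (\<lambda>_. 1) (\<lambda>x :: complex^(2 \<Rightarrow> 4)^unit. Z (x $ ()))"
    unfolding Z_def by (intro vhom_add vhom_matrix X M)
qed

lemma projective_variety_surface: "projective_variety (surface_of_2dim_subalgebras m)"
proof -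
  define E :: "(complex^(2 \<Rightarrow> 4)^unit \<Rightarrow> complex) set" where
    "E = range (\<lambda>(i, j) x. exterior_square g (x $ ()) $ pair i j + exterior_square g (x $ ()) $ pair j i)
      \<union> range (\<lambda>k x. ccross (Z (x $ ())) (X (x $ ())) $ k)
      \<union> {\<lambda>x. X (x $ ()) \<cdot> M (x $ ()), \<lambda>x. Z (x $ ()) \<cdot> M (x $ ())}"
  have E: "(\<forall>p\<in>E. p x = 0) \<longleftrightarrow> admissible (x $ ())" for x
  proof -
    have "(\<forall>p\<in>E. p x = 0) \<longleftrightarrow> (\<forall>i j. exterior_square g (x $ ()) $ pair i j + exterior_square g (x $ ()) $ pair j i = 0) \<and>
        (\<forall>k. ccross (Z (x $ ())) (X (x $ ())) $ k = 0) \<and> X (x $ ()) \<cdot> M (x $ ()) = 0 \<and> Z (x $ ()) \<cdot> M (x $ ()) = 0"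
      unfolding E_def ball_Un by (simp add: split_paired_All)
    then show ?thesis unfolding admissible_def antisymmetric_def vec_eq_iff[of "ccross _ _"] by auto
  qed
  have "\<exists>d. multihomogeneous d p" if "p \<in> E" for p
  proof -
    have c: "vhom (\<lambda>_. 1) (\<lambda>x :: complex^(2 \<Rightarrow> 4)^unit. exterior_square g (x $ ()))"
      using vhom_exterior_square[OF vhom_coordinate[of "()"], of g] by simp
    have "multihomogeneous (\<lambda>_. 1) (\<lambda>x :: complex^(2 \<Rightarrow> 4)^unit. exterior_square g (x $ ()) $ pair i j + exterior_square g (x $ ()) $ pair j i)" for i j
      using c by (intro multihomogeneous_add) (auto simp: vhom_def)
    moreover have "\<exists>d. multihomogeneous d (\<lambda>x :: complex^(2 \<Rightarrow> 4)^unit. ccross (Z (x $ ())) (X (x $ ())) $ k)" for k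
      using vhom_ccross[OF vhom_Z vhom_X] unfolding vhom_def by blast
    ultimately show ?thesis
      using \<open>p \<in> E\<close> vhom_cdot[OF vhom_X vhom_M] vhom_cdot[OF vhom_Z vhom_M] unfolding E_def by auto
  qed
  moreover have "surface_of_2dim_subalgebras m = {Pt \<in> multiprojective_space. \<forall>p\<in>E. \<forall>x. represents x Pt \<longrightarrow> p x = 0}"
  proof (intro set_eqI iffI)
    fix Pt assume "Pt \<in> surface_of_2dim_subalgebras m"
    then obtain w where w: "w \<noteq> 0" "admissible w" "Pt = (\<lambda>_. vec.span {w})" unfolding surface_iff by blast
    have "Pt \<in> multiprojective_space" using w(1,3) by (simp add: multiprojective_space_def vec.dim_eq_card_independent)
    moreover have "admissible (x $ ())" if r: "represents x Pt" for x
    proof -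
      obtain c where "x $ () = c *s w" using r w(3) by (auto simp: represents_def vec.span_singleton)
      then show ?thesis using admissible_scale[OF w(2)] by simp
    qed
    ultimately show "Pt \<in> {Pt \<in> multiprojective_space. \<forall>p\<in>E. \<forall>x. represents x Pt \<longrightarrow> p x = 0}"
      using E by blast
  next
    fix Pt assume a: "Pt \<in> {Pt \<in> multiprojective_space. \<forall>p\<in>E. \<forall>x. represents x Pt \<longrightarrow> p x = 0}"
    then have "vec.subspace (Pt ())" "vec.dim (Pt ()) = 1" by (auto simp: multiprojective_space_def)
    then obtain w where w: "w \<noteq> 0" "Pt () = vec.span {w}" using line_span by blast
    then have "represents (\<chi> i. w) Pt" by (simp add: represents_def vec.span_base)
    then have "admissible w" using a E[of "\<chi> i. w"] by auto
    moreover have "Pt = (\<lambda>_. vec.span {w})" using w(2) by (simp add: fun_eq_iff)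
    ultimately show "Pt \<in> surface_of_2dim_subalgebras m" unfolding surface_iff using w(1) by blast
  qed
  ultimately show ?thesis unfolding projective_variety_def by blast
qed

end

section \<open>Parametrisation by the graph of the pencil\<close>

lemma proportional:
  fixes \<kappa> \<alpha> a b :: complex
  assumes "(\<kappa>, \<alpha>) \<noteq> (0, 0)" "\<alpha> * a = \<kappa> * b"
  obtains t where "a = t * \<kappa>" "b = t * \<alpha>"
proof (cases "\<kappa> = 0")
  case True
  then have "a = b / \<alpha> * \<kappa>" "b = b / \<alpha> * \<alpha>" using assms by auto
  then show ?thesis using that by blast
next
  case False
  then have "a = a / \<kappa> * \<kappa>" "b = a / \<kappa> * \<alpha>" using assms by (auto simp: field_simps)
  then show ?thesis using that by blast
qed

lemma span_scale_eq:
  fixes v :: "complex^'n::finite"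
  assumes "c \<noteq> 0" shows "vec.span {c *s v} = vec.span {v}"
proof -
  have "(1 / c) *s (c *s v) \<in> vec.span {c *s v}" by (intro vec.span_scale vec.span_base) simp
  then have "v \<in> vec.span {c *s v}" using assms by simp
  moreover have "c *s v \<in> vec.span {v}" by (intro vec.span_scale vec.span_base) simp
  ultimately show ?thesis by (simp add: vec.span_eq)
qed

lemma span_eq_multiple:
  fixes v w :: "complex^'n::finite"
  assumes "vec.span {v} = vec.span {w}" "w \<noteq> 0"
  obtains c where "c \<noteq> 0" "w = c *s v"
proof -
  have "w \<in> vec.span {v}" using assms(1) by (simp add: vec.span_base)
  then obtain c where "w = c *s v" by (auto simp: vec.span_singleton)
  then show ?thesis using that[of c] assms(2) by auto
qed

context pencil_surface
begin

text \<open>Homogeneous coordinates of a point of the product of plane and line: \<open>q\<close>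
  lies on the member of the pencil given by \<open>\<alpha>\<close> times \<open>P\<close> minus
  \<open>\<kappa>\<close> times \<open>Q\<close>.\<close>

definition conic :: "complex^3 \<Rightarrow> complex \<Rightarrow> complex \<Rightarrow> bool" where
  "conic q \<kappa> \<alpha> \<longleftrightarrow> q \<noteq> 0 \<and> (\<kappa>, \<alpha>) \<noteq> (0, 0) \<and> \<alpha> * (q \<cdot> (P *v q)) = \<kappa> * (q \<cdot> (Q *v q))"

text \<open>The Pluecker vector with \<open>X w = \<kappa> *s q\<close> and
  \<open>Z w = \<alpha> *s q\<close>; solving the definition of \<open>Z\<close> for
  \<open>M\<close> gives the moment.\<close>

definition \<Psi> :: "complex^3 \<Rightarrow> complex \<Rightarrow> complex \<Rightarrow> complex^(2 \<Rightarrow> 4)" where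
  "\<Psi> q \<kappa> \<alpha> = exterior_square (matrix_inv g) (bivector (\<kappa> *s q) (L *v (\<alpha> *s q - \<kappa> *s (R *v q))))"

lemma XZ_Psi: "X (\<Psi> q \<kappa> \<alpha>) = \<kappa> *s q" "Z (\<Psi> q \<kappa> \<alpha>) = \<alpha> *s q"
  and M_Psi: "M (\<Psi> q \<kappa> \<alpha>) = L *v (\<alpha> *s q - \<kappa> *s (R *v q))"
proof -
  show x: "X (\<Psi> q \<kappa> \<alpha>) = \<kappa> *s q" by (simp add: X_def \<Psi>_def exterior_square_inverse[OF g])
  show m: "M (\<Psi> q \<kappa> \<alpha>) = L *v (\<alpha> *s q - \<kappa> *s (R *v q))" by (simp add: M_def \<Psi>_def exterior_square_inverse[OF g])
  show "Z (\<Psi> q \<kappa> \<alpha>) = \<alpha> *s q" unfolding Z_def x m TL by (simp add: vec.scale)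
qed

lemma quadratic_forms:
  "q \<cdot> (P *v q) = 2 * (q \<cdot> (L *v q))" "q \<cdot> (Q *v q) = 2 * (q \<cdot> (L *v (R *v q)))"
  by (simp_all add: P_def Q_def sym_part(2) matrix_vector_mul_assoc)

lemma Psi_admissible: assumes "conic q \<kappa> \<alpha>" shows "admissible (\<Psi> q \<kappa> \<alpha>)"
proof -
  have "q \<cdot> (L *v (\<alpha> *s q - \<kappa> *s (R *v q))) = 0"
    using assms by (simp add: conic_def quadratic_forms matrix_vector_mult_diff_distrib vec.scale)
  then show ?thesis
    by (simp add: admissible_def XZ_Psi M_Psi ccross_linear)
      (simp add: \<Psi>_def exterior_square_inverse[OF g] antisymmetric_bivector)
qed

lemma zero_linear: "X 0 = 0" "Z 0 = 0"
  using scale_linear(1,3)[of 0 0] by simp_all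

lemma Psi_nonzero: assumes "q \<noteq> 0" "(\<kappa>, \<alpha>) \<noteq> (0, 0)" shows "\<Psi> q \<kappa> \<alpha> \<noteq> 0"
proof
  assume z: "\<Psi> q \<kappa> \<alpha> = 0"
  have "\<kappa> *s q = 0" "\<alpha> *s q = 0" using XZ_Psi[of q \<kappa> \<alpha>] unfolding z zero_linear by simp_all
  then show False using assms by simp
qed

lemma Psi_scale: "\<Psi> (a *s q) (b * \<kappa>) (b * \<alpha>) = (a * b) *s \<Psi> q \<kappa> \<alpha>"
proof -
  have "L *v ((b * \<alpha>) *s (a *s q) - (b * \<kappa>) *s (R *v (a *s q))) = (a * b) *s (L *v (\<alpha> *s q - \<kappa> *s (R *v q)))"
    by (simp add: vec.scale matrix_vector_mult_diff_distrib vec_eq_iff algebra_simps)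
  moreover have "(b * \<kappa>) *s (a *s q) = (a * b) *s (\<kappa> *s q)" by (simp add: vec_eq_iff)
  ultimately show ?thesis by (simp only: \<Psi>_def bivector_scale exterior_square_scale)
qed

text \<open>Parallel vectors \<open>X w\<close> and \<open>Z w\<close> have a common direction
  \<open>q\<close>; for \<open>X w = 0\<close> it is that of \<open>Z w\<close>, with
  \<open>\<kappa> = 0\<close>. Both being orthogonal to \<open>M w\<close> means
  \<open>q \<cdot> M w = 0\<close>, which is the conic equation up to the factor 2.\<close>

lemma admissible_Psi:
  assumes w: "w \<noteq> 0" "admissible w"
  obtains q \<kappa> \<alpha> where "conic q \<kappa> \<alpha>" "w = \<Psi> q \<kappa> \<alpha>"
proof -
  have e: "exterior_square g w = bivector (X w) (M w)"
    using bivector_eta w(2) by (simp add: admissible_def X_def M_def)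
  have M: "M w = L *v (Z w - R *v X w)" by (simp add: Z_def TL)
  have c: "ccross (Z w) (X w) = 0" "X w \<cdot> M w = 0" "Z w \<cdot> M w = 0" using w(2) by (simp_all add: admissible_def)
  obtain q \<kappa> \<alpha> where q: "q \<noteq> 0" "(\<kappa>, \<alpha>) \<noteq> (0, 0)" "X w = \<kappa> *s q" "Z w = \<alpha> *s q"
  proof (cases "X w = 0")
    case True
    have "Z w \<noteq> 0"
    proof
      assume "Z w = 0"
      then have "M w = 0" using M True by simp
      then have "exterior_square g w = 0" using e True bivector_scale[of 0 0 0] by simp
      then show False using exterior_square_nonzero[OF g w(1)] by simp
    qed
    then show ?thesis using that[of "Z w" 0 1] True by simp
  next
    case False
    have "ccross (X w) (Z w) = 0" using c(1) ccross_swap[of "X w" "Z w"] by simp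
    then obtain k where "Z w = k *s X w" using ccross_eq_0[OF False] by blast
    then show ?thesis using that[of "X w" 1 k] False by simp
  qed
  have "\<kappa> * (q \<cdot> M w) = 0" "\<alpha> * (q \<cdot> M w) = 0" using c(2,3) by (simp_all add: q)
  then have qM: "q \<cdot> M w = 0" using q(2) by auto
  have M': "M w = L *v (\<alpha> *s q - \<kappa> *s (R *v q))" unfolding M q by (simp add: vec.scale)
  have "conic q \<kappa> \<alpha>"
    using qM q(1,2) unfolding M'
    by (simp add: conic_def quadratic_forms matrix_vector_mult_diff_distrib vec.scale)
  moreover have "w = \<Psi> q \<kappa> \<alpha>"
    using exterior_square_inverse(1)[OF g, of w] by (simp add: e \<Psi>_def q(3) M')
  ultimately show ?thesis using that by blast
qed

lemma surface_Psi: "Pt \<in> surface_of_2dim_subalgebras m \<longleftrightarrow> (\<exists>q \<kappa> \<alpha>. conic q \<kappa> \<alpha> \<and> Pt = (\<lambda>_. vec.span {\<Psi> q \<kappa> \<alpha>}))"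
proof
  assume "Pt \<in> surface_of_2dim_subalgebras m"
  then obtain w where "w \<noteq> 0" "admissible w" "Pt = (\<lambda>_. vec.span {w})" unfolding surface_iff by blast
  then show "\<exists>q \<kappa> \<alpha>. conic q \<kappa> \<alpha> \<and> Pt = (\<lambda>_. vec.span {\<Psi> q \<kappa> \<alpha>})" using admissible_Psi by metis
next
  assume "\<exists>q \<kappa> \<alpha>. conic q \<kappa> \<alpha> \<and> Pt = (\<lambda>_. vec.span {\<Psi> q \<kappa> \<alpha>})"
  then obtain q \<kappa> \<alpha> where "conic q \<kappa> \<alpha>" "Pt = (\<lambda>_. vec.span {\<Psi> q \<kappa> \<alpha>})" by blast
  then show "Pt \<in> surface_of_2dim_subalgebras m"
    unfolding surface_iff using Psi_admissible Psi_nonzero[of q \<kappa> \<alpha>]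
    by (intro exI[of _ "\<Psi> q \<kappa> \<alpha>"]) (simp add: conic_def)
qed

text \<open>Equality of points in the product of plane and line.\<close>

definition same :: "complex^3 \<Rightarrow> complex \<Rightarrow> complex \<Rightarrow> complex^3 \<Rightarrow> complex \<Rightarrow> complex \<Rightarrow> bool" where
  "same q \<kappa> \<alpha> q' \<kappa>' \<alpha>' \<longleftrightarrow> (\<exists>a b. a \<noteq> 0 \<and> b \<noteq> 0 \<and> q' = a *s q \<and> \<kappa>' = b * \<kappa> \<and> \<alpha>' = b * \<alpha>)"

lemma same_Psi: "same q \<kappa> \<alpha> q' \<kappa>' \<alpha>' \<Longrightarrow> vec.span {\<Psi> q' \<kappa>' \<alpha>'} = vec.span {\<Psi> q \<kappa> \<alpha>}"
  unfolding same_def by (elim exE conjE) (simp add: Psi_scale span_scale_eq)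

lemma Psi_same:
  assumes c: "conic q \<kappa> \<alpha>" "conic q' \<kappa>' \<alpha>'" and e: "vec.span {\<Psi> q \<kappa> \<alpha>} = vec.span {\<Psi> q' \<kappa>' \<alpha>'}"
  shows "same q \<kappa> \<alpha> q' \<kappa>' \<alpha>'"
proof -
  have nz: "q \<noteq> 0" "q' \<noteq> 0" "(\<kappa>, \<alpha>) \<noteq> (0, 0)" "(\<kappa>', \<alpha>') \<noteq> (0, 0)" using c by (auto simp: conic_def)
  obtain k where k: "k \<noteq> 0" "\<Psi> q' \<kappa>' \<alpha>' = k *s \<Psi> q \<kappa> \<alpha>"
    using span_eq_multiple[OF e Psi_nonzero[OF nz(2,4)]] by blast
  have x: "\<kappa>' *s q' = k *s (\<kappa> *s q)" and z: "\<alpha>' *s q' = k *s (\<alpha> *s q)"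
    using XZ_Psi[of q' \<kappa>' \<alpha>'] unfolding k(2) scale_linear XZ_Psi by simp_all
  have "\<exists>a. a \<noteq> 0 \<and> q' = a *s q"
  proof (cases "\<kappa>' = 0")
    case True
    then have "\<alpha>' \<noteq> 0" using nz(4) by simp
    then have "q' = (1 / \<alpha>') *s (\<alpha>' *s q')" by simp
    then have q': "q' = (k * \<alpha> / \<alpha>') *s q" unfolding z by simp
    then show ?thesis using nz(2) by (intro exI[of _ "k * \<alpha> / \<alpha>'"]) auto
  next
    case False
    then have "q' = (1 / \<kappa>') *s (\<kappa>' *s q')" by simp
    then have q': "q' = (k * \<kappa> / \<kappa>') *s q" unfolding x by simp
    then show ?thesis using nz(2) by (intro exI[of _ "k * \<kappa> / \<kappa>'"]) auto
  qed
  then obtain a where a: "a \<noteq> 0" "q' = a *s q" by blast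
  have "(\<kappa>' * a) *s q = (k * \<kappa>) *s q" "(\<alpha>' * a) *s q = (k * \<alpha>) *s q" using x z a(2) by simp_all
  then have "\<kappa>' * a = k * \<kappa>" "\<alpha>' * a = k * \<alpha>" using nz(1) by (simp_all only: vec.scale_cancel_right simp_thms)
  then have "\<kappa>' = k / a * \<kappa>" "\<alpha>' = k / a * \<alpha>" using a(1) by (simp_all add: field_simps)
  then show ?thesis unfolding same_def using a k(1) by (intro exI[of _ a] exI[of _ "k / a"]) simp
qed

section \<open>Chords through the base points\<close>

lemma p_nonzero: "p i \<noteq> 0"
proof
  assume z: "p i = 0"
  obtain j where "j \<noteq> i" using third_index[of i i] by blast
  moreover obtain l where "l \<noteq> i" "l \<noteq> j" using third_index[of i j] by blast
  ultimately show False using ind[of i j l 1 0 0] z by auto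
qed

lemma p_not_parallel: assumes "i \<noteq> j" shows "ccross (c *s p i) (p j) = 0 \<longleftrightarrow> c = 0"
proof
  assume z: "ccross (c *s p i) (p j) = 0"
  show "c = 0"
  proof (rule ccontr)
    assume "c \<noteq> 0"
    then have "c *s p i \<noteq> 0" using p_nonzero by simp
    then obtain d where "p j = d *s (c *s p i)" using ccross_eq_0 z by blast
    moreover obtain l where "l \<noteq> i" "l \<noteq> j" using third_index[of i j] by blast
    ultimately show False using ind[of i j l "d * c" "- 1" 0] assms by auto
  qed
qed (simp add: ccross_linear)

lemma p_base: "p i \<cdot> (P *v p i) = 0" "p i \<cdot> (Q *v p i) = 0"
proof -
  have "\<exists>j c. p i = c *s p j" by (intro exI[of _ i] exI[of _ 1]) simp
  then show "p i \<cdot> (P *v p i) = 0" "p i \<cdot> (Q *v p i) = 0" using base[of "p i"] by blast+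
qed

lemma PQ_sym: "x \<cdot> (P *v y) = y \<cdot> (P *v x)" "x \<cdot> (Q *v y) = y \<cdot> (Q *v x)"
  by (simp_all add: P_def Q_def sym_part(2))

lemma p_tangent: assumes "p i \<cdot> (P *v y) = 0" "p i \<cdot> (Q *v y) = 0" obtains c where "y = c *s p i"
  using tv p_nonzero p_base assms unfolding transversal_def by blast

text \<open>Half the gradient of a conic of the pencil, that is, the polar line of
  \<open>x\<close>.\<close>

definition grad :: "complex \<Rightarrow> complex \<Rightarrow> complex^3 \<Rightarrow> complex^3" where
  "grad \<kappa> \<alpha> x = \<alpha> *s (P *v x) - \<kappa> *s (Q *v x)"

lemma grad_linear: "grad \<kappa> \<alpha> (c *s x) = c *s grad \<kappa> \<alpha> x" "grad \<kappa> \<alpha> (x - y) = grad \<kappa> \<alpha> x - grad \<kappa> \<alpha> y"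
  "grad (b * \<kappa>) (b * \<alpha>) x = b *s grad \<kappa> \<alpha> x"
  by (simp_all add: grad_def vec.scale matrix_vector_mult_diff_distrib vec_eq_iff algebra_simps)

lemma grad_sym: "x \<cdot> grad \<kappa> \<alpha> y = y \<cdot> grad \<kappa> \<alpha> x"
  using PQ_sym[of x y] by (simp add: grad_def)

lemma grad_p: "p i \<cdot> grad \<kappa> \<alpha> (p i) = 0" by (simp add: grad_def p_base)

lemma grad_conic: "conic q \<kappa> \<alpha> \<Longrightarrow> q \<cdot> grad \<kappa> \<alpha> q = 0" by (simp add: grad_def conic_def)

text \<open>If a member were singular at \<open>p i\<close>, the two tangency conditions there would
  be dependent, and their common solutions would have dimension at least two, against
  transversality.\<close>

lemma grad_p_zero: assumes "grad \<kappa> \<alpha> (p i) = 0" shows "\<kappa> = 0 \<and> \<alpha> = 0"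
proof (rule ccontr)
  assume n: "\<not> ?thesis"
  have e: "\<alpha> * (p i \<cdot> (P *v y)) = \<kappa> * (p i \<cdot> (Q *v y))" for y
  proof -
    have "y \<cdot> grad \<kappa> \<alpha> (p i) = 0" by (simp add: assms)
    then show ?thesis using PQ_sym[of y "p i"] by (simp add: grad_def)
  qed
  define r where "r = (if \<alpha> = 0 then P else Q) *v p i"
  have r: "r \<cdot> y = 0 \<Longrightarrow> p i \<cdot> (P *v y) = 0 \<and> p i \<cdot> (Q *v y) = 0" for y
    using e[of y] n PQ_sym[of y "p i"] by (auto simp: r_def cdot_commute[of _ y] split: if_splits)
  obtain a b where ab: "r \<cdot> a = 0" "r \<cdot> b = 0" "\<And>x y. x *s a + y *s b = 0 \<Longrightarrow> x = 0 \<and> y = 0"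
    using two_in_kernel by blast
  obtain c where c: "a = c *s p i" using p_tangent r[OF ab(1)] by blast
  obtain d where d: "b = d *s p i" using p_tangent r[OF ab(2)] by blast
  have "d *s a + (- c) *s b = 0" by (simp add: c d vec_eq_iff)
  from ab(3)[OF this] have "c = 0" by simp
  then show False using ab(3)[of 1 0] c by simp
qed

text \<open>A reference line missing \<open>p i\<close>, normalised at that point; any choice will
  do.\<close>

definition \<theta> :: "4 \<Rightarrow> complex^3" where "\<theta> i = (SOME t. t \<cdot> p i = 1)"

lemma theta: "\<theta> i \<cdot> p i = 1"
proof -
  obtain t where "p i \<cdot> t = 1" using nonzero_cdot[OF p_nonzero] by blast
  then show ?thesis unfolding \<theta>_def using someI[of "\<lambda>t. t \<cdot> p i = 1" t] by (simp add: cdot_commute)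
qed

text \<open>The chord of a conic of the pencil through \<open>q\<close> and \<open>p i\<close>; unlike the cross product it
  extends over \<open>q = p i\<close>, where it is the tangent.\<close>
definition chord :: "4 \<Rightarrow> complex^3 \<Rightarrow> complex \<Rightarrow> complex \<Rightarrow> complex^3" where
  "chord i q \<kappa> \<alpha> = grad \<kappa> \<alpha> q + (\<theta> i \<cdot> q) *s grad \<kappa> \<alpha> (p i) - (q \<cdot> grad \<kappa> \<alpha> (p i)) *s \<theta> i"

text \<open>The line through \<open>q\<close> and \<open>p i\<close>, or the tangent of the conic if
  the two points coincide.\<close>

definition side :: "4 \<Rightarrow> complex^3 \<Rightarrow> complex \<Rightarrow> complex \<Rightarrow> complex^3" where
  "side i q \<kappa> \<alpha> = (if ccross q (p i) = 0 then chord i q \<kappa> \<alpha> else ccross q (p i))"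

lemma chord_scale: "chord i (a *s q) (b * \<kappa>) (b * \<alpha>) = (a * b) *s chord i q \<kappa> \<alpha>"
  unfolding chord_def grad_linear(3) grad_linear(1) by (simp add: vec_eq_iff algebra_simps)

text \<open>At \<open>q\<close> the two terms with \<open>\<theta> i\<close> cancel and the gradient
  vanishes on \<open>q\<close> because \<open>q\<close> is on the conic; at \<open>p i\<close> the
  remaining terms cancel by symmetry of the polar form.\<close>

lemma chord_incident:
  assumes "conic q \<kappa> \<alpha>" shows "chord i q \<kappa> \<alpha> \<cdot> q = 0" "chord i q \<kappa> \<alpha> \<cdot> p i = 0"
proof -
  have c: "grad \<kappa> \<alpha> x \<cdot> y = y \<cdot> grad \<kappa> \<alpha> x" for x y by (rule cdot_commute)
  show "chord i q \<kappa> \<alpha> \<cdot> q = 0" "chord i q \<kappa> \<alpha> \<cdot> p i = 0"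
    using grad_conic[OF assms] grad_p[of i \<kappa> \<alpha>] grad_sym[of "p i" \<kappa> \<alpha> q]
    by (simp_all add: chord_def c theta)
qed

lemma parallel_p: assumes "ccross q (p i) = 0" obtains c where "q = c *s p i"
proof -
  have "ccross (p i) q = 0" using assms ccross_swap[of "p i" q] by simp
  then show ?thesis using that ccross_eq_0[OF p_nonzero] by blast
qed

lemma chord_p: "chord i (c *s p i) \<kappa> \<alpha> = (2 * c) *s grad \<kappa> \<alpha> (p i)"
  by (simp add: chord_def grad_linear grad_p theta vec_eq_iff)

lemma side_nonzero: assumes "conic q \<kappa> \<alpha>" shows "side i q \<kappa> \<alpha> \<noteq> 0"
proof (cases "ccross q (p i) = 0")
  case True
  then obtain c where c: "q = c *s p i" using parallel_p by blast
  then have "c \<noteq> 0" using assms by (auto simp: conic_def)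
  moreover have "grad \<kappa> \<alpha> (p i) \<noteq> 0" using grad_p_zero assms by (auto simp: conic_def)
  ultimately show ?thesis using True c chord_p by (simp add: side_def)
qed (simp add: side_def)

lemma ccross_incident: "ccross x y \<cdot> x = 0" "ccross x y \<cdot> y = 0"
  by (simp_all add: cdot_3 algebra_simps)

lemma side_incident: assumes "conic q \<kappa> \<alpha>" shows "side i q \<kappa> \<alpha> \<cdot> q = 0" "side i q \<kappa> \<alpha> \<cdot> p i = 0"
  using chord_incident[OF assms] ccross_incident by (simp_all add: side_def)

lemma line_unique:
  assumes "ccross q (p i) \<noteq> 0" "l \<cdot> q = 0" "l \<cdot> p i = 0"
  obtains c where "l = c *s ccross q (p i)"
proof -
  have "ccross l (ccross q (p i)) = 0" using assms(2,3) by (simp add: ccross_triple)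
  then have "ccross (ccross q (p i)) l = 0" using ccross_swap[of "ccross q (p i)" l] by simp
  then show ?thesis using that ccross_eq_0[OF assms(1)] by blast
qed

lemma chord_side: assumes "conic q \<kappa> \<alpha>" shows "chord i q \<kappa> \<alpha> \<in> vec.span {side i q \<kappa> \<alpha>}"
proof (cases "ccross q (p i) = 0")
  case True then show ?thesis by (simp add: side_def vec.span_base)
next
  case False
  then obtain c where "chord i q \<kappa> \<alpha> = c *s ccross q (p i)" using line_unique chord_incident[OF assms] by blast
  then show ?thesis using False by (auto simp: side_def vec.span_singleton)
qed

end

section \<open>Bijection with the blown-up plane\<close>

lemma incident_span: "incident (vec.span {l}) (vec.span {x}) \<longleftrightarrow> l \<cdot> x = 0"
proof
  assume "incident (vec.span {l}) (vec.span {x})"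
  then show "l \<cdot> x = 0" by (simp add: incident_def cdot_def vec.span_base)
next
  assume "l \<cdot> x = 0"
  then have "a \<cdot> b = 0" if "a \<in> vec.span {l}" "b \<in> vec.span {x}" for a b
    using that by (auto simp: vec.span_singleton)
  then show "incident (vec.span {l}) (vec.span {x})" by (simp add: incident_def cdot_def)
qed

context pencil_surface
begin

definition points :: "(4, 3) mpoint" where "points i = vec.span {p i}"

definition blowup_point :: "complex^3 \<Rightarrow> complex \<Rightarrow> complex \<Rightarrow> (4 option, 3) mpoint" where
  "blowup_point q \<kappa> \<alpha> = (\<lambda>s. case s of None \<Rightarrow> vec.span {q} | Some i \<Rightarrow> vec.span {side i q \<kappa> \<alpha>})"

lemma generic_points: "generic_plane_points points"
proof -
  have "vec.dim (\<Union>i\<in>I. points i) = 3" if I: "card I = 3" for I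
  proof -
    obtain i j l where ijl: "I = {i, j, l}" "i \<noteq> j" "j \<noteq> l" "i \<noteq> l" using I by (auto simp: card_3_iff)
    have "vec.span (\<Union>i\<in>I. points i) = UNIV"
    proof (intro set_eqI iffI UNIV_I)
      fix v :: "complex^3"
      obtain x y z where v: "v = x *s p i + y *s p j + z *s p l"
        using indep3_span[OF ind[OF ijl(2-4)]] by blast
      have "p a \<in> (\<Union>i\<in>I. points i)" if "a \<in> I" for a
        using that by (auto simp: points_def intro!: vec.span_base)
      then show "v \<in> vec.span (\<Union>i\<in>I. points i)"
        unfolding v using ijl(1) by (intro vec.span_add vec.span_scale vec.span_base) simp_all
    qed
    then have "vec.dim (vec.span (\<Union>i\<in>I. points i)) = CARD(3)" by (simp only: vec_dim_card)
    then show ?thesis by (simp only: vec.dim_span) simp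
  qed
  then show ?thesis
    using p_nonzero by (simp add: generic_plane_points_def multiprojective_space_def points_def vec.dim_eq_card_independent)
qed

lemma blowup_point_in: assumes "conic q \<kappa> \<alpha>" shows "blowup_point q \<kappa> \<alpha> \<in> plane_blowup points"
proof -
  have "q \<noteq> 0" using assms by (simp add: conic_def)
  then have "blowup_point q \<kappa> \<alpha> \<in> multiprojective_space"
    using side_nonzero[OF assms]
    by (auto simp: multiprojective_space_def blowup_point_def vec.dim_eq_card_independent split: option.split)
  then show ?thesis
    using side_incident[OF assms] by (simp add: plane_blowup_def blowup_point_def points_def incident_span)
qed

text \<open>The point \<open>ccross l (\<theta> i)\<close> lies on the line \<open>l\<close> and
  differs from \<open>p i\<close>, since \<open>\<theta> i\<close> kills it. Were it on both
  tangents at \<open>p i\<close>, transversality would identify the two points. The pair is thus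
  \<open>(\<kappa>, \<alpha>)\<close> for the conic touching \<open>l\<close> at
  \<open>p i\<close>.\<close>

lemma chord_direction_nonzero:
  assumes l: "l \<noteq> 0" "l \<cdot> p i = 0"
  shows "(p i \<cdot> (P *v ccross l (\<theta> i)), p i \<cdot> (Q *v ccross l (\<theta> i))) \<noteq> (0, 0)"
proof
  let ?r = "ccross l (\<theta> i)"
  assume "(p i \<cdot> (P *v ?r), p i \<cdot> (Q *v ?r)) = (0, 0)"
  then obtain c where c: "?r = c *s p i" using p_tangent[of i ?r] by auto
  have "\<theta> i \<cdot> ?r = 0" using ccross_incident(2) cdot_commute by metis
  then have "c = 0" unfolding c by (simp add: theta)
  then have "?r = 0" using c by simp
  then obtain d where d: "\<theta> i = d *s l" using ccross_eq_0[OF l(1)] by blast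
  then have "\<theta> i \<cdot> p i = 0" using l(2) by simp
  then show False by (simp add: theta)
qed

text \<open>Over a point \<open>q\<close> that is not a base point all lines are forced, and the
  unique conic of the pencil through \<open>q\<close> gives \<open>(\<kappa>, \<alpha>)\<close>.
  Over \<open>p i\<close> only the line with index \<open>i\<close> is free, and the conic touching
  it there is taken.\<close>

lemma plane_blowup_cases:
  assumes "S \<in> plane_blowup points"
  obtains q \<kappa> \<alpha> where "conic q \<kappa> \<alpha>" "S = blowup_point q \<kappa> \<alpha>"
proof -
  have S: "vec.subspace (S s)" "vec.dim (S s) = 1" for s
    using assms by (auto simp: plane_blowup_def multiprojective_space_def)
  obtain q where q: "q \<noteq> 0" "S None = vec.span {q}" using line_span[OF S] by blast
  have "\<forall>i. \<exists>l. l \<noteq> 0 \<and> S (Some i) = vec.span {l}" using line_span[OF S] by metis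
  then obtain l where l: "\<And>i. l i \<noteq> 0" "\<And>i. S (Some i) = vec.span {l i}" by metis
  have inc: "l i \<cdot> q = 0" "l i \<cdot> p i = 0" for i
    using assms unfolding plane_blowup_def by (auto simp: l(2) q(2) points_def incident_span)
  have off: "S (Some i) = vec.span {side i q \<kappa> \<alpha>}" if i: "ccross q (p i) \<noteq> 0" for i \<kappa> \<alpha>
  proof -
    obtain c where c: "l i = c *s ccross q (p i)" using line_unique[OF i inc] by blast
    then have "c \<noteq> 0" using l(1)[of i] by auto
    then show ?thesis using i by (simp add: l(2) c side_def span_scale_eq)
  qed
  have eq: "S = blowup_point q \<kappa> \<alpha>" if "\<And>i. S (Some i) = vec.span {side i q \<kappa> \<alpha>}" for \<kappa> \<alpha>
    using that q(2) by (auto simp: blowup_point_def fun_eq_iff split: option.split)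
  show ?thesis
  proof (cases "\<exists>i c. q = c *s p i")
    case False
    then have "(q \<cdot> (P *v q), q \<cdot> (Q *v q)) \<noteq> (0, 0)" using base[of q] by auto
    then have "conic q (q \<cdot> (P *v q)) (q \<cdot> (Q *v q))" using q(1) by (simp add: conic_def mult.commute)
    moreover have "ccross q (p i) \<noteq> 0" for i using parallel_p[of q i] False by blast
    ultimately show ?thesis using that eq[OF off] by blast
  next
    case True
    then obtain i c where qi: "q = c *s p i" by blast
    then have c: "c \<noteq> 0" using q(1) by auto
    define r where "r = ccross (l i) (\<theta> i)"
    define \<kappa> where "\<kappa> = p i \<cdot> (P *v r)"
    define \<alpha> where "\<alpha> = p i \<cdot> (Q *v r)"
    have nz: "(\<kappa>, \<alpha>) \<noteq> (0, 0)"
      using chord_direction_nonzero[OF l(1) inc(2)] by (simp add: \<kappa>_def \<alpha>_def r_def)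
    have "q \<cdot> (P *v q) = 0 \<and> q \<cdot> (Q *v q) = 0" unfolding base using qi by blast
    then have con: "conic q \<kappa> \<alpha>" using q(1) nz by (simp add: conic_def)
    let ?h = "grad \<kappa> \<alpha> (p i)"
    have h0: "?h \<noteq> 0" using grad_p_zero nz by auto
    have "r \<cdot> ?h = p i \<cdot> grad \<kappa> \<alpha> r" by (rule grad_sym)
    then have rh: "?h \<cdot> r = 0" by (simp add: grad_def \<kappa>_def \<alpha>_def mult.commute cdot_commute[of _ r])
    have hp: "?h \<cdot> p i = 0" using grad_p by (simp add: cdot_commute)
    have "ccross ?h (l i) = 0"
    proof -
      have "ccross (p i) r = l i"
        using inc(2)[of i] theta[of i] by (simp add: r_def ccross_triple cdot_commute[of "p i"])
      moreover have "ccross ?h (ccross (p i) r) = 0" using rh hp by (simp add: ccross_triple)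
      ultimately show ?thesis by simp
    qed
    then obtain d where d: "l i = d *s ?h" using ccross_eq_0[OF h0] by blast
    then have d0: "d \<noteq> 0" using l(1)[of i] by auto
    have "side i q \<kappa> \<alpha> = (2 * c) *s ?h"
      unfolding qi by (simp add: side_def ccross_linear chord_p)
    moreover have "vec.span {d *s ?h} = vec.span {?h}" by (rule span_scale_eq[OF d0])
    moreover have "vec.span {(2 * c) *s ?h} = vec.span {?h}" by (rule span_scale_eq) (use c in simp)
    ultimately have "S (Some i) = vec.span {side i q \<kappa> \<alpha>}" by (simp only: l(2) d)
    moreover have "ccross q (p j) \<noteq> 0" if "j \<noteq> i" for j
      using p_not_parallel[of i j c] that c qi by auto
    ultimately have "S (Some j) = vec.span {side j q \<kappa> \<alpha>}" for j using off by (cases "j = i") auto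
    then show ?thesis using that[OF con] eq by blast
  qed
qed

lemma same_blowup_point: assumes "conic q \<kappa> \<alpha>" "same q \<kappa> \<alpha> q' \<kappa>' \<alpha>'" shows "blowup_point q' \<kappa>' \<alpha>' = blowup_point q \<kappa> \<alpha>"
proof -
  obtain a b where ab: "a \<noteq> 0" "b \<noteq> 0" "q' = a *s q" "\<kappa>' = b * \<kappa>" "\<alpha>' = b * \<alpha>"
    using assms(2) by (auto simp: same_def)
  have "vec.span {side i q' \<kappa>' \<alpha>'} = vec.span {side i q \<kappa> \<alpha>}" for i
    using ab(1,2) unfolding ab(3-5) side_def by (simp add: ccross_linear chord_scale span_scale_eq)
  then show ?thesis using ab(1) by (simp add: blowup_point_def ab(3) span_scale_eq fun_eq_iff split: option.split)
qed

text \<open>The conic is recovered from \<open>q\<close> when \<open>q\<close> is not a base point,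
  and from its tangent at \<open>p i\<close> otherwise; there \<open>grad\<close> is injective in
  \<open>(\<kappa>, \<alpha>)\<close> by \<open>grad_p_zero\<close>.\<close>

lemma blowup_point_same:
  assumes c: "conic q \<kappa> \<alpha>" "conic q' \<kappa>' \<alpha>'" and e: "blowup_point q \<kappa> \<alpha> = blowup_point q' \<kappa>' \<alpha>'"
  shows "same q \<kappa> \<alpha> q' \<kappa>' \<alpha>'"
proof -
  have nz: "q \<noteq> 0" "q' \<noteq> 0" "(\<kappa>, \<alpha>) \<noteq> (0, 0)" "(\<kappa>', \<alpha>') \<noteq> (0, 0)" using c by (auto simp: conic_def)
  have "vec.span {q} = vec.span {q'}" using fun_cong[OF e, of None] by (simp add: blowup_point_def)
  then obtain a where a: "a \<noteq> 0" "q' = a *s q" using span_eq_multiple nz(2) by blast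
  have "\<exists>b. \<kappa>' = b * \<kappa> \<and> \<alpha>' = b * \<alpha>"
  proof (cases "\<exists>i c. q = c *s p i")
    case False
    then have n: "(q \<cdot> (P *v q), q \<cdot> (Q *v q)) \<noteq> (0, 0)" using base[of q] by auto
    have "\<alpha>' * (q \<cdot> (P *v q)) = \<kappa>' * (q \<cdot> (Q *v q))"
      using c(2) a(1) by (simp add: conic_def a(2) vec.scale)
    then obtain t where t: "q \<cdot> (P *v q) = t * \<kappa>'" "q \<cdot> (Q *v q) = t * \<alpha>'" using proportional[OF nz(4)] by blast
    have "t \<noteq> 0" using n t by auto
    have "\<alpha> * (t * \<kappa>') = \<kappa> * (t * \<alpha>')" using c(1) t by (simp add: conic_def)
    then have "\<alpha> * \<kappa>' = \<kappa> * \<alpha>'" using \<open>t \<noteq> 0\<close> by simp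
    then show ?thesis using proportional[OF nz(3)] by metis
  next
    case True
    then obtain i d where qi: "q = d *s p i" by blast
    then have d: "d \<noteq> 0" using nz(1) by auto
    have s: "side i q \<kappa> \<alpha> = (2 * d) *s grad \<kappa> \<alpha> (p i)" "side i q' \<kappa>' \<alpha>' = (2 * (a * d)) *s grad \<kappa>' \<alpha>' (p i)"
      unfolding a(2) qi by (simp_all add: side_def ccross_linear chord_p)
    have "vec.span {side i q \<kappa> \<alpha>} = vec.span {side i q' \<kappa>' \<alpha>'}"
      using fun_cong[OF e, of "Some i"] by (simp add: blowup_point_def)
    moreover have "vec.span {(2 * d) *s grad \<kappa> \<alpha> (p i)} = vec.span {grad \<kappa> \<alpha> (p i)}"
      "vec.span {(2 * (a * d)) *s grad \<kappa>' \<alpha>' (p i)} = vec.span {grad \<kappa>' \<alpha>' (p i)}"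
      by (rule span_scale_eq, use a(1) d in simp)+
    ultimately have "vec.span {grad \<kappa> \<alpha> (p i)} = vec.span {grad \<kappa>' \<alpha>' (p i)}" by (simp only: s)
    moreover have "grad \<kappa>' \<alpha>' (p i) \<noteq> 0" using grad_p_zero nz(4) by auto
    ultimately obtain b where b: "grad \<kappa>' \<alpha>' (p i) = b *s grad \<kappa> \<alpha> (p i)" using span_eq_multiple by blast
    have "grad (\<kappa>' - b * \<kappa>) (\<alpha>' - b * \<alpha>) (p i) = 0"
      using b by (simp add: grad_def vec_eq_iff algebra_simps)
    then have "\<kappa>' - b * \<kappa> = 0 \<and> \<alpha>' - b * \<alpha> = 0" by (rule grad_p_zero)
    then show ?thesis by (intro exI[of _ b]) simp
  qed
  then obtain b where b: "\<kappa>' = b * \<kappa>" "\<alpha>' = b * \<alpha>" by blast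
  then have "b \<noteq> 0" using nz(4) by auto
  then show ?thesis unfolding same_def using a b by blast
qed

text \<open>Defined by choice, as a point has many homogeneous coordinates; \<open>Psi_same\<close>
  and \<open>same_blowup_point\<close> make the value independent of them.\<close>

definition to_blowup :: "(unit, 2 \<Rightarrow> 4) mpoint \<Rightarrow> (4 option, 3) mpoint" where
  "to_blowup Pt = (SOME S. \<exists>q \<kappa> \<alpha>. conic q \<kappa> \<alpha> \<and> Pt = (\<lambda>_. vec.span {\<Psi> q \<kappa> \<alpha>}) \<and> S = blowup_point q \<kappa> \<alpha>)"

definition of_blowup :: "(4 option, 3) mpoint \<Rightarrow> (unit, 2 \<Rightarrow> 4) mpoint" where
  "of_blowup S = (SOME Pt. \<exists>q \<kappa> \<alpha>. conic q \<kappa> \<alpha> \<and> S = blowup_point q \<kappa> \<alpha> \<and> Pt = (\<lambda>_. vec.span {\<Psi> q \<kappa> \<alpha>}))"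

lemma to_blowup: assumes "conic q \<kappa> \<alpha>" shows "to_blowup (\<lambda>_. vec.span {\<Psi> q \<kappa> \<alpha>}) = blowup_point q \<kappa> \<alpha>"
  unfolding to_blowup_def
proof (rule some_equality)
  fix S assume "\<exists>q' \<kappa>' \<alpha>'. conic q' \<kappa>' \<alpha>' \<and> (\<lambda>_. vec.span {\<Psi> q \<kappa> \<alpha>}) = (\<lambda>_::unit. vec.span {\<Psi> q' \<kappa>' \<alpha>'}) \<and> S = blowup_point q' \<kappa>' \<alpha>'"
  then obtain q' \<kappa>' \<alpha>' where c: "conic q' \<kappa>' \<alpha>'" "(\<lambda>_. vec.span {\<Psi> q \<kappa> \<alpha>}) = (\<lambda>_::unit. vec.span {\<Psi> q' \<kappa>' \<alpha>'})"
    "S = blowup_point q' \<kappa>' \<alpha>'" by blast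
  have "vec.span {\<Psi> q \<kappa> \<alpha>} = vec.span {\<Psi> q' \<kappa>' \<alpha>'}" using fun_cong[OF c(2)] by simp
  then show "S = blowup_point q \<kappa> \<alpha>" using c(3) same_blowup_point[OF assms Psi_same[OF assms c(1)]] by simp
qed (use assms in blast)

lemma of_blowup: assumes "conic q \<kappa> \<alpha>" shows "of_blowup (blowup_point q \<kappa> \<alpha>) = (\<lambda>_. vec.span {\<Psi> q \<kappa> \<alpha>})"
  unfolding of_blowup_def
proof (rule some_equality)
  fix Pt :: "(unit, 2 \<Rightarrow> 4) mpoint"
  assume "\<exists>q' \<kappa>' \<alpha>'. conic q' \<kappa>' \<alpha>' \<and> blowup_point q \<kappa> \<alpha> = blowup_point q' \<kappa>' \<alpha>' \<and> Pt = (\<lambda>_. vec.span {\<Psi> q' \<kappa>' \<alpha>'})"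
  then obtain q' \<kappa>' \<alpha>' where c: "conic q' \<kappa>' \<alpha>'" "blowup_point q \<kappa> \<alpha> = blowup_point q' \<kappa>' \<alpha>'"
    "Pt = (\<lambda>_. vec.span {\<Psi> q' \<kappa>' \<alpha>'})" by blast
  then show "Pt = (\<lambda>_. vec.span {\<Psi> q \<kappa> \<alpha>})" using same_Psi[OF blowup_point_same[OF assms c(1,2)]] by simp
qed (use assms in blast)

end

context pencil_surface
begin

section \<open>Regularity of both maps\<close>

lemma vhom_Psi:
  assumes "multihomogeneous d a" "multihomogeneous d b" "vhom e F"
  shows "vhom (d + e) (\<lambda>x. \<Psi> (F x) (a x) (b x))"
  unfolding \<Psi>_def
  by (intro vhom_exterior_square vhom_bivector vhom_matrix vhom_diff vhom_scale assms)

lemma vhom_chord: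
  assumes "multihomogeneous d a" "multihomogeneous d b" "vhom e F"
  shows "vhom (d + e) (\<lambda>x. chord i (F x) (a x) (b x))"
proof -
  have g: "vhom (d + e) (\<lambda>x. grad (a x) (b x) (F x))"
    unfolding grad_def by (intro vhom_diff vhom_scale vhom_matrix assms)
  have c: "vhom d (\<lambda>x. grad (a x) (b x) (p i))"
    unfolding grad_def by (intro vhom_diff vhom_scale_const assms)
  have "vhom (e + d) (\<lambda>x. (\<theta> i \<cdot> F x) *s grad (a x) (b x) (p i))"
    by (intro vhom_scale vhom_cdot_const assms c)
  moreover have "vhom (e + d) (\<lambda>x. (F x \<cdot> grad (a x) (b x) (p i)) *s \<theta> i)"
    by (intro vhom_scale_const vhom_cdot assms c)
  moreover have "e + d = d + e" by (rule add.commute)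
  ultimately show ?thesis
    unfolding chord_def by (intro vhom_diff vhom_add g) simp_all
qed

text \<open>Near a given point, \<open>q\<close> is read off from \<open>X\<close> or
  \<open>Z\<close>, whichever does not vanish there, and \<open>(\<kappa>, \<alpha>)\<close> from a
  coordinate \<open>k\<close> of both with \<open>q0 $ k \<noteq> 0\<close>. If \<open>q0\<close> is
  the point \<open>p i\<close>, \<open>chord\<close> gives the line with index \<open>i\<close>,
  otherwise the cross product does. These choices depend on the given point only, so the components
  are polynomials.\<close>

lemma regular_to_blowup: "regular_map (surface_of_2dim_subalgebras m) (plane_blowup points) to_blowup"
  unfolding regular_map_def
proof (intro conjI ballI)
  show "to_blowup ` surface_of_2dim_subalgebras m \<subseteq> plane_blowup points"
  proof (rule image_subsetI)
    fix S assume "S \<in> surface_of_2dim_subalgebras m"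
    then obtain q \<kappa> \<alpha> where "conic q \<kappa> \<alpha>" "S = (\<lambda>_. vec.span {\<Psi> q \<kappa> \<alpha>})"
      unfolding surface_Psi by blast
    then show "to_blowup S \<in> plane_blowup points" using to_blowup blowup_point_in by simp
  qed
  fix Pt assume "Pt \<in> surface_of_2dim_subalgebras m"
  then obtain q0 \<kappa>0 \<alpha>0 where c0: "conic q0 \<kappa>0 \<alpha>0" "Pt = (\<lambda>_. vec.span {\<Psi> q0 \<kappa>0 \<alpha>0})"
    unfolding surface_Psi by blast
  then obtain k where k: "q0 $ k \<noteq> 0" by (auto simp: conic_def vec_eq_iff)
  have nz0: "q0 \<noteq> 0" "(\<kappa>0, \<alpha>0) \<noteq> (0, 0)" using c0(1) by (auto simp: conic_def)
  define H :: "complex^(2 \<Rightarrow> 4)^unit \<Rightarrow> complex^3" where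
    "H x = (if \<kappa>0 \<noteq> 0 then X (x $ ()) else Z (x $ ()))" for x
  define F :: "4 option \<Rightarrow> complex^(2 \<Rightarrow> 4)^unit \<Rightarrow> complex^3" where
    "F s x = (case s of None \<Rightarrow> H x | Some i \<Rightarrow> if ccross q0 (p i) \<noteq> 0 then ccross (H x) (p i)
       else chord i (H x) (X (x $ ()) $ k) (Z (x $ ()) $ k))" for s x
  have H: "vhom (\<lambda>_. 1) H"
    unfolding H_def using vhom_X vhom_Z by (cases "\<kappa>0 = 0") simp_all
  have "\<exists>d. vhom d (F s)" for s
  proof (cases s)
    case None
    then have "F s = H" by (simp add: F_def fun_eq_iff)
    then show ?thesis using H by blast
  next
    case (Some i)
    have x: "multihomogeneous (\<lambda>_. 1) (\<lambda>x :: complex^(2 \<Rightarrow> 4)^unit. X (x $ ()) $ k)"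
      "multihomogeneous (\<lambda>_. 1) (\<lambda>x :: complex^(2 \<Rightarrow> 4)^unit. Z (x $ ()) $ k)"
      using vhom_X vhom_Z by (simp_all add: vhom_def)
    have "F s = (if ccross q0 (p i) \<noteq> 0 then (\<lambda>x. ccross (H x) (p i))
        else (\<lambda>x. chord i (H x) (X (x $ ()) $ k) (Z (x $ ()) $ k)))"
      using Some by (simp add: F_def fun_eq_iff)
    then show ?thesis using vhom_ccross_const[OF H] vhom_chord[OF x H] by auto
  qed
  then have hom: "\<forall>s. \<exists>d. \<forall>k. multihomogeneous d (\<lambda>x. F s x $ k)" by (simp add: vhom_def)
  have val: "\<exists>c a. c \<noteq> 0 \<and> H x = a *s q \<and> (a = 0 \<longleftrightarrow> (if \<kappa>0 \<noteq> 0 then \<kappa> else \<alpha>) = 0)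
      \<and> X (x $ ()) $ k = (c * (q $ k)) * \<kappa> \<and> Z (x $ ()) $ k = (c * (q $ k)) * \<alpha>"
    if x: "represents x (\<lambda>_. vec.span {\<Psi> q \<kappa> \<alpha>})" for x q \<kappa> \<alpha>
  proof -
    obtain c where c: "c \<noteq> 0" "x $ () = c *s \<Psi> q \<kappa> \<alpha>"
      using x by (force simp: represents_def vec.span_singleton)
    have "X (x $ ()) = (c * \<kappa>) *s q" "Z (x $ ()) = (c * \<alpha>) *s q"
      by (simp_all add: c(2) scale_linear XZ_Psi)
    then show ?thesis using c(1)
      by (intro exI[of _ c] exI[of _ "c * (if \<kappa>0 \<noteq> 0 then \<kappa> else \<alpha>)"]) (simp add: H_def)
  qed
  have nonzero: "F s x \<noteq> 0" if x: "represents x Pt" for x s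
  proof -
    obtain c a where c: "c \<noteq> 0" "H x = a *s q0" "a = 0 \<longleftrightarrow> (if \<kappa>0 \<noteq> 0 then \<kappa>0 else \<alpha>0) = 0"
      "X (x $ ()) $ k = (c * (q0 $ k)) * \<kappa>0" "Z (x $ ()) $ k = (c * (q0 $ k)) * \<alpha>0"
      using val[OF x[unfolded c0(2)]] by blast
    have a: "a \<noteq> 0" using c(3) nz0(2) by (auto split: if_splits)
    show ?thesis
    proof (cases s)
      case None then show ?thesis using a nz0(1) c(2) by (simp add: F_def)
    next
      case (Some i)
      show ?thesis
      proof (cases "ccross q0 (p i) = 0")
        case True
        then have "F s x = (a * (c * (q0 $ k))) *s side i q0 \<kappa>0 \<alpha>0"
          using Some by (simp add: F_def c(2,4,5) chord_scale side_def)
        then show ?thesis using a c(1) k side_nonzero[OF c0(1)] by simp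
      next
        case False
        then show ?thesis using Some a by (simp add: F_def c(2) ccross_linear)
      qed
    qed
  qed
  have mem: "F s x \<in> to_blowup S s" if S: "S \<in> surface_of_2dim_subalgebras m" and x: "represents x S" for S x s
  proof -
    obtain q \<kappa> \<alpha> where c: "conic q \<kappa> \<alpha>" "S = (\<lambda>_. vec.span {\<Psi> q \<kappa> \<alpha>})"
      using S unfolding surface_Psi by blast
    obtain c a where v: "H x = a *s q" "X (x $ ()) $ k = (c * (q $ k)) * \<kappa>" "Z (x $ ()) $ k = (c * (q $ k)) * \<alpha>"
      using val[OF x[unfolded c(2)]] by blast
    have "F s x \<in> blowup_point q \<kappa> \<alpha> s"
    proof (cases s)
      case None then show ?thesis by (simp add: F_def blowup_point_def v vec.span_scale vec.span_base)
    next
      case (Some i)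
      have "ccross q (p i) \<in> vec.span {side i q \<kappa> \<alpha>}"
        by (simp add: side_def vec.span_zero vec.span_base)
      then show ?thesis
        using Some chord_side[OF c(1)] by (simp add: F_def blowup_point_def v ccross_linear chord_scale vec.span_scale)
    qed
    then show ?thesis using c to_blowup by simp
  qed
  show "\<exists>F :: 4 option \<Rightarrow> complex^(2 \<Rightarrow> 4)^unit \<Rightarrow> complex^3.
      (\<forall>j. \<exists>d. \<forall>k. multihomogeneous d (\<lambda>x. F j x $ k)) \<and>
      (\<forall>x. represents x Pt \<longrightarrow> (\<forall>j. F j x \<noteq> 0)) \<and>
      (\<forall>S\<in>surface_of_2dim_subalgebras m. \<forall>y. represents y S \<and> (\<forall>j. F j y \<noteq> 0) \<longrightarrow> (\<forall>j. F j y \<in> to_blowup S j))"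
    using hom nonzero mem by (intro exI[of _ F]) blast
qed

text \<open>The datum to recover is the ratio of \<open>\<kappa>\<close> and
  \<open>\<alpha>\<close>. Away from the base points it is the ratio of the two quadratic forms at
  \<open>q\<close>; at \<open>p i\<close> both vanish, and the line with index \<open>i\<close> must
  supply it.\<close>

lemma regular_of_blowup: "regular_map (plane_blowup points) (surface_of_2dim_subalgebras m) of_blowup"
  unfolding regular_map_def
proof (intro conjI ballI)
  show "of_blowup ` plane_blowup points \<subseteq> surface_of_2dim_subalgebras m"
  proof (rule image_subsetI)
    fix S assume "S \<in> plane_blowup points"
    then obtain q \<kappa> \<alpha> where "conic q \<kappa> \<alpha>" "S = blowup_point q \<kappa> \<alpha>" using plane_blowup_cases by blast
    then show "of_blowup S \<in> surface_of_2dim_subalgebras m" unfolding surface_Psi using of_blowup by auto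
  qed
  fix S0 assume "S0 \<in> plane_blowup points"
  then obtain q0 \<kappa>0 \<alpha>0 where c0: "conic q0 \<kappa>0 \<alpha>0" "S0 = blowup_point q0 \<kappa>0 \<alpha>0" using plane_blowup_cases by blast
  have nz0: "q0 \<noteq> 0" using c0(1) by (auto simp: conic_def)
  let ?n = "\<lambda>x :: complex^3^(4 option). x $ None"
  have vn: "vhom (\<lambda>j. if j = None then 1 else 0) ?n" by (rule vhom_coordinate)
  have rep: "\<exists>k. k \<noteq> 0 \<and> x $ None = k *s q" if "represents x (blowup_point q \<kappa> \<alpha>)" for x q \<kappa> \<alpha>
  proof -
    have "x $ None \<noteq> 0" "x $ None \<in> vec.span {q}"
      using that by (auto simp: represents_def blowup_point_def dest: spec[of _ None])
    then show ?thesis by (auto simp: vec.span_singleton)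
  qed
  have rep_side: "\<exists>k. x $ Some i = k *s side i q \<kappa> \<alpha>" if "represents x (blowup_point q \<kappa> \<alpha>)" for x q \<kappa> \<alpha> i
  proof -
    have "x $ Some i \<in> vec.span {side i q \<kappa> \<alpha>}"
      using that by (auto simp: represents_def blowup_point_def dest: spec[of _ "Some i"])
    then show ?thesis by (auto simp: vec.span_singleton)
  qed
  have main: "\<exists>d a b. multihomogeneous d a \<and> multihomogeneous d b \<and>
      (\<forall>x. represents x S0 \<longrightarrow> (a x, b x) \<noteq> (0, 0)) \<and>
      (\<forall>q \<kappa> \<alpha> x. conic q \<kappa> \<alpha> \<longrightarrow> represents x (blowup_point q \<kappa> \<alpha>) \<longrightarrow> \<alpha> * a x = \<kappa> * b x)"
  proof (cases "\<exists>i c. q0 = c *s p i")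
    case False
    let ?a = "\<lambda>x. ?n x \<cdot> (P *v ?n x)" and ?b = "\<lambda>x. ?n x \<cdot> (Q *v ?n x)"
    let ?d = "(\<lambda>j :: 4 option. if j = None then 1 else 0 :: nat) + (\<lambda>j. if j = None then 1 else 0)"
    have "multihomogeneous ?d ?a" "multihomogeneous ?d ?b"
      by (intro vhom_cdot vhom_matrix vn)+
    moreover have "(?a x, ?b x) \<noteq> (0, 0)" if x: "represents x S0" for x
    proof -
      obtain k where "k \<noteq> 0" "x $ None = k *s q0" using rep[OF x[unfolded c0(2)]] by blast
      then show ?thesis using base[of q0] False by (auto simp: vec.scale)
    qed
    moreover have "\<alpha> * ?a x = \<kappa> * ?b x" if con: "conic q \<kappa> \<alpha>" and x: "represents x (blowup_point q \<kappa> \<alpha>)" for q \<kappa> \<alpha> x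
    proof -
      obtain k where "x $ None = k *s q" using rep[OF x] by blast
      then show ?thesis using con by (simp add: conic_def vec.scale)
    qed
    ultimately show ?thesis by blast
  next
    case True
    then obtain i c where q0: "q0 = c *s p i" by blast
    let ?r = "\<lambda>x :: complex^3^(4 option). ccross (x $ Some i) (\<theta> i)"
    \<comment> \<open>On the line through \<open>q\<close> and \<open>p i\<close>, the point
      \<open>?r\<close> is a multiple of \<open>(\<theta> i \<cdot> q) *s p i - q\<close>,
      harmonically conjugate to \<open>q + (\<theta> i \<cdot> q) *s p i\<close> with respect to
      \<open>q\<close> and \<open>p i\<close>. Such points are conjugate for every conic through
      \<open>q\<close> and \<open>p i\<close>, which is the required relation. Unlike the quadratic
      forms at \<open>q\<close>, these expressions do not both vanish at \<open>p i\<close>.\<close>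
    let ?a = "\<lambda>x. ?n x \<cdot> (P *v ?r x) + (\<theta> i \<cdot> ?n x) * (p i \<cdot> (P *v ?r x))"
    let ?b = "\<lambda>x. ?n x \<cdot> (Q *v ?r x) + (\<theta> i \<cdot> ?n x) * (p i \<cdot> (Q *v ?r x))"
    let ?d = "(\<lambda>j :: 4 option. if j = None then 1 else 0 :: nat) + (\<lambda>j. if j = Some i then 1 else 0)"
    have vr: "vhom (\<lambda>j. if j = Some i then 1 else 0) ?r"
      by (intro vhom_ccross_const vhom_coordinate)
    have "multihomogeneous ?d ?a" "multihomogeneous ?d ?b"
      by (intro multihomogeneous_add multihomogeneous_mult vhom_cdot vhom_cdot_const vhom_matrix vn vr)+
    moreover have "(?a x, ?b x) \<noteq> (0, 0)" if x: "represents x S0" for x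
    proof -
      obtain k where k: "k \<noteq> 0" "x $ None = k *s q0" using rep[OF x[unfolded c0(2)]] by blast
      have "c \<noteq> 0" using q0 nz0 by auto
      obtain k' where "x $ Some i = k' *s side i q0 \<kappa>0 \<alpha>0" using rep_side[OF x[unfolded c0(2)]] by blast
      moreover have "x $ Some i \<noteq> 0" using x by (simp add: represents_def)
      ultimately have "(p i \<cdot> (P *v ?r x), p i \<cdot> (Q *v ?r x)) \<noteq> (0, 0)"
        using side_incident(2)[OF c0(1)] by (intro chord_direction_nonzero) simp_all
      moreover have "?a x = (2 * (k * c)) * (p i \<cdot> (P *v ?r x))" "?b x = (2 * (k * c)) * (p i \<cdot> (Q *v ?r x))"
        by (simp_all add: k(2) q0 theta algebra_simps)
      ultimately show ?thesis using k(1) \<open>c \<noteq> 0\<close> by auto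
    qed
    moreover have "\<alpha> * ?a x = \<kappa> * ?b x" if con: "conic q \<kappa> \<alpha>" and x: "represents x (blowup_point q \<kappa> \<alpha>)" for q \<kappa> \<alpha> x
    proof -
      obtain k where k: "x $ None = k *s q" using rep[OF x] by blast
      obtain l where l: "x $ Some i = l *s side i q \<kappa> \<alpha>" using rep_side[OF x] by blast
      have "\<alpha> * ?a x - \<kappa> * ?b x = k * (q \<cdot> grad \<kappa> \<alpha> (?r x) + (\<theta> i \<cdot> q) * (p i \<cdot> grad \<kappa> \<alpha> (?r x)))"
        by (simp add: k grad_def algebra_simps)
      also have "q \<cdot> grad \<kappa> \<alpha> (?r x) + (\<theta> i \<cdot> q) * (p i \<cdot> grad \<kappa> \<alpha> (?r x)) = 0"
      proof (cases "ccross q (p i) = 0")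
        case False
        have r: "?r x = l *s ((\<theta> i \<cdot> q) *s p i - q)"
        proof -
          have "ccross (ccross q (p i)) (\<theta> i) = (\<theta> i \<cdot> q) *s p i - (\<theta> i \<cdot> p i) *s q"
            by (simp add: vec_eq_iff forall_3 cdot_3 algebra_simps)
          then show ?thesis using False by (simp add: l side_def ccross_linear theta)
        qed
        show ?thesis
          using grad_conic[OF con] grad_p[of i \<kappa> \<alpha>] grad_sym[of q \<kappa> \<alpha> "p i"]
          unfolding r by (simp add: grad_linear algebra_simps)
      next
        case True
        then obtain d where d: "q = d *s p i" using parallel_p by blast
        have "x $ Some i = (l * (2 * d)) *s grad \<kappa> \<alpha> (p i)"
          using True by (simp add: l side_def d chord_p)
        then have "p i \<cdot> grad \<kappa> \<alpha> (?r x) = 0"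
          unfolding grad_sym[of "p i" \<kappa> \<alpha>] using ccross_incident(1)[of "grad \<kappa> \<alpha> (p i)" "\<theta> i"]
          by (simp add: ccross_linear)
        then show ?thesis by (simp add: d)
      qed
      finally show ?thesis by simp
    qed
    ultimately show ?thesis by blast
  qed
  then obtain d a b where hom: "multihomogeneous d a" "multihomogeneous d b"
    and nz: "\<And>x. represents x S0 \<Longrightarrow> (a x, b x) \<noteq> (0, 0)"
    and ratio: "\<And>q \<kappa> \<alpha> x. conic q \<kappa> \<alpha> \<Longrightarrow> represents x (blowup_point q \<kappa> \<alpha>) \<Longrightarrow> \<alpha> * a x = \<kappa> * b x"
    by blast
  define F where "F = (\<lambda>(_ :: unit) x. \<Psi> (?n x) (a x) (b x))"
  have "\<forall>j. \<exists>d. \<forall>k. multihomogeneous d (\<lambda>x. F j x $ k)"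
    using vhom_Psi[OF hom vn] unfolding vhom_def F_def by blast
  moreover have "F j x \<noteq> 0" if x: "represents x S0" for x j
  proof -
    have "x $ None \<noteq> 0" using x by (simp add: represents_def)
    then show ?thesis using Psi_nonzero nz[OF x] by (simp add: F_def)
  qed
  moreover have "F j x \<in> of_blowup S j" if S: "S \<in> plane_blowup points" and x: "represents x S" for S x j
  proof -
    obtain q \<kappa> \<alpha> where c: "conic q \<kappa> \<alpha>" "S = blowup_point q \<kappa> \<alpha>" using plane_blowup_cases[OF S] by blast
    obtain k where k: "x $ None = k *s q" using rep[OF x[unfolded c(2)]] by blast
    obtain t where t: "a x = t * \<kappa>" "b x = t * \<alpha>"
      using proportional ratio[OF c(1)] x c by (metis conic_def)
    have "F j x = (k * t) *s \<Psi> q \<kappa> \<alpha>" by (simp add: F_def k t Psi_scale)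
    then show ?thesis using of_blowup[OF c(1)] c(2) by (simp add: vec.span_scale vec.span_base)
  qed
  ultimately show "\<exists>F :: unit \<Rightarrow> complex^3^(4 option) \<Rightarrow> complex^(2 \<Rightarrow> 4).
      (\<forall>j. \<exists>d. \<forall>k. multihomogeneous d (\<lambda>x. F j x $ k)) \<and>
      (\<forall>x. represents x S0 \<longrightarrow> (\<forall>j. F j x \<noteq> 0)) \<and>
      (\<forall>S\<in>plane_blowup points. \<forall>y. represents y S \<and> (\<forall>j. F j y \<noteq> 0) \<longrightarrow> (\<forall>j. F j y \<in> of_blowup S j))"
    by (intro exI[of _ F]) blast
qed

lemma del_pezzo_surface: "del_pezzo_degree_5 (surface_of_2dim_subalgebras m)"
proof -
  have "of_blowup (to_blowup Pt) = Pt" if Pt: "Pt \<in> surface_of_2dim_subalgebras m" for Pt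
    using Pt unfolding surface_Psi by (auto simp: to_blowup of_blowup)
  moreover have "to_blowup (of_blowup S) = S" if S: "S \<in> plane_blowup points" for S
  proof -
    obtain q \<kappa> \<alpha> where "conic q \<kappa> \<alpha>" "S = blowup_point q \<kappa> \<alpha>" using plane_blowup_cases[OF S] by blast
    then show ?thesis by (simp add: to_blowup of_blowup)
  qed
  ultimately have "isomorphic_varieties (surface_of_2dim_subalgebras m) (plane_blowup points)"
    unfolding isomorphic_varieties_def using regular_to_blowup regular_of_blowup by blast
  then show ?thesis
    unfolding del_pezzo_degree_5_def using projective_variety_surface generic_points by blast
qed

end

theorem del_pezzo:
  assumes alt: "alternating m" and nd: "nondegenerate m"
  shows "del_pezzo_degree_5 (surface_of_2dim_subalgebras m)"
proof -
  obtain f where f: "f \<noteq> 0" "sub_covector m f" using exists_sub_covector[OF alt] by blast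
  obtain g :: "complex^4^4" where g: "invertible g" "axis 4 1 v* g = f"
    using complete_row[OF f(1)] by blast
  have alt': "alternating (gl_act g m)" and nd': "nondegenerate (gl_act g m)"
    using alternating_gl_act[OF alt] nondegenerate_gl_act[OF g(1) nd] by auto
  have "sub_covector (gl_act g m) (axis 4 1)" using f(2) by (simp add: sub_covector_gl_act[OF g(1)] g(2))
  then obtain N R \<rho> where b: "gl_act g m = block_algebra N R \<rho>" using block_algebra_exists[OF alt'] by blast
  note alt'' = alt'[unfolded b] and nd'' = nd'[unfolded b]
  define L where "L = matrix_inv (N + skew \<rho>)"
  have tv: "transversal (sym_part L) (sym_part (L ** R))"
    unfolding L_def by (rule transversal_block(1)[OF alt'' nd''])
  obtain p :: "4 \<Rightarrow> complex^3" where
    "\<And>x. x \<cdot> (sym_part L *v x) = 0 \<and> x \<cdot> (sym_part (L ** R) *v x) = 0 \<longleftrightarrow> (\<exists>i c. x = c *s p i)"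
    "\<And>i j l a b c. i \<noteq> j \<Longrightarrow> j \<noteq> l \<Longrightarrow> i \<noteq> l \<Longrightarrow> a *s p i + b *s p j + c *s p l = 0 \<Longrightarrow> a = 0 \<and> b = 0 \<and> c = 0"
    using pencil_points[OF tv] by blast
  then interpret pencil_surface m g N R \<rho> p "N + skew \<rho>" L "sym_part L" "sym_part (L ** R)"
    using g(1) b alt'' invertible_block[OF alt'' nd''] tv by unfold_locales (auto simp: L_def)
  show ?thesis by (rule del_pezzo_surface)
qed

theorem theorem4:
  fixes A :: alg
  assumes "A \<in> zero_trace_algebras"
    and "regular_algebra A"
  shows "(card (subalgebras_of_dim A 3) = 5 \<and>
          generic_five_hyperplanes (subalgebras_of_dim A 3) \<and>
          (\<exists>g. invertible g \<and> subalgebras_of_dim (gl_act g A) 3 = sylvester_pentahedron)) \<and>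
         (\<nexists>I. alg_ideal A I \<and> (vec.dim I = 1 \<or> vec.dim I = 2)) \<and>
         del_pezzo_degree_5 (surface_of_2dim_subalgebras A) \<and>
         card (alg_fans A) = 10"
proof -
  have reg: "E_regular A" using assms(2) by (simp add: regular_algebra_def)
  note alt = alternating_zero_trace[OF assms(1)] and nd = E_regular_nondegenerate[OF reg]
  show ?thesis
    using three_dim_subalgebras[OF alt nd] no_small_ideals[OF alt nd] del_pezzo[OF alt nd]
      ten_fans[OF alt nd] by blast
qed

end
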